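(* Let $\alpha\ge 0$, $\alpha\neq 1$. Suppose $g$ is a non-CSC HCMU metric (with finite area and finite Calabi energy) on the K-surface $S^{2}_{\{\alpha\}}$, and let $K$ be the Gaussian curvature of $g$. Then the following classification holds. (1) If the singularity is an extremal point of $K$, then $g$ is a rotationally symmetric metric that is uniquely determined by the total area and the angle $2\pi\alpha$. Explicitly, if $0\le\alpha<1$, the singularity is the minimum point of $K$; if $\alpha>1$, the singularity is the maximum point of $K$. (2) If the singularity is the saddle point of $K$, then $\alpha$ is an integer with $\alpha\ge 2$, and $K$ has $I_{1}\geq 1$ maximum points and $I_{2}\geq 1$ minimum points, where $I_{1}$ and $I_{2}$ satisfy $I_{1}>I_{2}$, $I_{1}+I_{2}=\alpha+1$, and one of the following conditions holds: (2-1) $I_{2}=1$; (2-2) $I_{2}\geq 2$ and $I_{2}\nmid I_{1}$.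
   Context: K-surface: for $\alpha_1,\dots,\alpha_N\in[0,\infty)\setminus\{1\}$, $S^2_{\{\alpha_1,\dots,\alpha_N\}}$ denotes the Riemann sphere $S^2=\mathbb{C}\cup\{\infty\}$ with $N$ distinct marked points $p_1,\dots,p_N$, where a metric on it is understood to be a smooth conformal metric on $S^2\setminus\{p_1,\dots,p_N\}$ having a singularity of singular angle $2\pi\alpha_j$ at $p_j$ for each $j$. Singular angle: if in a local complex coordinate $z=re^{\sqrt{-1}\theta}$ centred at the point, on a punctured disk, $g=e^{2\psi}|dz|^2$, the singular angle is $2\pi\alpha$ ($\alpha\ge 0$) if $\lim_{r\to 0}\frac{1}{2\pi}\int_0^{2\pi}\left(r\frac{\partial\psi(r,\theta)}{\partial r}+1-\alpha\right)d\theta=0$. For $\alpha>0$ the point is called a conical singularity; for $\alpha=0$ it is called a (weak) cusp. HCMU metric: a conformal metric $g$ on $S^2\setminus\{p_1,\dots,p_N\}$ whose Gaussian curvature $K$ satisfies $K_{,zz}=0$, where $K_{,zz}$ is the $(2,0)$ part of the second covariant derivative of $K$; writing $g=e^{2\varphi}|dz|^2$ locally, this is $K_{zz}-2\varphi_zK_z=0$. Equivalently, $\nabla K=\sqrt{-1}e^{-2\varphi}K_{\bar z}\frac{\partial}{\partial z}$ is a holomorphic vector field there. Throughout it is assumed that $\int dg<+\infty$ and $\int K^2\,dg<+\infty$ over $S^2\setminus\{p_1,\dots,p_N\}$. Non-CSC means that $K$ is not constant. It is known that under these assumptions $K$ extends continuously to $S^2$. Maximum points and minimum points of $K$ are the points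 of $S^2$ at which this extension attains its global maximum $K_1$ and its global minimum $K_2$; extremal points are the maximum and minimum points. A saddle point of $K$ is a critical point (possibly a singularity of $g$, where $dK$ extends by $0$) that is not an extremal point. Rotationally symmetric means that, for some conformal identification of the sphere with $\mathbb{C}\cup\{\infty\}$, $g$ is invariant under $z\mapsto e^{\sqrt{-1}\theta}z$ for all real $\theta$. "Uniquely determined" by given data means: any two such metrics with the same data are isometric. *)

theory Defs
  imports "HOL-Analysis.Analysis"
begin

section \<open>The Riemann sphere\<close>

text \<open>The sphere is the one-point compactification of the complex plane, with \<^term>\<open>None\<close> as the
  point at infinity and the standard atlas of two charts z and w = 1/z.
  The map param c is the inverse of the chart c and coord c is the chart itself; coord c q is
  meaningful only for q in the range of param c.\<close>

type_synonym sphere = "complex option"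

definition riemann_sphere :: "sphere topology" where
  "riemann_sphere = Alexandroff_compactification euclidean"

datatype chart = Std | Inf

fun param :: "chart \<Rightarrow> complex \<Rightarrow> sphere" where
  "param Std z = Some z"
| "param Inf w = (if w = 0 then None else Some (1 / w))"

fun coord :: "chart \<Rightarrow> sphere \<Rightarrow> complex" where
  "coord Std (Some z) = z"
| "coord Std None = 0"
| "coord Inf (Some z) = 1 / z"
| "coord Inf None = 0"

definition local_rep :: "(sphere \<Rightarrow> sphere) \<Rightarrow> chart \<Rightarrow> chart \<Rightarrow> complex \<Rightarrow> complex" where
  "local_rep F c d z = coord d (F (param c z))"

definition biholomorphic_sphere :: "(sphere \<Rightarrow> sphere) \<Rightarrow> bool" where
  "biholomorphic_sphere h \<longleftrightarrow>
     homeomorphic_map riemann_sphere riemann_sphere h \<and>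
     (\<forall>c d. local_rep h c d holomorphic_on {z. h (param c z) \<in> range (param d)})"

definition rotation :: "real \<Rightarrow> sphere \<Rightarrow> sphere" where
  "rotation \<theta> = map_option (\<lambda>z. cis \<theta> * z)"

section \<open>Differential operators in a chart\<close>

text \<open>Real smoothness; the set S is understood to be open.\<close>

fun k_times_differentiable_on ::
  "nat \<Rightarrow> 'a::real_normed_vector set \<Rightarrow> ('a \<Rightarrow> 'b::real_normed_vector) \<Rightarrow> bool" where
  "k_times_differentiable_on 0 S f \<longleftrightarrow> continuous_on S f"
| "k_times_differentiable_on (Suc k) S f \<longleftrightarrow>
     (\<forall>x\<in>S. f differentiable (at x)) \<and>
     (\<forall>v. k_times_differentiable_on k S (\<lambda>x. frechet_derivative f (at x) v))"

definition smooth_on ::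
  "'a::real_normed_vector set \<Rightarrow> ('a \<Rightarrow> 'b::real_normed_vector) \<Rightarrow> bool" where
  "smooth_on S f \<longleftrightarrow> (\<forall>k. k_times_differentiable_on k S f)"

definition laplacian :: "(complex \<Rightarrow> real) \<Rightarrow> complex \<Rightarrow> real" where
  "laplacian f z =
     frechet_derivative (\<lambda>w. frechet_derivative f (at w) 1) (at z) 1 +
     frechet_derivative (\<lambda>w. frechet_derivative f (at w) \<i>) (at z) \<i>"

text \<open>The Wirtinger derivative, the operator (d/dx - i d/dy)/2.\<close>

definition wirtinger :: "(complex \<Rightarrow> complex) \<Rightarrow> complex \<Rightarrow> complex" where
  "wirtinger f z =
     (frechet_derivative f (at z) 1 - \<i> * frechet_derivative f (at z) \<i>) / 2"

section \<open>Conformal metrics on the sphere with one marked point\<close>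

text \<open>A conformal metric g is given by its local expressions exp(2 g c) |dz|^2 in the two charts.
  In everything below p is the marked point, and values of g at p are irrelevant. The relation
  between the two expressions is the transformation law under w = 1/z, where |dw| = |dz|/|z|^2.\<close>

type_synonym conf_metric = "chart \<Rightarrow> complex \<Rightarrow> real"

definition smooth_conformal_metric :: "sphere \<Rightarrow> conf_metric \<Rightarrow> bool" where
  "smooth_conformal_metric p g \<longleftrightarrow>
     (\<forall>c. smooth_on {z. param c z \<noteq> p} (g c)) \<and>
     (\<forall>z. z \<noteq> 0 \<and> Some z \<noteq> p \<longrightarrow> g Inf (1 / z) = g Std z + 2 * ln (norm z))"

text \<open>A local complex coordinate centred at p is given by its inverse, an injective holomorphic
  map h of a disk into a chart c. In it g reads exp(2 psi) |dz|^2 with the psi below.\<close>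

definition has_singular_angle :: "sphere \<Rightarrow> conf_metric \<Rightarrow> real \<Rightarrow> bool" where
  "has_singular_angle p g \<alpha> \<longleftrightarrow>
     (\<exists>c \<rho> h. \<rho> > 0 \<and> h holomorphic_on ball 0 \<rho> \<and> inj_on h (ball 0 \<rho>) \<and> param c (h 0) = p \<and>
        (let \<psi> = (\<lambda>z. g c (h z) + ln (norm (deriv h z))) in
         ((\<lambda>r. 1 / (2 * pi) *
               integral {0..2 * pi}
                 (\<lambda>\<theta>. r * deriv (\<lambda>s. \<psi> (of_real s * cis \<theta>)) r + 1 - \<alpha>))
          \<longlongrightarrow> 0) (at_right 0)))"

definition chart_curv :: "(complex \<Rightarrow> real) \<Rightarrow> complex \<Rightarrow> real" where
  "chart_curv \<phi> z = - exp (- 2 * \<phi> z) * laplacian \<phi> z"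

text \<open>The Gaussian curvature is a scalar, so either chart may be used at each point.\<close>

fun gauss_curv :: "conf_metric \<Rightarrow> sphere \<Rightarrow> real" where
  "gauss_curv g (Some z) = chart_curv (g Std) z"
| "gauss_curv g None = chart_curv (g Inf) 0"

definition hcmu_equation :: "sphere \<Rightarrow> conf_metric \<Rightarrow> bool" where
  "hcmu_equation p g \<longleftrightarrow>
     (\<forall>c z. param c z \<noteq> p \<longrightarrow>
        (let K = (\<lambda>z. complex_of_real (gauss_curv g (param c z)));
             \<phi> = (\<lambda>z. complex_of_real (g c z))
         in wirtinger (wirtinger K) z - 2 * wirtinger \<phi> z * wirtinger K z = 0))"

text \<open>The area form is exp(2 g) dx dy. Integrals over the punctured sphere are computed in the chart
  z, which misses at most the single point at infinity.\<close>

definition finite_area :: "sphere \<Rightarrow> conf_metric \<Rightarrow> bool" where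
  "finite_area p g \<longleftrightarrow>
     set_integrable lborel {z. Some z \<noteq> p} (\<lambda>z. exp (2 * g Std z))"

definition total_area :: "sphere \<Rightarrow> conf_metric \<Rightarrow> real" where
  "total_area p g = (LINT z:{z. Some z \<noteq> p}|lborel. exp (2 * g Std z))"

definition finite_calabi_energy :: "sphere \<Rightarrow> conf_metric \<Rightarrow> bool" where
  "finite_calabi_energy p g \<longleftrightarrow>
     set_integrable lborel {z. Some z \<noteq> p} (\<lambda>z. (gauss_curv g (Some z))\<^sup>2 * exp (2 * g Std z))"

definition non_csc :: "sphere \<Rightarrow> conf_metric \<Rightarrow> bool" where
  "non_csc p g \<longleftrightarrow> \<not> (\<exists>k. \<forall>q. q \<noteq> p \<longrightarrow> gauss_curv g q = k)"

definition non_csc_hcmu :: "sphere \<Rightarrow> real \<Rightarrow> conf_metric \<Rightarrow> bool" where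
  "non_csc_hcmu p \<alpha> g \<longleftrightarrow>
     smooth_conformal_metric p g \<and> has_singular_angle p g \<alpha> \<and> hcmu_equation p g \<and>
     finite_area p g \<and> finite_calabi_energy p g \<and> non_csc p g"

section \<open>Extremal points and saddle points of the curvature\<close>

text \<open>The continuous extension of K over the marked point. For HCMU metrics of finite area and finite
  Calabi energy the limit exists.\<close>

definition curv_ext :: "sphere \<Rightarrow> conf_metric \<Rightarrow> sphere \<Rightarrow> real" where
  "curv_ext p g q =
     (if q = p then Lim (atin riemann_sphere p) (gauss_curv g) else gauss_curv g q)"

definition max_points :: "sphere \<Rightarrow> conf_metric \<Rightarrow> sphere set" where
  "max_points p g = {q. \<forall>q'. curv_ext p g q' \<le> curv_ext p g q}"

definition min_points :: "sphere \<Rightarrow> conf_metric \<Rightarrow> sphere set" where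
  "min_points p g = {q. \<forall>q'. curv_ext p g q \<le> curv_ext p g q'}"

definition extremal_points :: "sphere \<Rightarrow> conf_metric \<Rightarrow> sphere set" where
  "extremal_points p g = max_points p g \<union> min_points p g"

text \<open>At the marked point, being critical means that the one-form dK extends continuously by 0.\<close>

definition critical_points :: "sphere \<Rightarrow> conf_metric \<Rightarrow> sphere set" where
  "critical_points p g =
     {q. \<exists>c a. param c a = q \<and>
        (let K = (\<lambda>z. gauss_curv g (param c z)) in
         if q = p then \<forall>v. ((\<lambda>z. frechet_derivative K (at z) v) \<longlongrightarrow> 0) (at a)
         else (K has_derivative (\<lambda>v. 0)) (at a))}"

definition saddle_points :: "sphere \<Rightarrow> conf_metric \<Rightarrow> sphere set" where
  "saddle_points p g = critical_points p g - extremal_points p g"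

section \<open>Isometries\<close>

text \<open>A diffeomorphism F between the punctured spheres, of either orientation, that pulls the second
  metric back to the first: the length of dF(v) equals the length of v. Smoothness of the inverse is
  automatic, since this makes dF injective.\<close>

definition isometry :: "sphere \<Rightarrow> conf_metric \<Rightarrow> sphere \<Rightarrow> conf_metric \<Rightarrow> (sphere \<Rightarrow> sphere) \<Rightarrow> bool" where
  "isometry p g p' g' F \<longleftrightarrow>
     homeomorphic_map (subtopology riemann_sphere (- {p})) (subtopology riemann_sphere (- {p'})) F \<and>
     (\<forall>c d. let D = {z. param c z \<noteq> p \<and> F (param c z) \<in> range (param d)}; L = local_rep F c d in
        smooth_on D L \<and>
        (\<forall>z\<in>D. \<forall>v. exp (g' d (L z)) * norm (frechet_derivative L (at z) v) = exp (g c z) * norm v))"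

definition isometric :: "sphere \<Rightarrow> conf_metric \<Rightarrow> sphere \<Rightarrow> conf_metric \<Rightarrow> bool" where
  "isometric p g p' g' \<longleftrightarrow> (\<exists>F. isometry p g p' g' F)"

definition rotationally_symmetric :: "sphere \<Rightarrow> conf_metric \<Rightarrow> bool" where
  "rotationally_symmetric p g \<longleftrightarrow>
     (\<exists>h. biholomorphic_sphere h \<and> (\<forall>\<theta>. isometry p g p g (inv h \<circ> rotation \<theta> \<circ> h)))"

end

theory Submission
  imports Defs "HOL-Complex_Analysis.Complex_Analysis" "HOL-Computational_Algebra.Fundamental_Theorem_Algebra"
begin

text \<open>Move the marked point to infinity, so that the metric becomes exp(2 phi) |dz|^2 on the plane and
  f = exp(-2 phi) K_zbar is an entire function. The HCMU equation has the first integral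
  2 exp(2 phi) |f|^2 = P(K) with a cubic polynomial P, whose derivative gives f' at the zeros of f:
  these are simple, K takes there its maximum K1 with f' = -a or its minimum K2 with f' = b, where
  a > b. By finite area and Green's formula the means of ln (1 + |f|^2) grow at most
  logarithmically, so f is a polynomial by Liouville's theorem.

  If f = c Q1 Q2 has degree at least 2, where Q1 vanishes at the I1 maxima and Q2 at the I2 minima,
  then K tends to an intermediate value at infinity and the angle is read off from the degree.
  The polynomial a Q1 Q2' - b Q1' Q2 is constant, whence b I1 = a I2, and if I1 = k I2 then
  comparing Q1 with Q2^k gives I2 = 1. If f has degree 1, then K is a radial function obtained
  by integrating dK / P(K), infinity is an extremal point, and the angle and the area determine K1 and K2.\<close>

text \<open>The singular angle is an averaged condition, so nothing pointwise is known near the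
  marked point, and f might a priori have an essential singularity at infinity. Its growth is
  controlled by global quantities: ln (1 + |f|^2) \<le> - 2 phi + exp(2 phi) + const holds
  pointwise, and area means of phi are bounded below because the Laplacian - K exp(2 phi) is
  dominated by a multiple of the finite area density. This needs K bounded, hence a lower root of P,
  and that is shown by potential theory while f is still an arbitrary entire function. Once f is a
  polynomial, z times the derivative of phi has a genuine limit at infinity, and the averaged
  condition becomes an equation for the angle. P has no quadratic term, so its roots satisfy K0 + K1
  + K2 = 0, and K0 \<le> K2 < K1. Then a and b are (K1 - K2)/12 times K1 - K0 and K2 - K0, whence b
  < a; this asymmetry is behind I1 > I2 and behind the dichotomy of angles below and above
  1.\<close>

unbundle no fps_syntax

section \<open>Change of variables in the complex plane\<close>

text \<open>The change of variables theorem \<open>has_absolute_integral_change_of_variables\<close>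
  speaks about real^n, so integrals over the complex plane are transported along this linear
  isometry with inverse \<open>complex_vec\<close>.\<close>

definition vec_complex :: "real^2 \<Rightarrow> complex" where
  "vec_complex x = Complex (x $ 1) (x $ 2)"

definition complex_vec :: "complex \<Rightarrow> real^2" where
  "complex_vec z = (\<chi> i. if i = 1 then Re z else Im z)"

lemma vec_complex_inverse [simp]: "complex_vec (vec_complex x) = x"
  by (auto simp: complex_vec_def vec_complex_def vec_eq_iff forall_2)

lemma complex_vec_inverse [simp]: "vec_complex (complex_vec z) = z"
  by (auto simp: complex_vec_def vec_complex_def)

lemma inj_vec_complex: "inj vec_complex"
  by (metis injI vec_complex_inverse)

lemma linear_vec_complex: "linear vec_complex"
  by (rule linearI) (auto simp: vec_complex_def complex_eq_iff)

lemma linear_complex_vec: "linear complex_vec"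
  by (rule linearI) (auto simp: complex_vec_def vec_eq_iff)

lemma norm_vec_complex [simp]: "norm (vec_complex x) = norm x"
  by (simp add: vec_complex_def norm_vec_def L2_set_def sum_2 cmod_def)

lemma image_vec_complex: "vec_complex ` S = complex_vec -` S"
  by (force simp: image_iff intro: exI[of _ "complex_vec _"])

lemma image_complex_vec: "complex_vec ` S = vec_complex -` S"
  by (force simp: image_iff)

lemma cbox_complex_vec: "complex_vec ` cbox a b = cbox (complex_vec a) (complex_vec b)"
  unfolding image_complex_vec
  by (auto simp: mem_box_cart forall_2 complex_vec_def vec_complex_def in_cbox_complex_iff)

lemma cbox_vec_complex: "vec_complex ` cbox a b = cbox (vec_complex a) (vec_complex b)"
  unfolding image_vec_complex
  by (auto simp: mem_box_cart forall_2 complex_vec_def vec_complex_def in_cbox_complex_iff)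

lemma content_vec_complex: "measure lborel (cbox (vec_complex a) (vec_complex b)) = measure lborel (cbox a b)"
proof (cases "cbox a b = {}")
  case True
  then show ?thesis by (metis cbox_vec_complex image_empty content_empty)
next
  case False
  then have le: "a $ 1 \<le> b $ 1" "a $ 2 \<le> b $ 2"
    by (auto simp: interval_ne_empty_cart forall_2)
  have "measure lborel (cbox a b) = (b $ 1 - a $ 1) * (b $ 2 - a $ 2)"
    using False by (simp add: content_cbox_cart UNIV_2)
  moreover have "measure lborel (cbox (vec_complex a) (vec_complex b)) = (b $ 1 - a $ 1) * (b $ 2 - a $ 2)"
    using le by (subst content_cbox) (auto simp: vec_complex_def Basis_complex_def inner_complex_def)
  ultimately show ?thesis by simp
qed

lemma has_integral_vec_complex_cbox:
  fixes f :: "complex \<Rightarrow> real"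
  assumes "(f has_integral i) (cbox (vec_complex a) (vec_complex b))"
  shows "((f \<circ> vec_complex) has_integral i) (cbox a b)"
proof -
  have "((\<lambda>x. f (vec_complex x)) has_integral (1 / 1) *\<^sub>R i) (complex_vec ` cbox (vec_complex a) (vec_complex b))"
  proof (rule has_integral_twiddle[where g=vec_complex and h=complex_vec and r=1])
    show "continuous (at x) vec_complex" for x
      using linear_vec_complex linear_continuous_at linear_conv_bounded_linear by blast
    show "\<exists>w z. vec_complex ` cbox u v = cbox w z" for u v using cbox_vec_complex by blast
    show "\<exists>w z. complex_vec ` cbox u v = cbox w z" for u v using cbox_complex_vec by blast
    show "measure lborel (vec_complex ` cbox u v) = 1 * measure lborel (cbox u v)" for u v
      by (simp add: cbox_vec_complex content_vec_complex)
  qed (use assms in auto)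
  then show ?thesis by (simp add: cbox_complex_vec o_def)
qed

lemma has_integral_complex_vec_cbox:
  fixes f :: "real^2 \<Rightarrow> real"
  assumes "(f has_integral i) (cbox (complex_vec a) (complex_vec b))"
  shows "((f \<circ> complex_vec) has_integral i) (cbox a b)"
proof -
  have "((\<lambda>x. f (complex_vec x)) has_integral (1 / 1) *\<^sub>R i) (vec_complex ` cbox (complex_vec a) (complex_vec b))"
  proof (rule has_integral_twiddle[where g=complex_vec and h=vec_complex and r=1])
    show "continuous (at x) complex_vec" for x
      using linear_complex_vec linear_continuous_at linear_conv_bounded_linear by blast
    show "\<exists>w z. vec_complex ` cbox u v = cbox w z" for u v using cbox_vec_complex by blast
    show "\<exists>w z. complex_vec ` cbox u v = cbox w z" for u v using cbox_complex_vec by blast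
    show "measure lborel (complex_vec ` cbox u v) = 1 * measure lborel (cbox u v)" for u v
      by (simp add: cbox_complex_vec flip: content_vec_complex)
  qed (use assms in auto)
  then show ?thesis by (simp add: cbox_vec_complex o_def)
qed

lemma has_integral_vec_complex_cbox_iff:
  fixes f :: "complex \<Rightarrow> real"
  shows "((f \<circ> vec_complex) has_integral i) (cbox a b) \<longleftrightarrow> (f has_integral i) (cbox (vec_complex a) (vec_complex b))"
  using has_integral_vec_complex_cbox[of f i a b]
    has_integral_complex_vec_cbox[of "f \<circ> vec_complex" i "vec_complex a" "vec_complex b"]
  by (auto simp: o_def)

text \<open>Integrals over general sets are tested on boxes that contain a large ball. The isometry
  carries boxes to boxes and centred balls to centred balls, which leaves only the case of a
  box.\<close>

lemma has_integral_vec_complex: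
  fixes f :: "complex \<Rightarrow> real"
  shows "((f \<circ> vec_complex) has_integral i) S \<longleftrightarrow> (f has_integral i) (vec_complex ` S)"
proof -
  have eq: "(\<lambda>x. if x \<in> S then (f \<circ> vec_complex) x else 0) =
            (\<lambda>x. if x \<in> vec_complex ` S then f x else 0) \<circ> vec_complex"
    by (auto simp: fun_eq_iff inj_vec_complex inj_image_mem_iff)
  have ball: "ball 0 B \<subseteq> cbox a b \<longleftrightarrow> ball 0 B \<subseteq> cbox (vec_complex a) (vec_complex b)" for B a b
  proof -
    have "vec_complex ` ball 0 B = ball 0 B"
      unfolding image_vec_complex by (auto, metis complex_vec_inverse norm_vec_complex, metis complex_vec_inverse norm_vec_complex)
    then show ?thesis
      by (metis cbox_vec_complex inj_image_subset_iff inj_vec_complex)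
  qed
  have all: "(\<forall>a b::real^2. P (vec_complex a) (vec_complex b)) \<longleftrightarrow> (\<forall>a b. P a b)" for P
  proof safe
    fix a b assume "\<forall>a b::real^2. P (vec_complex a) (vec_complex b)"
    then have "P (vec_complex (complex_vec a)) (vec_complex (complex_vec b))" by blast
    then show "P a b" by simp
  qed auto
  show ?thesis
    unfolding has_integral'[of _ _ S] has_integral'[of _ _ "vec_complex ` S"] eq has_integral_vec_complex_cbox_iff ball
    by (subst all) simp
qed

lemma absolutely_integrable_vec_complex:
  fixes f :: "complex \<Rightarrow> real"
  shows "((f \<circ> vec_complex) absolutely_integrable_on S \<and> integral S (f \<circ> vec_complex) = b) \<longleftrightarrow>
     (f absolutely_integrable_on (vec_complex ` S) \<and> integral (vec_complex ` S) f = b)"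
proof -
  have 1: "(f \<circ> vec_complex) integrable_on S \<longleftrightarrow> f integrable_on (vec_complex ` S)" for f :: "complex \<Rightarrow> real"
    by (simp add: integrable_on_def has_integral_vec_complex)
  have 2: "integral S (f \<circ> vec_complex) = integral (vec_complex ` S) f"
    by (simp add: integral_def 1 has_integral_vec_complex)
  show ?thesis
    unfolding absolutely_integrable_on_def 2 using 1[of f] 1[of "\<lambda>x. norm (f x)"] by (auto simp: o_def)
qed

text \<open>The factor in front of f is the absolute determinant of the real 2x2 matrix with columns
  D z 1 and D z i. The equivalence form gives integrability and the value of the integral in both
  directions at once.\<close>

theorem complex_change_of_variables:
  fixes f :: "complex \<Rightarrow> real"
  assumes S: "open S" and h: "\<And>z. z \<in> S \<Longrightarrow> (h has_derivative D z) (at z)" and inj: "inj_on h S"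
  shows "((\<lambda>z. \<bar>Re (D z 1) * Im (D z \<i>) - Im (D z 1) * Re (D z \<i>)\<bar> * f (h z)) absolutely_integrable_on S \<and>
          integral S (\<lambda>z. \<bar>Re (D z 1) * Im (D z \<i>) - Im (D z 1) * Re (D z \<i>)\<bar> * f (h z)) = b) \<longleftrightarrow>
         (f absolutely_integrable_on (h ` S) \<and> integral (h ` S) f = b)"
proof -
  define g where "g = complex_vec \<circ> h \<circ> vec_complex"
  define S' where "S' = complex_vec ` S"
  define D' where "D' = (\<lambda>x. complex_vec \<circ> D (vec_complex x) \<circ> vec_complex)"
  have S'2: "vec_complex ` S' = S" unfolding S'_def by (force simp: image_image)
  have gS: "vec_complex ` g ` S' = h ` S" unfolding S'_def g_def by (force simp: image_image)
  have oS: "open S'"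
    unfolding S'_def image_complex_vec
    by (rule open_vimage[OF S]) (use linear_vec_complex linear_continuous_on linear_conv_bounded_linear in blast)
  have der: "(g has_derivative D' x) (at x within S')" if "x \<in> S'" for x
  proof -
    have 1: "(h has_derivative D (vec_complex x)) (at (vec_complex x))" using that S'2 h by blast
    have 2: "(vec_complex has_derivative vec_complex) (at x)"
      using linear_vec_complex by (simp add: bounded_linear_imp_has_derivative linear_linear)
    have 3: "(complex_vec has_derivative complex_vec) (at y)" for y
      using linear_complex_vec by (simp add: bounded_linear_imp_has_derivative linear_linear)
    have "(g has_derivative D' x) (at x)"
      unfolding g_def D'_def
      by (rule diff_chain_at[OF 2]) (rule diff_chain_at[OF 1 3])
    then show ?thesis by (rule has_derivative_at_withinI)
  qed
  have injg: "inj_on g S'"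
    using inj unfolding inj_on_def g_def S'_def by (auto; metis complex_vec_inverse)
  have ax: "vec_complex (axis 1 1) = 1" "vec_complex (axis 2 1) = \<i>"
    by (auto simp: vec_complex_def axis_def complex_eq_iff)
  have det: "det (matrix (D' x)) = Re (D (vec_complex x) 1) * Im (D (vec_complex x) \<i>)
       - Im (D (vec_complex x) 1) * Re (D (vec_complex x) \<i>)" for x
    by (simp add: det_2 matrix_def D'_def complex_vec_def ax)
  have "((\<lambda>z. \<bar>Re (D z 1) * Im (D z \<i>) - Im (D z 1) * Re (D z \<i>)\<bar> * f (h z)) absolutely_integrable_on S \<and>
          integral S (\<lambda>z. \<bar>Re (D z 1) * Im (D z \<i>) - Im (D z 1) * Re (D z \<i>)\<bar> * f (h z)) = b) \<longleftrightarrow>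
     ((\<lambda>x. \<bar>det (matrix (D' x))\<bar> * (f \<circ> vec_complex) (g x)) absolutely_integrable_on S' \<and>
          integral S' (\<lambda>x. \<bar>det (matrix (D' x))\<bar> * (f \<circ> vec_complex) (g x)) = b)"
    unfolding S'2[symmetric] det
    by (subst absolutely_integrable_vec_complex[symmetric]) (simp add: o_def g_def)
  \<comment> \<open>The theorem for real^n is applied to functions into real^1; \<open>vec\<close>
    converts between those and real functions.\<close>
  also have "\<dots> \<longleftrightarrow> ((\<lambda>x. \<bar>det (matrix (D' x))\<bar> *\<^sub>R (vec ((f \<circ> vec_complex) (g x)) :: real^1)) absolutely_integrable_on S' \<and>
          integral S' (\<lambda>x. \<bar>det (matrix (D' x))\<bar> *\<^sub>R (vec ((f \<circ> vec_complex) (g x)) :: real^1)) = vec b)"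
    by (simp add: absolutely_integrable_on_1_iff integral_on_1_eq)
  also have "\<dots> \<longleftrightarrow> ((\<lambda>x. vec ((f \<circ> vec_complex) x) :: real^1) absolutely_integrable_on (g ` S') \<and>
          integral (g ` S') (\<lambda>x. vec ((f \<circ> vec_complex) x) :: real^1) = vec b)"
    by (rule has_absolute_integral_change_of_variables[OF _ der injg]) (use oS lborelD_Collect in auto)
  also have "\<dots> \<longleftrightarrow> ((f \<circ> vec_complex) absolutely_integrable_on (g ` S') \<and>
          integral (g ` S') (f \<circ> vec_complex) = b)"
    by (simp add: absolutely_integrable_on_1_iff integral_on_1_eq o_def)
  also have "\<dots> \<longleftrightarrow> (f absolutely_integrable_on (h ` S) \<and> integral (h ` S) f = b)"
    unfolding gS[symmetric] by (rule absolutely_integrable_vec_complex)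
  finally show ?thesis .
qed

corollary holomorphic_change_of_variables:
  fixes f :: "complex \<Rightarrow> real"
  assumes S: "open S" and h: "h holomorphic_on S" and inj: "inj_on h S"
  shows "((\<lambda>z. (norm (deriv h z))\<^sup>2 * f (h z)) absolutely_integrable_on S \<and>
          integral S (\<lambda>z. (norm (deriv h z))\<^sup>2 * f (h z)) = b) \<longleftrightarrow>
         (f absolutely_integrable_on (h ` S) \<and> integral (h ` S) f = b)"
proof -
  have "(h has_derivative (\<lambda>v. deriv h z * v)) (at z)" if "z \<in> S" for z
    using holomorphic_derivI[OF h S that] by (simp add: has_field_derivative_def)
  moreover have "\<bar>Re (deriv h z * 1) * Im (deriv h z * \<i>) - Im (deriv h z * 1) * Re (deriv h z * \<i>)\<bar>
       = (norm (deriv h z))\<^sup>2" for z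
    unfolding cmod_power2 by (simp add: power2_eq_square)
  ultimately show ?thesis
    using complex_change_of_variables[OF S _ inj, of "\<lambda>z v. deriv h z * v" f b] by simp
qed

section \<open>Polar coordinates\<close>

lemma has_integral_complex_Pair:
  fixes f :: "complex \<Rightarrow> real"
  assumes "(f has_integral i) (cbox a b)"
  shows "((\<lambda>(x, y). f (Complex x y)) has_integral i) (cbox (Re a, Im a) (Re b, Im b))"
proof -
  let ?g = "\<lambda>p::real \<times> real. Complex (fst p) (snd p)" and ?h = "\<lambda>z. (Re z, Im z)"
  have hi: "?h ` S = ?g -` S" for S by (force simp: image_iff)
  have gi: "?g ` S = ?h -` S" for S by (force simp: image_iff intro: exI[of _ "?h _"])
  have hc: "?h ` cbox u v = cbox (?h u) (?h v)" for u v
    unfolding hi by (auto simp: in_cbox_complex_iff)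
  have gc: "?g ` cbox u v = cbox (?g u) (?g v)" for u v
    unfolding gi by (cases u, cases v) (auto simp: in_cbox_complex_iff)
  have "((\<lambda>p. f (?g p)) has_integral (1 / 1) *\<^sub>R i) (?h ` cbox a b)"
  proof (rule has_integral_twiddle[where g="?g" and h="?h" and r=1])
    show "continuous (at x) ?g" for x by (auto intro!: continuous_intros simp: Complex_eq)
    show "\<exists>w z. ?g ` cbox u v = cbox w z" for u v using gc by blast
    show "\<exists>w z. ?h ` cbox u v = cbox w z" for u v using hc by blast
    show "measure lborel (?g ` cbox u v) = 1 * measure lborel (cbox u v)" for u v
    proof (cases "cbox u v = {}")
      case False
      then have le: "fst u \<le> fst v" "snd u \<le> snd v" by (cases u; cases v; auto simp: cbox_Pair_eq)+
      have "measure lborel (cbox u v) = (fst v - fst u) * (snd v - snd u)"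
        using le by (cases u, cases v) (simp add: content_Pair)
      then show ?thesis unfolding gc
        using le by (subst content_cbox) (auto simp: Basis_complex_def inner_complex_def)
    qed simp
  qed (use assms in auto)
  then show ?thesis by (simp add: hc case_prod_unfold)
qed

text \<open>The polar map has Jacobian |Re w| and is injective on the open rectangle of radii and
  angles; Fubini on the closed rectangle then separates the two variables.\<close>

lemma polar_integral_ball:
  fixes u :: "complex \<Rightarrow> real"
  assumes u: "continuous_on UNIV u" and R: "R > 0"
  shows "integral (ball c R) u = integral {0..R} (\<lambda>r. r * integral {0..2*pi} (\<lambda>\<theta>. u (c + of_real r * cis \<theta>)))"
proof -
  define S where "S = box 0 (Complex R (2*pi))"
  define h where "h = (\<lambda>w. c + of_real (Re w) * cis (Im w))"
  define D where "D = (\<lambda>w v. of_real (Re v) * cis (Im w) + of_real (Re w) * (of_real (Im v) * (\<i> * cis (Im w))))"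
  have S: "z \<in> S \<longleftrightarrow> 0 < Re z \<and> Re z < R \<and> 0 < Im z \<and> Im z < 2 * pi" for z
    by (auto simp: S_def in_box_complex_iff)
  have der: "(h has_derivative D w) (at w)" for w
    unfolding h_def D_def
    by (auto intro!: derivative_eq_intros simp: fun_eq_iff scaleR_conv_of_real)
  have jac: "\<bar>Re (D w 1) * Im (D w \<i>) - Im (D w 1) * Re (D w \<i>)\<bar> = \<bar>Re w\<bar>" for w
  proof -
    have "Re (D w 1) * Im (D w \<i>) - Im (D w 1) * Re (D w \<i>) = Re w * (cos (Im w) * cos (Im w) + sin (Im w) * sin (Im w))"
      unfolding distrib_left by (simp add: D_def mult_ac)
    then show ?thesis by simp
  qed
  have inj: "inj_on h S"
  proof (rule inj_onI)
    fix w v assume w: "w \<in> S" "v \<in> S" and eq: "h w = h v"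
    then have "of_real (Re w) * cis (Im w) = of_real (Re v) * cis (Im v)" by (simp add: h_def)
    then have "rcis (Re w) (Im w) = rcis (Re v) (Im v)" by (simp add: rcis_def)
    moreover from this have "Re w = Re v" using w unfolding S by (metis abs_of_pos complex_mod_rcis)
    ultimately have "cis (Im w) = cis (Im v)" using w by (auto simp: rcis_def S)
    then have "Im w = Im v" using w unfolding S
      by (metis Arg2pi_unique cis_conv_exp mult.commute mult_1 of_real_1 zero_less_one less_eq_real_def)
    with \<open>Re w = Re v\<close> show "w = v" by (simp add: complex_eq_iff)
  qed
  \<comment> \<open>The open rectangle misses the angle 0, so its image is the ball without one
    radius. That radius lies on the horizontal line through c, a null set.\<close>
  define N where "N = {z::complex. Im z = Im c}"
  have N: "negligible N"
    using negligible_standard_hyperplane[of \<i> "Im c"] by (simp add: N_def Basis_complex_def inner_complex_def)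
  have im: "h ` S \<subseteq> ball c R" "ball c R - N \<subseteq> h ` S"
  proof -
    show "h ` S \<subseteq> ball c R"
      by (auto simp: h_def S dist_norm norm_mult)
    show "ball c R - N \<subseteq> h ` S"
    proof
      fix z assume z: "z \<in> ball c R - N"
      define t where "t = Arg2pi (z - c)"
      have "z \<noteq> c" using z by (auto simp: N_def)
      have 1: "z - c = of_real (norm (z - c)) * cis t"
        using Arg2pi_eq[of "z-c"] by (simp add: t_def cis_conv_exp)
      have t: "0 \<le> t" "t < 2*pi" by (simp_all add: t_def Arg2pi_ge_0 Arg2pi_lt_2pi)
      have "t \<noteq> 0"
      proof
        assume "t = 0"
        then have "Im (z - c) = 0" using 1 by (metis cis_zero mult.right_neutral Im_complex_of_real)
        then show False using z by (auto simp: N_def)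
      qed
      then have "Complex (norm (z - c)) t \<in> S" using t z \<open>z \<noteq> c\<close> by (auto simp: S dist_norm norm_minus_commute)
      moreover have "h (Complex (norm (z - c)) t) = z" using 1 by (simp add: h_def)
      ultimately show "z \<in> h ` S" by force
    qed
  qed
  have cont: "continuous_on A (\<lambda>w. \<bar>Re w\<bar> * u (h w))" for A
    unfolding h_def cis_conv_exp by (intro continuous_intros continuous_on_compose2[OF u]) auto
  have "(\<lambda>w. \<bar>Re w\<bar> * u (h w)) absolutely_integrable_on cbox 0 (Complex R (2*pi))"
    by (intro absolutely_integrable_continuous cont)
  then have "(\<lambda>w. \<bar>Re w\<bar> * u (h w)) absolutely_integrable_on S"
    unfolding S_def by (rule set_integrable_subset) (auto simp: box_subset_cbox)
  then have "integral (h ` S) u = integral S (\<lambda>w. \<bar>Re w\<bar> * u (h w))"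
    using complex_change_of_variables[of S h D u "integral S (\<lambda>w. \<bar>Re w\<bar> * u (h w))"] der inj open_box
    unfolding S_def jac by blast
  moreover have "integral (h ` S) u = integral (ball c R) u"
    by (rule integral_spike_set; rule negligible_subset[OF N]) (use im in auto)
  moreover have "integral S (\<lambda>w. \<bar>Re w\<bar> * u (h w)) = integral (cbox 0 (Complex R (2*pi))) (\<lambda>w. \<bar>Re w\<bar> * u (h w))"
    unfolding S_def by (rule integral_open_interval)
  moreover have "integral (cbox 0 (Complex R (2*pi))) (\<lambda>w. \<bar>Re w\<bar> * u (h w))
      = integral (cbox (0,0) (R, 2*pi)) (\<lambda>(x, y). \<bar>x\<bar> * u (h (Complex x y)))"
    using has_integral_complex_Pair[OF integrable_integral[OF integrable_continuous[OF cont[of "cbox 0 (Complex R (2*pi))"]]]]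
    by (simp add: integral_unique split_beta)
  moreover have "integral (cbox (0,0) (R, 2*pi)) (\<lambda>(x, y). \<bar>x\<bar> * u (h (Complex x y)))
      = integral (cbox 0 R) (\<lambda>x. integral (cbox 0 (2*pi)) (\<lambda>y. \<bar>x\<bar> * u (h (Complex x y))))"
    by (subst integral_prod_continuous)
       (auto simp: h_def split_beta cis_conv_exp intro!: continuous_intros continuous_on_compose2[OF u])
  moreover have "\<dots> = integral {0..R} (\<lambda>r. r * integral {0..2*pi} (\<lambda>\<theta>. u (c + of_real r * cis \<theta>)))"
    by (auto intro!: integral_cong simp: h_def)
  ultimately show ?thesis by simp
qed

section \<open>Potentials on the plane\<close>

definition circle_integral :: "(complex \<Rightarrow> real) \<Rightarrow> complex \<Rightarrow> real \<Rightarrow> real" where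
  "circle_integral u c r = integral {0..2*pi} (\<lambda>\<theta>. u (c + of_real r * cis \<theta>))"

lemma continuous_on_circle_integral:
  assumes u: "continuous_on UNIV u"
  shows "continuous_on A (circle_integral u c)"
proof -
  have "continuous_on A (\<lambda>r. integral (cbox 0 (2*pi)) (\<lambda>\<theta>. u (c + of_real r * cis \<theta>)))"
    by (rule integral_continuous_on_param)
       (auto simp: split_beta intro!: continuous_intros continuous_on_compose2[OF u])
  then show ?thesis by (simp add: circle_integral_def[abs_def])
qed

lemma circle_integral_0 [simp]: "circle_integral u c 0 = 2 * pi * u c"
  by (simp add: circle_integral_def)

lemma circle_integrand_integrable:
  fixes u :: "complex \<Rightarrow> real"
  assumes "continuous_on UNIV u"
  shows "(\<lambda>\<theta>. u (c + of_real r * cis \<theta>)) integrable_on {0..2*pi}"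
  by (rule integrable_continuous_real) (auto intro!: continuous_intros continuous_on_compose2[OF assms])

lemma circle_integral_mono:
  assumes "continuous_on UNIV u" "continuous_on UNIV v" "\<And>z. u z \<le> v z"
  shows "circle_integral u c r \<le> circle_integral v c r"
  unfolding circle_integral_def
  by (intro integral_le circle_integrand_integrable assms)

lemma polar_circle_integral:
  assumes "continuous_on UNIV u" "R > 0"
  shows "((\<lambda>r. r * circle_integral u c r) has_integral integral (ball c R) u) {0..R}"
proof -
  have "(\<lambda>r. r * circle_integral u c r) integrable_on {0..R}"
    by (intro integrable_continuous_real continuous_intros continuous_on_circle_integral assms)
  then show ?thesis
    using polar_integral_ball[OF assms, of c] by (simp add: circle_integral_def has_integral_iff)
qed

text \<open>The pair (q, s) encodes the first derivatives and the Laplacian of u: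
  q is twice the Wirtinger derivative of u, and s is half of its Laplacian.\<close>

locale plane_potential =
  fixes u :: "complex \<Rightarrow> real" and q p :: "complex \<Rightarrow> complex" and s :: "complex \<Rightarrow> real"
  assumes du: "\<And>z. (u has_derivative (\<lambda>v. Re (q z * v))) (at z)"
    and dq: "\<And>z. (q has_derivative (\<lambda>v. p z * v + of_real (s z) * cnj v)) (at z)"
    and cont_p: "continuous_on UNIV p" and cont_s: "continuous_on UNIV s"
begin

lemma cont_u: "continuous_on UNIV u"
  by (intro continuous_at_imp_continuous_on ballI has_derivative_continuous[OF du])

lemma cont_q: "continuous_on UNIV q"
  by (intro continuous_at_imp_continuous_on ballI has_derivative_continuous[OF dq])

text \<open>The outward flux of the gradient of u through the circle: the integrand is r times the
  radial derivative of u.\<close>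

definition flux :: "complex \<Rightarrow> real \<Rightarrow> real" where
  "flux c r = integral {0..2*pi} (\<lambda>\<theta>. Re (q (c + of_real r * cis \<theta>) * (of_real r * cis \<theta>)))"

lemma circle_integral_deriv:
  "(circle_integral u c has_real_derivative
      integral {0..2*pi} (\<lambda>\<theta>. Re (q (c + of_real r * cis \<theta>) * cis \<theta>))) (at r)"
proof -
  have "((\<lambda>r. integral (cbox 0 (2*pi)) (\<lambda>\<theta>. u (c + of_real r * cis \<theta>))) has_real_derivative
      integral (cbox 0 (2*pi)) (\<lambda>\<theta>. Re (q (c + of_real r * cis \<theta>) * cis \<theta>))) (at r within UNIV)"
  proof (rule leibniz_rule_field_derivative[where U=UNIV])
    fix r \<theta> :: real
    have "((\<lambda>r. u (c + of_real r * cis \<theta>)) has_derivative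
       (\<lambda>x. Re (q (c + of_real r * cis \<theta>) * (of_real x * cis \<theta>)))) (at r)"
      by (rule has_derivative_compose[OF _ du]) (auto intro!: derivative_eq_intros)
    then show "((\<lambda>r. u (c + of_real r * cis \<theta>)) has_real_derivative
       Re (q (c + of_real r * cis \<theta>) * cis \<theta>)) (at r within UNIV)"
      unfolding has_field_derivative_def by (auto simp: algebra_simps elim!: has_derivative_eq_rhs)
  qed (auto simp: split_beta circle_integrand_integrable[OF cont_u, simplified]
      intro!: continuous_intros continuous_on_compose2[OF cont_q])
  then show ?thesis by (simp add: circle_integral_def[abs_def])
qed

lemma circle_integral_deriv_flux:
  assumes "r \<noteq> 0"
  shows "(circle_integral u c has_real_derivative flux c r / r) (at r)"
proof -
  have "integral {0..2*pi} (\<lambda>\<theta>. Re (q (c + of_real r * cis \<theta>) * cis \<theta>)) = flux c r / r"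
    unfolding flux_def using assms
    unfolding integral_divide[symmetric] by (intro integral_cong) (simp add: field_simps)
  then show ?thesis using circle_integral_deriv[of c r] by simp
qed

text \<open>Green's formula for a thin annulus: 2 s is the Laplacian of u, and the flux grows by its
  integral over the annulus.\<close>

lemma flux_deriv: "(flux c has_real_derivative 2 * r * circle_integral s c r) (at r)"
proof -
  define e where "e = (\<lambda>r \<theta>. c + of_real r * cis \<theta>)"
  define F where "F = (\<lambda>r \<theta>. Re ((p (e r \<theta>) * cis \<theta> + of_real (s (e r \<theta>)) * cnj (cis \<theta>)) * (of_real r * cis \<theta>) + q (e r \<theta>) * cis \<theta>))"
  \<comment> \<open>\<open>B r\<close> is minus the tangential derivative of u on the circle. The
    radial derivative F of the flux integrand differs from 2 r s by the angular derivative of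
    \<open>B r\<close>, which integrates to zero by periodicity.\<close>
  define B where "B = (\<lambda>r \<theta>. Re (- \<i> * (q (e r \<theta>) * cis \<theta>)))"
  have conte: "continuous_on A (\<lambda>x. e (a x) (b x))" if "continuous_on A a" "continuous_on A b" for A :: "'c::topological_space set" and a b
    unfolding e_def by (intro continuous_intros that)
  note [continuous_intros] = conte continuous_on_compose2[OF cont_q] continuous_on_compose2[OF cont_p] continuous_on_compose2[OF cont_s]
  have "((\<lambda>r. integral (cbox 0 (2*pi)) (\<lambda>\<theta>. Re (q (e r \<theta>) * (of_real r * cis \<theta>)))) has_real_derivative
      integral (cbox 0 (2*pi)) (F r)) (at r within UNIV)"
  proof (rule leibniz_rule_field_derivative[where U=UNIV])
    fix r \<theta> :: real
    have 1: "((\<lambda>r. q (e r \<theta>)) has_derivative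
       (\<lambda>x. p (e r \<theta>) * (of_real x * cis \<theta>) + of_real (s (e r \<theta>)) * cnj (of_real x * cis \<theta>))) (at r)"
      unfolding e_def by (rule has_derivative_compose[OF _ dq]) (auto intro!: derivative_eq_intros)
    show "((\<lambda>r. Re (q (e r \<theta>) * (of_real r * cis \<theta>))) has_real_derivative F r \<theta>) (at r within UNIV)"
      unfolding has_field_derivative_def
      by (rule has_derivative_eq_rhs, (rule derivative_intros 1 refl)+)
         (auto simp: F_def fun_eq_iff algebra_simps)
  qed (auto simp: split_beta F_def intro!: continuous_intros integrable_continuous_real)
  moreover have "integral {0..2*pi} (F r) = 2 * r * circle_integral s c r"
  proof -
    define B' where "B' = (\<lambda>\<theta>. F r \<theta> - 2 * r * s (e r \<theta>))"
    have "(B r has_vector_derivative B' \<theta>) (at \<theta> within {0..2*pi})" for \<theta>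
    proof -
      have 0: "((\<lambda>\<theta>. e r \<theta>) has_derivative (\<lambda>x. of_real r * (of_real x * (\<i> * cis \<theta>)))) (at \<theta> within {0..2*pi})"
        unfolding e_def by (auto intro!: derivative_eq_intros simp: scaleR_conv_of_real)
      have 1: "((\<lambda>\<theta>. q (e r \<theta>)) has_derivative
       (\<lambda>x. p (e r \<theta>) * (of_real r * (of_real x * (\<i> * cis \<theta>))) + of_real (s (e r \<theta>)) * cnj (of_real r * (of_real x * (\<i> * cis \<theta>))))) (at \<theta> within {0..2*pi})"
        by (rule has_derivative_compose[OF 0 dq])
      have 2: "(cis has_derivative (\<lambda>x. of_real x * (\<i> * cis \<theta>))) (at \<theta> within {0..2*pi})"
        by (auto intro!: derivative_eq_intros simp: scaleR_conv_of_real)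
      have 3: "cis \<theta> * cnj (cis \<theta>) = 1" by (simp add: cis_cnj cis_mult)
      show ?thesis
        unfolding has_vector_derivative_def B_def
      proof (rule has_derivative_eq_rhs)
        show "((\<lambda>\<theta>. Re (- \<i> * (q (e r \<theta>) * cis \<theta>))) has_derivative (\<lambda>h. Re (- \<i> * (q (e r \<theta>) * (of_real h * (\<i> * cis \<theta>)) +
            (p (e r \<theta>) * (of_real r * (of_real h * (\<i> * cis \<theta>))) +
             of_real (s (e r \<theta>)) * cnj (of_real r * (of_real h * (\<i> * cis \<theta>)))) * cis \<theta>)))) (at \<theta> within {0..2*pi})"
          by (intro has_derivative_Re has_derivative_mult_right has_derivative_mult 1 2)
        show "(\<lambda>h. Re (- \<i> * (q (e r \<theta>) * (of_real h * (\<i> * cis \<theta>)) +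
            (p (e r \<theta>) * (of_real r * (of_real h * (\<i> * cis \<theta>))) +
             of_real (s (e r \<theta>)) * cnj (of_real r * (of_real h * (\<i> * cis \<theta>)))) * cis \<theta>))) = (\<lambda>x. x *\<^sub>R B' \<theta>)"
        proof
          fix h :: real
          let ?c = "cis \<theta>" and ?P = "p (e r \<theta>)" and ?s = "complex_of_real (s (e r \<theta>))" and ?q = "q (e r \<theta>)"
          have "- \<i> * (?q * (of_real h * (\<i> * ?c)) +
            (?P * (of_real r * (of_real h * (\<i> * ?c))) +
             ?s * cnj (of_real r * (of_real h * (\<i> * ?c)))) * ?c) =
             of_real h * (?q * ?c + ?P * of_real r * ?c * ?c - ?s * of_real r * (?c * cnj ?c))"
            by (simp add: algebra_simps)
          also have "\<dots> = of_real h * ((?P * ?c + ?s * cnj ?c) * (of_real r * ?c) + ?q * ?c - of_real (2 * r * s (e r \<theta>)) * (?c * cnj ?c))"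
            by (simp add: algebra_simps)
          finally show "Re (- \<i> * (?q * (of_real h * (\<i> * ?c)) +
            (?P * (of_real r * (of_real h * (\<i> * ?c))) +
             ?s * cnj (of_real r * (of_real h * (\<i> * ?c)))) * ?c)) = h *\<^sub>R B' \<theta>"
            unfolding 3 by (simp add: B'_def F_def)
        qed
      qed
    qed
    then have "(B' has_integral B r (2*pi) - B r 0) {0..2*pi}"
      by (intro fundamental_theorem_of_calculus) auto
    then have "(B' has_integral 0) {0..2*pi}"
      by (simp add: B_def e_def)
    moreover have "((\<lambda>\<theta>. 2 * r * s (e r \<theta>)) has_integral 2 * r * circle_integral s c r) {0..2*pi}"
      unfolding circle_integral_def e_def
      by (intro has_integral_mult_right integrable_integral circle_integrand_integrable cont_s)
    ultimately have "((\<lambda>\<theta>. B' \<theta> + 2 * r * s (e r \<theta>)) has_integral 0 + 2 * r * circle_integral s c r) {0..2*pi}"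
      by (rule has_integral_add)
    then show ?thesis by (simp add: B'_def integral_unique)
  qed
  ultimately show ?thesis by (simp add: flux_def[abs_def] e_def)
qed

lemma flux_0 [simp]: "flux c 0 = 0"
  by (simp add: flux_def)

lemma flux_eq:
  assumes "R \<ge> 0"
  shows "((\<lambda>r. 2 * r * circle_integral s c r) has_integral flux c R) {0..R}"
proof -
  have "((\<lambda>r. 2 * r * circle_integral s c r) has_integral flux c R - flux c 0) {0..R}"
    using flux_deriv assms
    by (intro fundamental_theorem_of_calculus)
       (auto simp: has_real_derivative_iff_has_vector_derivative[symmetric] intro: DERIV_subset)
  then show ?thesis by simp
qed

lemma flux_nonneg:
  assumes "\<And>z. s z \<ge> 0" "R \<ge> 0"
  shows "flux c R \<ge> 0"
proof (rule has_integral_nonneg[OF flux_eq])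
  have "circle_integral s c r \<ge> circle_integral (\<lambda>_. 0) c r" for r
    by (rule circle_integral_mono) (auto intro: cont_s assms)
  then show "0 \<le> 2 * r * circle_integral s c r" if "r \<in> {0..R}" for r
    using that by (simp add: circle_integral_def)
qed (rule assms)

lemma subharmonic_circle_mean:
  assumes "\<And>z. s z \<ge> 0" "R \<ge> 0"
  shows "2 * pi * u c \<le> circle_integral u c R"
proof -
  have "circle_integral u c 0 \<le> circle_integral u c R"
  proof (rule DERIV_nonneg_imp_increasing_open[OF assms(2)])
    fix x assume "0 < x" "x < R"
    then show "\<exists>y. (circle_integral u c has_real_derivative y) (at x) \<and> y \<ge> 0"
      using flux_nonneg[OF assms(1), of x c] by (intro exI[of _ "flux c x / x"]) (auto intro: circle_integral_deriv_flux)
  qed (rule continuous_on_circle_integral[OF cont_u])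
  then show ?thesis by simp
qed

lemma subharmonic_area_mean:
  assumes "\<And>z. s z \<ge> 0" "R > 0"
  shows "pi * R\<^sup>2 * u c \<le> integral (ball c R) u"
proof -
  have "((\<lambda>r. r * (2 * pi * u c)) has_integral ((R\<^sup>2 - 0\<^sup>2)/2) * (2 * pi * u c)) {0..R}"
    using assms(2) by (intro has_integral_mult_left ident_has_integral) auto
  then have "((R\<^sup>2 - 0\<^sup>2)/2) * (2 * pi * u c) \<le> integral (ball c R) u"
    by (rule has_integral_le[OF _ polar_circle_integral[OF cont_u assms(2)]])
       (auto intro!: mult_left_mono subharmonic_circle_mean assms)
  then show ?thesis by (simp add: algebra_simps)
qed

text \<open>The flux is strictly decreasing, so it stays below a negative constant -k outside the
  unit disk, and the circle integrals fall at least as fast as -k ln R.\<close>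

lemma superharmonic_unbounded_below:
  assumes "\<And>z. s z < 0"
  shows "\<exists>z. u z < B"
proof (rule ccontr)
  assume "\<not> ?thesis"
  then have B: "u z \<ge> B" for z by (simp add: not_less)
  have circ_s: "circle_integral s 0 r < 0" for r
  proof -
    have "circle_integral s 0 r < integral {0..2*pi} (\<lambda>_. 0)"
      unfolding circle_integral_def
      by (rule integral_less_real) (auto intro!: assms integrable_continuous_real continuous_intros continuous_on_compose2[OF cont_s] simp: not_le)
    then show ?thesis by simp
  qed
  have dec: "flux 0 y < flux 0 x" if "0 \<le> x" "x < y" for x y
  proof (rule DERIV_neg_imp_decreasing_open[OF that(2)])
    fix t assume "x < t" "t < y"
    then show "\<exists>d. (flux 0 has_real_derivative d) (at t) \<and> d < 0"
      using flux_deriv[of 0 t] circ_s[of t] that by (intro exI[of _ "2 * t * circle_integral s 0 t"]) (auto simp: mult_pos_neg)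
  qed (intro continuous_at_imp_continuous_on ballI DERIV_isCont[OF flux_deriv])
  define k where "k = - flux 0 1"
  have k: "k > 0" using dec[of 0 1] by (simp add: k_def)
  have fl: "flux 0 r \<le> - k" if "r \<ge> 1" for r
    using dec[of 1 r] that by (cases "r = 1") (auto simp: k_def)
  have up: "circle_integral u 0 R + k * ln R \<le> circle_integral u 0 1" if "R > 1" for R
  proof -
    have "circle_integral u 0 R + k * ln R \<le> circle_integral u 0 1 + k * ln 1"
    proof (rule DERIV_nonpos_imp_decreasing_open[of 1 R "\<lambda>R. circle_integral u 0 R + k * ln R"])
      fix x assume x: "1 < x" "x < R"
      have "((\<lambda>R. circle_integral u 0 R + k * ln R) has_real_derivative (flux 0 x + k) / x) (at x)"
        using x by (auto intro!: derivative_eq_intros circle_integral_deriv_flux simp: field_simps)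
      moreover have "(flux 0 x + k) / x \<le> 0" using fl[of x] x by (simp add: divide_nonpos_pos)
      ultimately show "\<exists>y. ((\<lambda>R. circle_integral u 0 R + k * ln R) has_real_derivative y) (at x) \<and> y \<le> 0" by blast
    qed (use that in \<open>auto intro!: continuous_intros continuous_on_circle_integral cont_u\<close>)
    then show ?thesis by simp
  qed
  have low: "circle_integral u 0 R \<ge> 2 * pi * B" for R
    using circle_integral_mono[OF _ cont_u, of "\<lambda>_. B" 0 R] B by (auto simp: circle_integral_def)
  \<comment> \<open>At this radius k ln R exceeds the drop that a lower bound B for u would permit
    by at least k.\<close>
  define R where "R = exp (1 + \<bar>circle_integral u 0 1 - 2 * pi * B\<bar> / k)"
  have "R > 1" using k by (simp add: R_def add_pos_nonneg)
  have "k * ln R = k + \<bar>circle_integral u 0 1 - 2 * pi * B\<bar>" using k by (simp add: R_def field_simps)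
  with up[OF \<open>R > 1\<close>] low[of R] k show False by linarith
qed

text \<open>A charge dominated by a density of finite total mass has flux bounded below, so circle
  integrals decrease at most like a multiple of ln R. Integrating them against r dr over the
  interval from 0 to R produces the factor R^2.\<close>

lemma finite_charge_area_mean:
  assumes bnd: "\<And>z. \<bar>s z\<bar> \<le> M * E z" and E: "continuous_on UNIV E"
    and A: "\<And>r. r > 0 \<Longrightarrow> integral (ball 0 r) E \<le> A" and M: "M \<ge> 0"
  shows "\<exists>B\<ge>0. \<forall>R\<ge>1. integral (ball 0 R) u \<ge> - B * (1 + ln R) * R\<^sup>2"
proof -
  have flux: "flux 0 r \<ge> - (2 * M * A)" if "r > 0" for r
  proof -
    have "((\<lambda>r. - (2 * M) * (r * circle_integral E 0 r)) has_integral - (2 * M) * integral (ball 0 r) E) {0..r}"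
      by (intro has_integral_mult_right polar_circle_integral E that)
    then have "- (2 * M) * integral (ball 0 r) E \<le> flux 0 r"
    proof (rule has_integral_le[OF _ flux_eq])
      fix x assume "x \<in> {0..r}"
      then have x: "0 \<le> x" by simp
      have "circle_integral (\<lambda>z. - M * E z) 0 x \<le> circle_integral s 0 x"
        by (rule circle_integral_mono) (use bnd in \<open>auto intro!: cont_s continuous_intros E simp: abs_le_iff minus_le_iff\<close>)
      moreover have "circle_integral (\<lambda>z. - M * E z) 0 x = - M * circle_integral E 0 x"
        unfolding circle_integral_def by (rule integral_mult_right)
      ultimately have "2 * x * (- M * circle_integral E 0 x) \<le> 2 * x * circle_integral s 0 x"
        using x by (intro mult_left_mono) auto
      moreover have "- (2 * M) * (x * circle_integral E 0 x) = 2 * x * (- M * circle_integral E 0 x)" by simp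
      ultimately show "- (2 * M) * (x * circle_integral E 0 x) \<le> 2 * x * circle_integral s 0 x"
        by (simp only:)
    qed (use that in auto)
    moreover have "2 * M * integral (ball 0 r) E \<le> 2 * M * A" using A[OF that] M by (intro mult_left_mono) auto
    ultimately show ?thesis by linarith
  qed
  have MA: "0 \<le> M * A"
  proof -
    have "0 \<le> M * E z" for z using bnd[of z] by linarith
    then have "integral (ball 0 1) (\<lambda>z. M * E z) \<ge> 0"
      by (cases "(\<lambda>z. M * E z) integrable_on ball 0 1") (simp_all add: Henstock_Kurzweil_Integration.integral_nonneg not_integrable_integral del: integral_mult_right)
    then have "M * integral (ball 0 1) E \<ge> 0" by simp
    also have "M * integral (ball 0 1) E \<le> M * A" using A[of 1] M by (intro mult_left_mono) auto
    finally show ?thesis .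
  qed
  have "compact (circle_integral u 0 ` {0..1})"
    by (intro compact_continuous_image continuous_on_circle_integral cont_u) auto
  then have "bounded (circle_integral u 0 ` {0..1})" by (rule compact_imp_bounded)
  then obtain B0 where "\<forall>x\<in>circle_integral u 0 ` {0..1}. norm x \<le> B0" unfolding bounded_iff by blast
  then have B0: "\<bar>circle_integral u 0 r\<bar> \<le> B0" if "0 \<le> r" "r \<le> 1" for r using that by auto
  have B0p: "B0 \<ge> 0" using B0[of 0] by linarith
  define Q where "Q = 2 * (M * A)"
  have Q: "Q \<ge> 0" using MA by (simp add: Q_def)
  have fluxQ: "flux 0 r \<ge> - Q" if "r > 0" for r using flux[OF that] by (simp add: Q_def)
  \<comment> \<open>Radii up to 1 are covered by compactness; beyond 1 the flux bound makes the
    circle integral plus Q ln r nondecreasing.\<close>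
  have low: "circle_integral u 0 r \<ge> - B0 - Q * ln R" if r: "0 \<le> r" "r \<le> R" "R \<ge> 1" for r R
  proof (cases "r \<le> 1")
    case True
    have "0 \<le> Q * ln R" using Q r by (intro mult_nonneg_nonneg) auto
    then show ?thesis using B0[of r] True r by linarith
  next
    case False
    have "circle_integral u 0 1 + Q * ln 1 \<le> circle_integral u 0 r + Q * ln r"
    proof (rule DERIV_nonneg_imp_increasing_open[of 1 r "\<lambda>R. circle_integral u 0 R + Q * ln R"])
      fix x assume x: "1 < x" "x < r"
      have "((\<lambda>R. circle_integral u 0 R + Q * ln R) has_real_derivative (flux 0 x + Q) / x) (at x)"
        using x by (auto intro!: derivative_eq_intros circle_integral_deriv_flux simp: field_simps)
      moreover have "(flux 0 x + Q) / x \<ge> 0" using fluxQ[of x] x by simp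
      ultimately show "\<exists>y. ((\<lambda>R. circle_integral u 0 R + Q * ln R) has_real_derivative y) (at x) \<and> y \<ge> 0" by blast
    qed (use False in \<open>auto intro!: continuous_intros continuous_on_circle_integral cont_u\<close>)
    moreover have "Q * ln r \<le> Q * ln R"
      using Q False r by (intro mult_left_mono) auto
    ultimately show ?thesis using B0[of 1] by simp
  qed
  define B where "B = B0 + Q"
  have "integral (ball 0 R) u \<ge> - B * (1 + ln R) * R\<^sup>2" if R: "R \<ge> 1" for R
  proof -
    let ?k = "- B0 - Q * ln R"
    have "((\<lambda>r. r * ?k) has_integral ((R\<^sup>2 - 0\<^sup>2)/2) * ?k) {0..R}"
      using R by (intro has_integral_mult_left ident_has_integral) auto
    then have 1: "((R\<^sup>2 - 0\<^sup>2)/2) * ?k \<le> integral (ball 0 R) u"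
      by (rule has_integral_le[OF _ polar_circle_integral[OF cont_u]]) (use R low[OF _ _ R] in \<open>auto intro!: mult_left_mono\<close>)
    have "ln R \<ge> 0" using R by simp
    then have "0 \<le> B0 * ln R" and "0 \<le> Q * ln R" using B0p Q by simp_all
    moreover have "B * (1 + ln R) = B0 + Q + B0 * ln R + Q * ln R" by (simp add: B_def algebra_simps)
    ultimately have k: "- (B * (1 + ln R)) \<le> ?k" and k0: "?k \<le> 0" using Q B0p by linarith+
    have "R\<^sup>2 * - (B * (1 + ln R)) \<le> R\<^sup>2 * ?k" using k by (rule mult_left_mono) simp
    moreover have "R\<^sup>2 * ?k \<le> 0" using k0 by (intro mult_nonneg_nonpos) simp_all
    moreover have "((R\<^sup>2 - 0\<^sup>2)/2) * ?k = (R\<^sup>2 * ?k) / 2" by simp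
    moreover have "R\<^sup>2 * - (B * (1 + ln R)) = - B * (1 + ln R) * R\<^sup>2" by simp
    ultimately show ?thesis using 1 by linarith
  qed
  moreover have "B \<ge> 0" using B0p Q by (simp add: B_def)
  ultimately show ?thesis by blast
qed

end

section \<open>HCMU metrics on the plane\<close>

text \<open>The function y^2 exp(-2 M t) is nonincreasing and starts at 0.\<close>

lemma gronwall_zero:
  fixes y y' :: "real \<Rightarrow> real"
  assumes der: "\<And>t. 0 \<le> t \<Longrightarrow> t \<le> 1 \<Longrightarrow> (y has_real_derivative y' t) (at t)"
    and bnd: "\<And>t. 0 \<le> t \<Longrightarrow> t \<le> 1 \<Longrightarrow> \<bar>y' t\<bar> \<le> M * \<bar>y t\<bar>"
    and y0: "y 0 = 0"
  shows "y 1 = 0"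
proof -
  have "(y 1)\<^sup>2 * exp (- 2 * M * 1) \<le> (y 0)\<^sup>2 * exp (- 2 * M * 0)"
  proof (rule DERIV_nonpos_imp_nonincreasing[of 0 1 "\<lambda>t. (y t)\<^sup>2 * exp (- 2 * M * t)"])
    fix t :: real assume t: "0 \<le> t" "t \<le> 1"
    have "((\<lambda>t. (y t)\<^sup>2 * exp (- 2 * M * t)) has_real_derivative
        2 * exp (- 2 * M * t) * (y t * y' t - M * (y t)\<^sup>2)) (at t)"
      by (auto intro!: derivative_eq_intros der t simp: power2_eq_square algebra_simps)
    moreover have "y t * y' t - M * (y t)\<^sup>2 \<le> 0"
    proof -
      have "y t * y' t \<le> \<bar>y t\<bar> * \<bar>y' t\<bar>" by (metis abs_ge_self abs_mult)
      also have "\<dots> \<le> \<bar>y t\<bar> * (M * \<bar>y t\<bar>)" by (intro mult_left_mono bnd t) auto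
      also have "\<dots> = M * (y t)\<^sup>2" by (simp add: power2_eq_square)
      finally show ?thesis by simp
    qed
    ultimately show "\<exists>d. ((\<lambda>t. (y t)\<^sup>2 * exp (- 2 * M * t)) has_real_derivative d) (at t) \<and> d \<le> 0"
      by (meson mult_nonneg_nonpos exp_ge_zero zero_le_mult_iff zero_le_numeral)
  qed simp
  then show ?thesis using y0 by (simp add: mult_le_0_iff)
qed

text \<open>The zero is the infimum of the closed set of points right of a where g \<le> 0;
  positivity to its left gives the opposite inequality in the limit.\<close>

lemma first_zero_right:
  fixes g :: "real \<Rightarrow> real"
  assumes cont: "continuous_on UNIV g" and a: "g a > 0" and c: "a < c" "g c \<le> 0"
  shows "\<exists>b>a. g b = 0 \<and> (\<forall>x. a \<le> x \<and> x < b \<longrightarrow> g x > 0)"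
proof -
  define S where "S = {x. a \<le> x \<and> g x \<le> 0}"
  have S: "closed S" "S \<noteq> {}" "bdd_below S"
  proof -
    have "S = {a..} \<inter> {x. g x \<le> 0}" by (auto simp: S_def)
    then show "closed S" by (auto intro!: closed_Collect_le cont continuous_intros)
    show "S \<noteq> {}" using c by (auto simp: S_def intro!: exI[of _ c])
    show "bdd_below S" by (auto simp: S_def intro: bdd_belowI[of _ a])
  qed
  define b where "b = Inf_class.Inf S"
  have b: "b \<in> S" using closed_contains_Inf[OF S(2,3,1)] by (simp add: b_def)
  have ba: "b > a" using b a by (cases "b = a") (auto simp: S_def)
  have pos: "g x > 0" if "a \<le> x" "x < b" for x
    using cInf_lower[OF _ S(3), of x] that by (force simp: S_def b_def)
  have "g b \<ge> 0"
  proof (rule tendsto_lowerbound)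
    show "(g \<longlongrightarrow> g b) (at_left b)"
      using cont by (auto simp: continuous_on_eq_continuous_at isCont_def intro: filterlim_at_split[THEN iffD1, THEN conjunct1])
    show "\<forall>\<^sub>F x in at_left b. 0 \<le> g x"
      using eventually_at_left[OF ba] ba pos by (auto intro!: exI[of _ a] less_imp_le)
  qed simp
  then show ?thesis using b ba pos by (auto simp: S_def intro!: exI[of _ b])
qed

text \<open>A metric exp(2 phi) |dz|^2 on the plane with curvature K and holomorphic vector field f;
  here q is twice the Wirtinger derivative of phi, and the last assumption on q f + f' expresses
  that K has symmetric second derivatives.\<close>

locale hcmu_plane =
  fixes \<phi> K :: "complex \<Rightarrow> real" and f f' q p :: "complex \<Rightarrow> complex"
  assumes df: "\<And>z. (f has_field_derivative f' z) (at z)"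
    and dphi: "\<And>z. (\<phi> has_derivative (\<lambda>v. Re (q z * v))) (at z)"
    and dq: "\<And>z. (q has_derivative (\<lambda>v. p z * v + of_real (- (K z * exp (2 * \<phi> z) / 2)) * cnj v)) (at z)"
    and cont_p: "continuous_on UNIV p"
    and dK: "\<And>z. (K has_derivative (\<lambda>v. 2 * exp (2 * \<phi> z) * Re (cnj (f z) * v))) (at z)"
    and real: "\<And>z. Im (q z * f z + f' z) = 0"
    and area: "integrable lborel (\<lambda>z. exp (2 * \<phi> z))"
    and nonconst: "\<exists>z w. K z \<noteq> K w"
begin

section \<open>First integrals of the HCMU equation\<close>

lemma holo_f: "f holomorphic_on UNIV"
  using df by (auto simp: holomorphic_on_def field_differentiable_def)

lemma deriv_f: "deriv f = f'"
  using df DERIV_imp_deriv by blast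

lemma df': "(f' has_field_derivative deriv f' z) (at z)"
  using holomorphic_deriv[OF holo_f open_UNIV] holomorphic_derivI[of f' UNIV z UNIV] by (simp add: deriv_f)

lemma cont_K: "continuous_on A K"
  by (rule continuous_on_subset[OF continuous_at_imp_continuous_on]) (auto intro!: has_derivative_continuous[OF dK])

lemma cont_phi: "continuous_on A \<phi>"
  by (rule continuous_on_subset[OF continuous_at_imp_continuous_on]) (auto intro!: has_derivative_continuous[OF dphi])

lemma cont_f: "continuous_on A f"
  using holo_f holomorphic_on_imp_continuous_on holomorphic_on_subset by blast

lemma cont_q: "continuous_on A q"
  by (rule continuous_on_subset[OF continuous_at_imp_continuous_on]) (auto intro!: has_derivative_continuous[OF dq])

text \<open>The two constants of integration, read off at the point 0: \<open>cA\<close> is the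
  constant value of Re (q f + f') + K^2/4, and \<open>cB\<close> that of 2 exp(2 phi) |f|^2 - (2 cA
  K - K^3/6).\<close>

definition cA :: real where "cA = Re (q 0 * f 0 + f' 0) + (K 0)\<^sup>2 / 4"
definition cB :: real where "cB = 2 * exp (2 * \<phi> 0) * (norm (f 0))\<^sup>2 + (K 0)^3 / 6 - 2 * cA * K 0"
definition P :: "real \<Rightarrow> real" where "P k = cB + 2 * cA * k - k^3 / 6"
definition P' :: "real \<Rightarrow> real" where "P' k = 2 * cA - k\<^sup>2 / 2"

lemma dP: "(P has_real_derivative P' k) (at k)"
  unfolding P_def P'_def by (auto intro!: derivative_eq_intros)

lemma cont_P: "continuous_on A P"
  unfolding P_def by (intro continuous_intros) auto

lemma dE: "((\<lambda>z. exp (2 * \<phi> z)) has_derivative (\<lambda>v. 2 * exp (2 * \<phi> z) * Re (q z * v))) (at z)"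
  by (auto intro!: derivative_eq_intros dphi)

lemma df_real: "(f has_derivative (\<lambda>v. f' z * v)) (at z)"
  using df by (simp add: has_field_derivative_def)

lemma dA: "((\<lambda>z. Re (q z * f z + f' z)) has_derivative (\<lambda>v. - (K z * exp (2 * \<phi> z)) * Re (cnj (f z) * v))) (at z)"
proof -
  define s where "s = K z * exp (2 * \<phi> z) / 2"
  define \<alpha> where "\<alpha> = p z * f z + q z * f' z + deriv f' z"
  define \<beta> where "\<beta> = - of_real s * f z"
  have 1: "((\<lambda>z. q z * f z + f' z) has_derivative (\<lambda>v. \<alpha> * v + \<beta> * cnj v)) (at z)"
  proof (rule has_derivative_eq_rhs)
    show "((\<lambda>z. q z * f z + f' z) has_derivative
       (\<lambda>v. (q z * (f' z * v) + (p z * v + of_real (- (K z * exp (2 * \<phi> z) / 2)) * cnj v) * f z) + deriv f' z * v)) (at z)"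
      by (intro has_derivative_add has_derivative_mult dq df_real df'[unfolded has_field_derivative_def])
  qed (auto simp: \<alpha>_def \<beta>_def s_def algebra_simps)
  \<comment> \<open>Im (q f + f') vanishes identically, hence so does its differential. This forces
    \<alpha> = cnj \<beta>, which eliminates p and f'' from the derivative of the real part.\<close>
  from has_derivative_Im[OF this] have 2: "((\<lambda>z. 0::real) has_derivative (\<lambda>v. Im (\<alpha> * v + \<beta> * cnj v))) (at z)"
    by (simp only: real)
  have 3: "Im (\<alpha> * v + \<beta> * cnj v) = 0" for v
    using fun_cong[OF has_derivative_unique[OF 2 has_derivative_const], of v] by simp
  have "\<alpha> = cnj \<beta>"
    using 3[of 1] 3[of \<i>] by (simp add: complex_eq_iff)
  have "Re (\<alpha> * v + \<beta> * cnj v) = - (K z * exp (2 * \<phi> z)) * Re (cnj (f z) * v)" for v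
    unfolding \<open>\<alpha> = cnj \<beta>\<close> by (simp add: \<beta>_def s_def algebra_simps)
  with has_derivative_Re[OF 1] show ?thesis by simp
qed

text \<open>By \<open>dA\<close> and \<open>dK\<close> the differential of the left-hand side is
  -(K/2) dK, so adding K^2/4 gives a constant.\<close>

lemma Re_A: "Re (q z * f z + f' z) = P' (K z) / 2"
proof -
  have "((\<lambda>z. Re (q z * f z + f' z) + (K z)\<^sup>2 / 4) has_derivative (\<lambda>v. 0)) (at z within UNIV)" for z
    by (rule has_derivative_eq_rhs, rule has_derivative_add[OF dA])
       (auto intro!: derivative_eq_intros dK simp: fun_eq_iff)
  from has_derivative_zero_constant[OF convex_UNIV this]
  have "Re (q z * f z + f' z) + (K z)\<^sup>2 / 4 = Re (q 0 * f 0 + f' 0) + (K 0)\<^sup>2 / 4" by (metis UNIV_I)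
  then show ?thesis by (simp add: P'_def cA_def)
qed

lemma A_eq: "q z * f z + f' z = of_real (P' (K z) / 2)"
  using Re_A real by (simp add: complex_eq_iff)

text \<open>By \<open>A_eq\<close> the right-hand side has differential P'(K) dK. Hence it differs
  from P(K) by a constant, and \<open>cB\<close> was chosen to make that constant zero.\<close>

lemma P_eq: "P (K z) = 2 * exp (2 * \<phi> z) * (norm (f z))\<^sup>2"
proof -
  have norm_f: "(norm (f z))\<^sup>2 = Re (f z * cnj (f z))" for z
    unfolding cmod_power2 by (simp add: power2_eq_square)
  have "((\<lambda>z. 2 * exp (2 * \<phi> z) * (norm (f z))\<^sup>2 - (2 * cA * K z - (K z)^3 / 6)) has_derivative (\<lambda>v. 0)) (at z within UNIV)" for z
  proof -
    have "((\<lambda>z. 2 * exp (2 * \<phi> z) * (norm (f z))\<^sup>2) has_derivative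
        (\<lambda>v. 4 * exp (2 * \<phi> z) * Re (cnj (f z) * ((q z * f z + f' z) * v)))) (at z)"
      unfolding norm_f
    proof (rule has_derivative_eq_rhs)
      show "((\<lambda>z. 2 * exp (2 * \<phi> z) * Re (f z * cnj (f z))) has_derivative
         (\<lambda>v. (2 * exp (2 * \<phi> z)) * Re (f z * cnj (f' z * v) + (f' z * v) * cnj (f z)) + (2 * (2 * exp (2 * \<phi> z) * Re (q z * v))) * Re (f z * cnj (f z)))) (at z)"
        by (intro has_derivative_mult has_derivative_mult_right dE has_derivative_Re has_derivative_cnj df_real)
    qed (auto simp: fun_eq_iff algebra_simps)
    also have "(\<lambda>v. 4 * exp (2 * \<phi> z) * Re (cnj (f z) * ((q z * f z + f' z) * v))) =
        (\<lambda>v. 2 * exp (2 * \<phi> z) * P' (K z) * Re (cnj (f z) * v))"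
      unfolding A_eq by (auto simp: fun_eq_iff algebra_simps)
    finally have 1: "((\<lambda>z. 2 * exp (2 * \<phi> z) * (norm (f z))\<^sup>2) has_derivative \<dots>) (at z)" .
    have 2: "((\<lambda>z. 2 * cA * K z - (K z)^3 / 6) has_derivative (\<lambda>v. P' (K z) * (2 * exp (2 * \<phi> z) * Re (cnj (f z) * v)))) (at z)"
      by (auto intro!: derivative_eq_intros dK simp: fun_eq_iff P'_def algebra_simps power2_eq_square)
    show ?thesis
      by (rule has_derivative_eq_rhs, rule has_derivative_diff[OF 1 2]) (auto simp: fun_eq_iff)
  qed
  from has_derivative_zero_constant[OF convex_UNIV this]
  have "2 * exp (2 * \<phi> z) * (norm (f z))\<^sup>2 - (2 * cA * K z - (K z)^3 / 6)
      = 2 * exp (2 * \<phi> 0) * (norm (f 0))\<^sup>2 - (2 * cA * K 0 - (K 0)^3 / 6)" by (metis UNIV_I)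
  then show ?thesis by (simp add: P_def cB_def)
qed

lemma P_nonneg: "P (K z) \<ge> 0"
  by (simp add: P_eq)

lemma f_zero_iff: "f z = 0 \<longleftrightarrow> P (K z) = 0"
  by (simp add: P_eq)

lemma f'_at_zero: "f z = 0 \<Longrightarrow> f' z = of_real (P' (K z) / 2)"
  using A_eq[of z] by simp

lemma exp_phi: "f z \<noteq> 0 \<Longrightarrow> exp (2 * \<phi> z) = P (K z) / (2 * (norm (f z))\<^sup>2)"
  by (simp add: P_eq)

lemma dK_eq: "f z \<noteq> 0 \<Longrightarrow> (K has_derivative (\<lambda>v. P (K z) * Re (v / f z))) (at z)"
proof (rule has_derivative_eq_rhs[OF dK])
  assume "f z \<noteq> 0"
  have "Re (v / f z) = Re (cnj (f z) * v) / (norm (f z))\<^sup>2" for v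
    by (simp add: complex_div_cnj[of v "f z"] mult.commute)
  then show "(\<lambda>v. 2 * exp (2 * \<phi> z) * Re (cnj (f z) * v)) = (\<lambda>v. P (K z) * Re (v / f z))"
    using \<open>f z \<noteq> 0\<close> by (simp add: P_eq fun_eq_iff)
qed

text \<open>At a multiple zero of P the equation for dK has a Lipschitz right-hand side that vanishes,
  so that K would be constant.\<close>

lemma P'_at_zero:
  assumes "f z0 = 0"
  shows "P' (K z0) \<noteq> 0"
proof
  assume P'0: "P' (K z0) = 0"
  define k where "k = K z0"
  have "P k = 0" "P' k = 0" using assms P'0 f_zero_iff by (auto simp: k_def)
  then have c: "cA = k\<^sup>2 / 4" "cB = k^3 / 6 - 2 * cA * k" by (simp_all add: P_def P'_def)
  have "cB = - (k^3) / 3" unfolding c by (simp add: power2_eq_square power3_eq_cube)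
  \<comment> \<open>k is a double root and the roots of P sum to zero, so the third root is -2
    k.\<close>
  then have Pk: "P x = - ((x - k)\<^sup>2 * (x + 2 * k) / 6)" for x
    unfolding P_def \<open>cB = - (k^3) / 3\<close> c(1) by (simp add: power2_eq_square power3_eq_cube field_simps)
  have "K z = k" for z
  proof -
    define v where "v = z - z0"
    define \<gamma> where "\<gamma> = (\<lambda>t::real. z0 + of_real t * v)"
    \<comment> \<open>Along the segment, (dK/dt)^2 \<le> 2 exp(2 phi) |v|^2 P(K) by
      \<open>P_eq\<close>. The factorization of P turns this into b times (K - k)^2, so the
      Lipschitz constant is the square root of the maximum of b.\<close>
    define b where "b = (\<lambda>t. exp (2 * \<phi> (\<gamma> t)) * (norm v)\<^sup>2 * \<bar>K (\<gamma> t) + 2 * k\<bar> / 3)"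
    have "continuous_on {0..1} b"
      unfolding b_def \<gamma>_def
      by (intro continuous_intros continuous_on_compose2[OF cont_phi[of UNIV]] continuous_on_compose2[OF cont_K[of UNIV]]) auto
    then have "bounded (b ` {0..1})" by (intro compact_imp_bounded compact_continuous_image) auto
    then obtain M where "\<forall>x\<in>b ` {0..1}. norm x \<le> M" unfolding bounded_iff by blast
    then have M: "\<bar>b t\<bar> \<le> M" if "t \<in> {0..1}" for t using that by force
    have M0: "M \<ge> 0" using M[of 0] by auto
    have "K (\<gamma> 1) - k = 0"
    proof (rule gronwall_zero[where y="\<lambda>t. K (\<gamma> t) - k" and M="sqrt M"
        and y'="\<lambda>t. 2 * exp (2 * \<phi> (\<gamma> t)) * Re (cnj (f (\<gamma> t)) * v)"])
      fix t :: real assume t: "0 \<le> t" "t \<le> 1"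
      have "(\<gamma> has_derivative (\<lambda>x. of_real x * v)) (at t)"
        unfolding \<gamma>_def by (auto intro!: derivative_eq_intros)
      from has_derivative_compose[OF this dK]
      show "((\<lambda>t. K (\<gamma> t) - k) has_real_derivative 2 * exp (2 * \<phi> (\<gamma> t)) * Re (cnj (f (\<gamma> t)) * v)) (at t)"
        unfolding has_field_derivative_def
        by (auto intro!: derivative_eq_intros simp: fun_eq_iff algebra_simps)
      let ?z = "\<gamma> t"
      have "\<bar>2 * exp (2 * \<phi> ?z) * Re (cnj (f ?z) * v)\<bar> \<le> 2 * exp (2 * \<phi> ?z) * (norm (f ?z) * norm v)"
        using abs_Re_le_cmod[of "cnj (f ?z) * v"] by (simp add: abs_mult norm_mult)
      then have "\<bar>2 * exp (2 * \<phi> ?z) * Re (cnj (f ?z) * v)\<bar>\<^sup>2 \<le> (2 * exp (2 * \<phi> ?z) * (norm (f ?z) * norm v))\<^sup>2"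
        by (rule power_mono) simp
      also have "\<dots> = 2 * exp (2 * \<phi> ?z) * (norm v)\<^sup>2 * P (K ?z)"
        by (simp add: P_eq power2_eq_square)
      also have "P (K ?z) = \<bar>P (K ?z)\<bar>" using P_nonneg by simp
      also have "\<bar>P (K ?z)\<bar> = (K ?z - k)\<^sup>2 * \<bar>K ?z + 2 * k\<bar> / 6"
        unfolding Pk by (simp add: abs_mult)
      also have "2 * exp (2 * \<phi> ?z) * (norm v)\<^sup>2 * ((K ?z - k)\<^sup>2 * \<bar>K ?z + 2 * k\<bar> / 6) = b t * (K ?z - k)\<^sup>2"
        by (simp add: b_def)
      also have "\<dots> \<le> M * (K ?z - k)\<^sup>2"
        using M[of t] t by (intro mult_right_mono) auto
      also have "\<dots> = (sqrt M * \<bar>K ?z - k\<bar>)\<^sup>2" using M0 by (simp add: power_mult_distrib)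
      finally show "\<bar>2 * exp (2 * \<phi> (\<gamma> t)) * Re (cnj (f (\<gamma> t)) * v)\<bar> \<le> sqrt M * \<bar>K (\<gamma> t) - k\<bar>"
        by (rule power2_le_imp_le) (simp add: M0)
    qed (simp add: \<gamma>_def k_def)
    then show ?thesis by (simp add: \<gamma>_def v_def)
  qed
  then show False using nonconst by auto
qed

lemma f'_nonzero: "f z = 0 \<Longrightarrow> f' z \<noteq> 0"
  using f'_at_zero[of z] P'_at_zero[of z] by auto

lemma ex_f_nonzero: "\<exists>z. f z \<noteq> 0"
proof (rule ccontr)
  assume "\<not> ?thesis"
  then have "f z = 0" for z by blast
  then show False using f'_nonzero df DERIV_unique
    by (metis DERIV_const ext)
qed

section \<open>The interval of curvature values\<close>

lemma range_K_interval:
  assumes "K z \<le> k" "k \<le> K w"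
  shows "\<exists>x. K x = k"
proof -
  have "connected (range K)" by (intro connected_continuous_image cont_K) auto
  then have "k \<in> range K" using assms connected_iff_interval[of "range K"] by (metis rangeI)
  then show ?thesis by auto
qed

text \<open>If K exceeded b it would also take the value b at a zero of f, so P' b is nonzero. A
  positive slope contradicts P > 0 just below b; a negative one makes P negative just above b, at
  values that K takes as well.\<close>

lemma K_upper:
  assumes k: "P k > 0" "K z = k" and b: "k < b" "P b = 0" "\<And>x. k \<le> x \<Longrightarrow> x < b \<Longrightarrow> P x > 0"
  shows "K w \<le> b"
proof (rule ccontr)
  assume "\<not> ?thesis"
  then have w: "K w > b" by simp
  obtain x where x: "K x = b" using range_K_interval[of z b w] k b w by auto
  then have "P' b \<noteq> 0" using P'_at_zero f_zero_iff b by blast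
  then consider "P' b > 0" | "P' b < 0" by linarith
  then show False
  proof cases
    case 1
    then obtain d where d: "d > 0" "\<And>h. h > 0 \<Longrightarrow> h < d \<Longrightarrow> P (b - h) < P b"
      using DERIV_pos_inc_left[OF dP] by blast
    have "P (b - min (d/2) (b - k)) < P b" using d(1) b(1) by (intro d(2)) auto
    moreover have "P (b - min (d/2) (b - k)) > 0" using d(1) b(1) by (intro b(3)) auto
    ultimately show False using b by simp
  next
    case 2
    then obtain d where d: "d > 0" "\<And>h. h > 0 \<Longrightarrow> h < d \<Longrightarrow> P (b + h) < P b"
      using DERIV_neg_dec_right[OF dP] by blast
    define h where "h = min (d/2) (K w - b)"
    have h: "0 < h" "h < d" "h \<le> K w - b" using d(1) w by (auto simp: h_def)
    have "P (b + h) < 0" using d(2)[OF h(1,2)] b by simp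
    moreover obtain y where "K y = b + h" using range_K_interval[of x "b + h" w] x h by force
    ultimately show False using P_nonneg[of y] by simp
  qed
qed

lemma K_lower:
  assumes k: "P k > 0" "K z = k" and b: "b < k" "P b = 0" "\<And>x. b < x \<Longrightarrow> x \<le> k \<Longrightarrow> P x > 0"
  shows "K w \<ge> b"
proof (rule ccontr)
  assume "\<not> ?thesis"
  then have w: "K w < b" by simp
  obtain x where x: "K x = b" using range_K_interval[of w b z] k b w by auto
  then have "P' b \<noteq> 0" using P'_at_zero f_zero_iff b by blast
  then consider "P' b > 0" | "P' b < 0" by linarith
  then show False
  proof cases
    case 2
    then obtain d where d: "d > 0" "\<And>h. h > 0 \<Longrightarrow> h < d \<Longrightarrow> P (b + h) < P b"
      using DERIV_neg_dec_right[OF dP] by blast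
    have "P (b + min (d/2) (k - b)) < P b" using d(1) b(1) by (intro d(2)) auto
    moreover have "P (b + min (d/2) (k - b)) > 0" using d(1) b(1) by (intro b(3)) auto
    ultimately show False using b by simp
  next
    case 1
    then obtain d where d: "d > 0" "\<And>h. h > 0 \<Longrightarrow> h < d \<Longrightarrow> P (b - h) < P b"
      using DERIV_pos_inc_left[OF dP] by blast
    define h where "h = min (d/2) (b - K w)"
    have h: "0 < h" "h < d" "h \<le> b - K w" using d(1) w by (auto simp: h_def)
    have "P (b - h) < 0" using d(2)[OF h(1,2)] b by simp
    moreover obtain y where "K y = b - h" using range_K_interval[of w "b - h" x] x h by force
    ultimately show False using P_nonneg[of y] by simp
  qed
qed


lemma upper_root:
  assumes "P k > 0"
  shows "\<exists>b>k. P b = 0 \<and> (\<forall>x. k \<le> x \<and> x < b \<longrightarrow> P x > 0)"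
proof -
  \<comment> \<open>Since c \<ge> 1, the lower terms of 6 P c are at most (6 |cB| + 12 |cA|) c^2,
    which is (c - |k| - 1) c^2, and the cubic term outweighs this.\<close>
  define c where "c = \<bar>k\<bar> + 6 * \<bar>cB\<bar> + 12 * \<bar>cA\<bar> + 1"
  have c: "c \<ge> 1" "c > k" by (auto simp: c_def)
  have "6 * P c = 6 * cB + 12 * cA * c - c * c * c" by (simp add: P_def power3_eq_cube)
  also have "6 * cB \<le> 6 * \<bar>cB\<bar> * (c * c)"
  proof -
    have "1 \<le> c * c" using c(1) by (simp add: mult_ge1_I)
    then have "6 * \<bar>cB\<bar> * 1 \<le> 6 * \<bar>cB\<bar> * (c * c)" by (intro mult_left_mono) auto
    then show ?thesis by simp
  qed
  also have "12 * cA * c \<le> 12 * \<bar>cA\<bar> * (c * c)"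
  proof -
    have "12 * cA * c \<le> 12 * \<bar>cA\<bar> * c" using c by (intro mult_right_mono) auto
    also have "\<dots> \<le> 12 * \<bar>cA\<bar> * (c * c)" using c by (intro mult_left_mono) auto
    finally show ?thesis .
  qed
  also have "6 * \<bar>cB\<bar> * (c * c) + 12 * \<bar>cA\<bar> * (c * c) - c * c * c = - ((\<bar>k\<bar> + 1) * (c * c))"
    by (subst (5) c_def) (simp add: algebra_simps)
  also have "\<dots> \<le> 0" by simp
  finally have "P c \<le> 0" by simp
  from first_zero_right[OF cont_P assms c(2) this] show ?thesis .
qed

text \<open>The last function is exp(2 phi) times the derivative of h P at K, so the sign of the
  Laplacian of H(K) is decided by a function of one real variable. Differentiability is required
  only at values of K because the H used later exists only below some bound.\<close>

lemma composite_potential: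
  assumes H: "\<And>z. (H has_real_derivative h (K z)) (at (K z))"
    and h: "\<And>z. (h has_real_derivative h' (K z)) (at (K z))"
    and h': "\<And>z. isCont h' (K z)"
  shows "plane_potential (\<lambda>z. H (K z)) (\<lambda>z. of_real (2 * h (K z) * exp (2 * \<phi> z)) * cnj (f z))
     (\<lambda>z. of_real (2 * h' (K z) * (exp (2 * \<phi> z))\<^sup>2) * (cnj (f z))\<^sup>2 + of_real (2 * h (K z) * exp (2 * \<phi> z)) * q z * cnj (f z))
     (\<lambda>z. exp (2 * \<phi> z) * (h' (K z) * P (K z) + h (K z) * P' (K z)))"
proof
  fix z
  show "((\<lambda>z. H (K z)) has_derivative (\<lambda>v. Re (of_real (2 * h (K z) * exp (2 * \<phi> z)) * cnj (f z) * v))) (at z)"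
    by (rule has_derivative_eq_rhs, rule has_derivative_compose[OF dK H[unfolded has_field_derivative_def]])
       (auto simp: fun_eq_iff algebra_simps)
  define e where "e = exp (2 * \<phi> z)"
  have dh: "((\<lambda>z. h (K z)) has_derivative (\<lambda>v. h' (K z) * (2 * e * Re (cnj (f z) * v)))) (at z)"
    using has_derivative_compose[OF dK h[unfolded has_field_derivative_def]] by (simp add: e_def)
  show "((\<lambda>z. of_real (2 * h (K z) * exp (2 * \<phi> z)) * cnj (f z)) has_derivative
     (\<lambda>v. (of_real (2 * h' (K z) * (exp (2 * \<phi> z))\<^sup>2) * (cnj (f z))\<^sup>2 + of_real (2 * h (K z) * exp (2 * \<phi> z)) * q z * cnj (f z)) * v +
     of_real (exp (2 * \<phi> z) * (h' (K z) * P (K z) + h (K z) * P' (K z))) * cnj v)) (at z)"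
  proof (rule has_derivative_eq_rhs)
    show "((\<lambda>z. of_real (2 * h (K z) * exp (2 * \<phi> z)) * cnj (f z)) has_derivative
      (\<lambda>v. of_real (2 * h (K z) * exp (2 * \<phi> z)) * cnj (f' z * v) +
           of_real (2 * h (K z) * (2 * exp (2 * \<phi> z) * Re (q z * v)) + (2 * (h' (K z) * (2 * e * Re (cnj (f z) * v)))) * exp (2 * \<phi> z)) * cnj (f z))) (at z)"
      by (intro has_derivative_mult has_derivative_of_real has_derivative_mult_right dE dh has_derivative_cnj df_real)
    show "(\<lambda>v. of_real (2 * h (K z) * exp (2 * \<phi> z)) * cnj (f' z * v) +
           of_real (2 * h (K z) * (2 * exp (2 * \<phi> z) * Re (q z * v)) + (2 * (h' (K z) * (2 * e * Re (cnj (f z) * v)))) * exp (2 * \<phi> z)) * cnj (f z)) =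
      (\<lambda>v. (of_real (2 * h' (K z) * (exp (2 * \<phi> z))\<^sup>2) * (cnj (f z))\<^sup>2 + of_real (2 * h (K z) * exp (2 * \<phi> z)) * q z * cnj (f z)) * v +
     of_real (exp (2 * \<phi> z) * (h' (K z) * P (K z) + h (K z) * P' (K z))) * cnj v)"
    proof
      fix v
      let ?h = "complex_of_real (h (K z))" and ?h' = "complex_of_real (h' (K z))" and ?e = "complex_of_real e"
      have R: "complex_of_real (2 * Re w) = w + cnj w" for w by (simp add: complex_add_cnj)
      have PP: "complex_of_real (P (K z)) = 2 * ?e * f z * cnj (f z)"
        unfolding P_eq e_def by (simp add: complex_norm_square mult_ac del: of_real_power flip: of_real_power)
      have PP': "complex_of_real (P' (K z)) = 2 * (cnj (q z) * cnj (f z) + cnj (f' z))"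
      proof -
        have "cnj (q z * f z + f' z) = of_real (P' (K z) / 2)" by (subst A_eq) simp
        then have "of_real (P' (K z) / 2) = cnj (q z) * cnj (f z) + cnj (f' z)" by simp
        then have "2 * complex_of_real (P' (K z) / 2) = 2 * (cnj (q z) * cnj (f z) + cnj (f' z))" by (rule arg_cong)
        then show ?thesis by simp
      qed
      have "of_real (2 * h (K z) * e) * cnj (f' z * v) +
           of_real (2 * h (K z) * (2 * e * Re (q z * v)) + (2 * (h' (K z) * (2 * e * Re (cnj (f z) * v)))) * e) * cnj (f z)
         = 2 * ?h * ?e * cnj (f' z * v) + (2 * ?h * ?e * of_real (2 * Re (q z * v)) + 2 * ?h' * ?e * ?e * of_real (2 * Re (cnj (f z) * v))) * cnj (f z)"
        by (simp add: algebra_simps)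
      also have "\<dots> = (2 * ?h' * ?e\<^sup>2 * (cnj (f z))\<^sup>2 + 2 * ?h * ?e * q z * cnj (f z)) * v +
          ?e * (?h' * (2 * ?e * f z * cnj (f z)) + ?h * (2 * (cnj (q z) * cnj (f z) + cnj (f' z)))) * cnj v"
        unfolding R by (simp add: algebra_simps power2_eq_square)
      also have "\<dots> = (of_real (2 * h' (K z) * e\<^sup>2) * (cnj (f z))\<^sup>2 + of_real (2 * h (K z) * e) * q z * cnj (f z)) * v +
     of_real (e * (h' (K z) * P (K z) + h (K z) * P' (K z))) * cnj v"
        unfolding PP[symmetric] PP'[symmetric] by simp
      finally show "of_real (2 * h (K z) * exp (2 * \<phi> z)) * cnj (f' z * v) +
           of_real (2 * h (K z) * (2 * exp (2 * \<phi> z) * Re (q z * v)) + (2 * (h' (K z) * (2 * e * Re (cnj (f z) * v)))) * exp (2 * \<phi> z)) * cnj (f z) =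
       (of_real (2 * h' (K z) * (exp (2 * \<phi> z))\<^sup>2) * (cnj (f z))\<^sup>2 + of_real (2 * h (K z) * exp (2 * \<phi> z)) * q z * cnj (f z)) * v +
     of_real (exp (2 * \<phi> z) * (h' (K z) * P (K z) + h (K z) * P' (K z))) * cnj v"
        unfolding e_def .
    qed
  qed
next
  have iK: "isCont K z" for z using has_derivative_continuous[OF dK] .
  then have 1: "continuous_on UNIV (\<lambda>z. h (K z))" "continuous_on UNIV (\<lambda>z. h' (K z))"
    by (intro continuous_at_imp_continuous_on ballI isCont_o2[OF iK DERIV_isCont[OF h]] isCont_o2[OF iK h'])+
  have 2: "continuous_on UNIV (\<lambda>z. P (K z))" "continuous_on UNIV (\<lambda>z. P' (K z))"
    unfolding P_def P'_def by (intro continuous_intros cont_K; simp)+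
  note c = 1 2 cont_phi cont_f cont_q
  show "continuous_on UNIV (\<lambda>z. of_real (2 * h' (K z) * (exp (2 * \<phi> z))\<^sup>2) * (cnj (f z))\<^sup>2 + of_real (2 * h (K z) * exp (2 * \<phi> z)) * q z * cnj (f z))"
    by (intro continuous_intros c)
  show "continuous_on UNIV (\<lambda>z. exp (2 * \<phi> z) * (h' (K z) * P (K z) + h (K z) * P' (K z)))"
    by (intro continuous_intros c)
qed


lemma P_factor_root: "P r = 0 \<Longrightarrow> P k = (r - k) * (k\<^sup>2 + k * r + r\<^sup>2 - 12 * cA) / 6"
proof -
  assume "P r = 0"
  then have "P k = P k - P r" by simp
  also have "\<dots> = (r - k) * (k\<^sup>2 + k * r + r\<^sup>2 - 12 * cA) / 6"
    by (simp add: P_def power2_eq_square power3_eq_cube field_simps)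
  finally show ?thesis .
qed

text \<open>If P were positive on the whole half-line below its root b, then a suitable increasing function
  H of K with (H' P)' < 0 would be superharmonic and bounded below on the plane. The choice
  H' P = (b - k)/(1 + b - k) makes H' integrable at minus infinity.\<close>

lemma P_not_positive_below:
  assumes b: "P b = 0" "\<And>k. k < b \<Longrightarrow> P k > 0" and Kb: "\<And>z. K z \<le> b"
  shows False
proof -
  define Q where "Q = (\<lambda>k. k\<^sup>2 + k * b + b\<^sup>2 - 12 * cA)"
  have PQ: "P k = (b - k) * Q k / 6" for k
    using P_factor_root[OF b(1)] by (simp add: Q_def)
  have Qpos: "Q k > 0" if "k < b" for k
    using b(2)[OF that] that by (simp add: PQ zero_less_mult_iff)
  have contQ: "continuous_on UNIV Q" unfolding Q_def by (intro continuous_intros)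
  \<comment> \<open>When K attains b, antiderivatives must be differentiable at b too, so the
    interval is extended slightly beyond b. There Q stays positive, because b is a simple root of P
    and therefore no root of the cofactor Q.\<close>
  obtain B where B: "B \<le> b + 1" "\<And>k. k < B \<Longrightarrow> Q k > 0" "\<And>z. K z < B" "b \<le> B"
  proof (cases "\<exists>z. K z = b")
    case True
    then obtain z where "K z = b" by blast
    then have "P' b \<noteq> 0" using P'_at_zero[of z] f_zero_iff[of z] b by auto
    then have "Q b \<noteq> 0" by (simp add: Q_def P'_def power2_eq_square)
    moreover have "Q b \<ge> 0"
    proof (rule tendsto_lowerbound)
      show "(Q \<longlongrightarrow> Q b) (at_left b)"
        using contQ by (auto simp: continuous_on_eq_continuous_at isCont_def intro: filterlim_at_split[THEN iffD1, THEN conjunct1])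
      show "\<forall>\<^sub>F x in at_left b. 0 \<le> Q x"
        using Qpos by (auto intro!: eventually_at_leftI[of "b-1"] less_imp_le)
    qed simp
    ultimately have "Q b > 0" by simp
    moreover have "isCont Q b" using contQ by (simp add: continuous_on_eq_continuous_at)
    ultimately have "\<forall>\<^sub>F k in nhds b. Q k > 0"
      by (metis continuous_within order_tendstoD(1) tendsto_within_open_NO_MATCH eventually_nhds_conv_at isCont_def)
    then obtain d where d: "d > 0" "\<And>k. dist k b < d \<Longrightarrow> Q k > 0"
      by (auto simp: eventually_nhds_metric)
    show ?thesis
    proof (rule that[of "b + min d 1"])
      show "Q k > 0" if "k < b + min d 1" for k
        using that Qpos[of k] d(2)[of k] by (cases "k < b") (auto simp: dist_real_def)
      show "K z < b + min d 1" for z using Kb[of z] d(1) by (smt (verit) min_def)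
    qed (use d(1) in auto)
  next
    case False
    show ?thesis
      by (rule that[of b]) (use False Kb Qpos in \<open>auto simp: less_le\<close>)
  qed
  \<comment> \<open>With x = 1 + b - k this is the solution of h P = (x - 1)/x, whose derivative in
    k is -1/x^2, hence negative.\<close>
  define h where "h = (\<lambda>k. 6 / ((1 + b - k) * Q k))"
  define h' where "h' = (\<lambda>k. - (6 * ((1 + b - k) * (2 * k + b) - Q k)) / ((1 + b - k) * Q k)\<^sup>2)"
  have nz: "1 + b - k > 0" "Q k > 0" if "k < B" for k using B(1) B(2)[OF that] that by linarith+
  have dQ: "(Q has_real_derivative 2 * k + b) (at k)" for k
    unfolding Q_def by (auto intro!: derivative_eq_intros)
  have dh: "(h has_real_derivative h' k) (at k)" if "k < B" for k
  proof -
    have "(1 + b - k) * Q k \<noteq> 0" using nz[OF that] by simp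
    then show ?thesis
      unfolding h_def h'_def by (auto intro!: derivative_eq_intros dQ simp: power2_eq_square)
  qed
  have ch': "isCont h' k" if "k < B" for k
    unfolding h'_def using nz[OF that] DERIV_isCont[OF dQ] by (intro continuous_intros) auto
  have hpos: "h k > 0" if "k < B" for k using nz[OF that] by (simp add: h_def)
  have key: "h' k * P k + h k * P' k < 0" if "k < B" for k
  proof -
    define x where "x = 1 + b - k"
    define y where "y = Q k"
    have xy: "x > 0" "y > 0" using nz[OF that] by (simp_all add: x_def y_def)
    have P: "P k = (x - 1) * y / 6" by (simp add: PQ x_def y_def)
    have P': "P' k = (- y + (x - 1) * (2 * k + b)) / 6"
      by (simp add: P'_def x_def y_def Q_def power2_eq_square algebra_simps)
    have h: "h k = 6 / (x * y)" "h' k = - (6 * (x * (2 * k + b) - y)) / (x * y)\<^sup>2"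
      by (simp_all add: h_def h'_def x_def y_def)
    have "h' k * P k + h k * P' k = - (1 / x\<^sup>2)"
      unfolding P P' h using xy by (simp add: divide_simps power2_eq_square) (simp add: algebra_simps)
    then show ?thesis using xy by simp
  qed
  obtain H where H: "\<And>k. k < B \<Longrightarrow> (H has_real_derivative h k) (at k)"
  proof -
    have "\<exists>F. \<forall>x::real. - \<infinity> < ereal x \<longrightarrow> ereal x < ereal B \<longrightarrow> (F has_vector_derivative h x) (at x)"
      by (rule einterval_antiderivative) (auto intro: DERIV_isCont[OF dh])
    then show ?thesis using that by (auto simp: has_real_derivative_iff_has_vector_derivative)
  qed
  interpret u: plane_potential "\<lambda>z. H (K z)" "\<lambda>z. of_real (2 * h (K z) * exp (2 * \<phi> z)) * cnj (f z)"
     "\<lambda>z. of_real (2 * h' (K z) * (exp (2 * \<phi> z))\<^sup>2) * (cnj (f z))\<^sup>2 + of_real (2 * h (K z) * exp (2 * \<phi> z)) * q z * cnj (f z)"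
     "\<lambda>z. exp (2 * \<phi> z) * (h' (K z) * P (K z) + h (K z) * P' (K z))"
    by (intro composite_potential H dh ch' B(3))
  have neg: "exp (2 * \<phi> z) * (h' (K z) * P (K z) + h (K z) * P' (K z)) < 0" for z
    using key[OF B(3)] by (simp add: mult_pos_neg)
  \<comment> \<open>R is so large that Q k \<ge> (1 + b - k)/2 for all k \<le> -R. This bounds h by
    12/(1 + b - k)^2, which is integrable at minus infinity.\<close>
  define R where "R = 2 * \<bar>b\<bar> + \<bar>b\<^sup>2 - 12 * cA\<bar> + 2"
  define k0 where "k0 = - R"
  have k0: "k0 < b" "R \<ge> 1" by (auto simp: k0_def R_def)
  have hle: "h k \<le> 12 / (1 + b - k)\<^sup>2" if "k \<le> k0" for k
  proof -
    have kB: "k < B" using that k0 B(4) by linarith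
    define y where "y = - k"
    have y: "y \<ge> R" "y \<ge> 1" using that k0(2) by (simp_all add: k0_def y_def)
    have "y * R \<le> y * y" using y by (intro mult_left_mono) auto
    moreover have "y * R = 2 * (y * \<bar>b\<bar>) + y * (\<bar>b\<^sup>2 - 12 * cA\<bar> + 1) + y" by (simp add: R_def algebra_simps)
    moreover have "1 * (\<bar>b\<^sup>2 - 12 * cA\<bar> + 1) \<le> y * (\<bar>b\<^sup>2 - 12 * cA\<bar> + 1)" using y by (intro mult_right_mono) auto
    moreover have "y * b \<le> y * \<bar>b\<bar>" using y by (intro mult_left_mono) auto
    moreover have "1 * \<bar>b\<bar> \<le> y * \<bar>b\<bar>" using y by (intro mult_right_mono) auto
    moreover have "0 \<le> \<bar>b\<^sup>2 - 12 * cA\<bar> + (b\<^sup>2 - 12 * cA)" by linarith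
    moreover define B' where "B' = \<bar>b\<bar>"
    moreover define c where "c = \<bar>b\<^sup>2 - 12 * cA\<bar> + 1"
    moreover define d where "d = b\<^sup>2 - 12 * cA"
    ultimately have "y * R \<le> y * y" "y * R = 2 * (y * B') + y * c + y" "c \<le> y * c" "y * b \<le> y * B'"
      "B' \<le> y * B'" "c + d \<ge> 1" by simp_all
    then have "y * y - y * b + d \<ge> B' + 1 + y" by linarith
    then have "y * y - y * b + (b\<^sup>2 - 12 * cA) \<ge> \<bar>b\<bar> + 1 + y" by (simp add: B'_def d_def)
    moreover have "Q k = y * y - y * b + (b\<^sup>2 - 12 * cA)" by (simp add: Q_def y_def power2_eq_square)
    moreover have "b \<le> \<bar>b\<bar>" "k = - y" by (simp_all add: y_def)
    ultimately have "Q k \<ge> (1 + b - k) / 2" using y(2) by simp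
    then show ?thesis using nz[OF kB] by (simp add: h_def divide_simps power2_eq_square)
  qed
  \<comment> \<open>To the left of \<open>k0\<close> the function H - 12/(1 + b - k) is
    nonincreasing by \<open>hle\<close>; to the right of it H itself is nondecreasing.\<close>
  have low: "H k \<ge> H k0 - 12 / (1 + b - k0)" if "k < B" for k
  proof (cases "k \<le> k0")
    case False
    have "H k0 \<le> H k"
      by (rule DERIV_nonneg_imp_nondecreasing) (use False that in \<open>auto intro!: exI H less_imp_le[OF hpos]\<close>)
    moreover have "0 \<le> 12 / (1 + b - k0)" using k0 by simp
    ultimately show ?thesis by linarith
  next
    case True
    have "H k - 12 / (1 + b - k) \<ge> H k0 - 12 / (1 + b - k0)"
    proof (rule DERIV_nonpos_imp_nonincreasing[of k k0 "\<lambda>k. H k - 12 / (1 + b - k)"])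
      fix x assume x: "k \<le> x" "x \<le> k0"
      then have xB: "x < B" "1 + b - x \<noteq> 0" using k0 B(4) by auto
      have "((\<lambda>k. H k - 12 / (1 + b - k)) has_real_derivative h x - 12 / (1 + b - x)\<^sup>2) (at x)"
        using xB by (auto intro!: derivative_eq_intros H simp: power2_eq_square)
      then show "\<exists>y. ((\<lambda>k. H k - 12 / (1 + b - k)) has_real_derivative y) (at x) \<and> y \<le> 0"
        using hle[OF x(2)] by (intro exI conjI) auto
    qed (rule True)
    moreover have "0 \<le> 12 / (1 + b - k)" using k0 True by simp
    ultimately show ?thesis by linarith
  qed
  obtain z where "H (K z) < H k0 - 12 / (1 + b - k0)"
    using u.superharmonic_unbounded_below[OF neg] by blast
  with low[OF B(3)[of z]] show False by linarith
qed

lemma lower_root: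
  assumes "P k > 0" "c < k" "P c \<le> 0"
  shows "\<exists>b<k. P b = 0 \<and> (\<forall>x. b < x \<and> x \<le> k \<longrightarrow> P x > 0)"
proof -
  have "continuous_on UNIV (\<lambda>x. P (- x))"
    unfolding P_def by (intro continuous_intros) auto
  from first_zero_right[OF this, of "-k" "-c"] assms
  obtain b where b: "b > - k" "P (- b) = 0" "\<And>x. - k \<le> x \<Longrightarrow> x < b \<Longrightarrow> P (- x) > 0" by auto
  show ?thesis
  proof (intro exI[of _ "- b"] conjI allI impI)
    fix x assume "- b < x \<and> x \<le> k"
    then show "P x > 0" using b(3)[of "- x"] by simp
  qed (use b in auto)
qed

text \<open>These are roots of P that enclose the range of K, and not a maximum and minimum over the
  plane: for a radial metric one of the two values is only approached at infinity.\<close>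

definition K1 :: real where "K1 = (SOME K1. \<exists>K2<K1. P K1 = 0 \<and> P K2 = 0 \<and> (\<forall>k. K2 < k \<and> k < K1 \<longrightarrow> P k > 0) \<and> (\<forall>z. K2 \<le> K z \<and> K z \<le> K1))"
definition K2 :: real where "K2 = (SOME K2. K2<K1 \<and> P K1 = 0 \<and> P K2 = 0 \<and> (\<forall>k. K2 < k \<and> k < K1 \<longrightarrow> P k > 0) \<and> (\<forall>z. K2 \<le> K z \<and> K z \<le> K1))"
text \<open>The third root, since the roots of a cubic without quadratic term sum to zero.\<close>

definition K0 :: real where "K0 = - K1 - K2"

text \<open>Starting from a point where f is nonzero, hence P(K) > 0, the enclosing roots are the
  nearest ones above and below. The one below exists by \<open>P_not_positive_below\<close>.\<close>

lemma K_range: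
  shows "K2 < K1" "P K1 = 0" "P K2 = 0" "\<And>k. K2 < k \<Longrightarrow> k < K1 \<Longrightarrow> P k > 0" "\<And>z. K2 \<le> K z" "\<And>z. K z \<le> K1"
proof -
  obtain z where "f z \<noteq> 0" using ex_f_nonzero by blast
  then have z: "P (K z) > 0" using P_nonneg[of z] f_zero_iff[of z] by simp
  then obtain b where b: "b > K z" "P b = 0" "\<And>x. K z \<le> x \<Longrightarrow> x < b \<Longrightarrow> P x > 0"
    using upper_root by blast
  have Kb: "K w \<le> b" for w using K_upper[OF z refl b] .
  have "\<exists>c<K z. P c \<le> 0"
  proof (rule ccontr)
    assume "\<not> ?thesis"
    then have "P k > 0" if "k < b" for k using b(3)[of k] that by (cases "k < K z") (auto simp: not_le)
    then show False using P_not_positive_below[OF b(2) _ Kb] by blast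
  qed
  then obtain a where a: "a < K z" "P a = 0" "\<And>x. a < x \<Longrightarrow> x \<le> K z \<Longrightarrow> P x > 0"
    using lower_root[OF z] by blast
  have Ka: "a \<le> K w" for w using K_lower[OF z refl a] .
  have "P k > 0" if "a < k" "k < b" for k using a(3)[of k] b(3)[of k] that by (cases "k \<le> K z") auto
  then have "\<exists>K1. \<exists>K2<K1. P K1 = 0 \<and> P K2 = 0 \<and> (\<forall>k. K2 < k \<and> k < K1 \<longrightarrow> P k > 0) \<and> (\<forall>z. K2 \<le> K z \<and> K z \<le> K1)"
    using a b Ka Kb by (intro exI[of _ b] exI[of _ a]) auto
  from someI_ex[OF this] have "\<exists>K2<K1. P K1 = 0 \<and> P K2 = 0 \<and> (\<forall>k. K2 < k \<and> k < K1 \<longrightarrow> P k > 0) \<and> (\<forall>z. K2 \<le> K z \<and> K z \<le> K1)"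
    unfolding K1_def[symmetric] .
  then have "\<exists>K2. K2<K1 \<and> P K1 = 0 \<and> P K2 = 0 \<and> (\<forall>k. K2 < k \<and> k < K1 \<longrightarrow> P k > 0) \<and> (\<forall>z. K2 \<le> K z \<and> K z \<le> K1)" by blast
  from someI_ex[OF this] have "K2<K1 \<and> P K1 = 0 \<and> P K2 = 0 \<and> (\<forall>k. K2 < k \<and> k < K1 \<longrightarrow> P k > 0) \<and> (\<forall>z. K2 \<le> K z \<and> K z \<le> K1)"
    unfolding K2_def[symmetric] .
  then show "K2 < K1" "P K1 = 0" "P K2 = 0" "\<And>k. K2 < k \<Longrightarrow> k < K1 \<Longrightarrow> P k > 0" "\<And>z. K2 \<le> K z" "\<And>z. K z \<le> K1"
    by blast+
qed

lemma cA_eq: "12 * cA = K2\<^sup>2 + K2 * K1 + K1\<^sup>2"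
  using P_factor_root[OF K_range(2), of K2] K_range(1,3) by simp

lemma P_factor: "P k = (K1 - k) * (k - K2) * (k - K0) / 6"
  unfolding P_factor_root[OF K_range(2), of k] K0_def cA_eq by (simp add: power2_eq_square algebra_simps)

text \<open>A third root above \<open>K2\<close> would make P negative just above
  \<open>K2\<close>.\<close>

lemma K0_le: "K0 \<le> K2"
proof (rule ccontr)
  assume "\<not> K0 \<le> K2"
  define k where "k = (K2 + min K0 K1) / 2"
  have k: "K2 < k" "k < K1" "k < K0" using \<open>\<not> K0 \<le> K2\<close> K_range(1) by (auto simp: k_def)
  then have "(K1 - k) * (k - K2) * (k - K0) < 0" by (intro mult_pos_neg mult_pos_pos) auto
  with K_range(4)[OF k(1,2)] show False by (simp add: P_factor)
qed

text \<open>Half the absolute slopes of P at \<open>K1\<close> and \<open>K2\<close>, written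
  through the roots. b vanishes exactly when \<open>K2\<close> is a double root, which corresponds
  to a cusp.\<close>

definition a :: real where "a = (K1 - K0) * (K1 - K2) / 12"
definition b :: real where "b = (K2 - K0) * (K1 - K2) / 12"

lemma ab: "a > 0" "b \<ge> 0" "b < a" "P' K1 = - 2 * a" "P' K2 = 2 * b"
proof -
  show "a > 0" "b \<ge> 0" "b < a" using K0_le K_range(1) by (auto simp: a_def b_def intro!: mult_strict_right_mono)
  have "12 * P' k = 2 * (K2\<^sup>2 + K2 * K1 + K1\<^sup>2) - 6 * k\<^sup>2" for k
    unfolding cA_eq[symmetric] by (simp add: P'_def)
  from this[of K1] this[of K2] show "P' K1 = - 2 * a" "P' K2 = 2 * b"
    by (simp_all add: a_def b_def K0_def power2_eq_square algebra_simps)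
qed

lemma K_at_zero: "f z = 0 \<Longrightarrow> (K z = K1 \<and> f' z = - of_real a) \<or> (K z = K2 \<and> f' z = of_real b \<and> b > 0)"
proof -
  assume f: "f z = 0"
  then have "P (K z) = 0" by (simp add: f_zero_iff)
  then have "K z = K1 \<or> K z = K2" using K_range(4)[of "K z"] K_range(5)[of z] K_range(6)[of z] by fastforce
  then show ?thesis
  proof
    assume "K z = K1"
    then show ?thesis using f'_at_zero[OF f] by (simp add: ab(4))
  next
    assume z: "K z = K2"
    then have "f' z = of_real b" using f'_at_zero[OF f] by (simp add: ab(5))
    moreover from this have "b \<noteq> 0" using f'_nonzero[OF f] by auto
    ultimately show ?thesis using z ab(2) by simp
  qed
qed

lemma K_strict: "f z \<noteq> 0 \<Longrightarrow> K2 < K z \<and> K z < K1"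
  using f_zero_iff[of z] K_range(2,3) K_range(5,6)[of z] by (metis less_le)

end

section \<open>The vector field is a polynomial\<close>

lemma continuous_integrable_ball:
  fixes u :: "complex \<Rightarrow> real"
  assumes "continuous_on UNIV u"
  shows "u integrable_on ball c R"
proof -
  obtain x y where xy: "ball c R \<subseteq> cbox x y" using bounded_subset_cbox_symmetric[OF bounded_ball] by metis
  have "u absolutely_integrable_on cbox x y"
    using assms continuous_on_subset by (intro absolutely_integrable_continuous) blast
  then have "u absolutely_integrable_on ball c R" by (rule set_integrable_subset) (use xy in auto)
  then show ?thesis using set_lebesgue_integral_eq_integral(1) by blast
qed

lemma integral_const_ball:
  assumes "R > 0"
  shows "integral (ball (c::complex) R) (\<lambda>_. M::real) = pi * R\<^sup>2 * M"
proof -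
  have "((\<lambda>r. r * circle_integral (\<lambda>_. M) c r) has_integral integral (ball c R) (\<lambda>_. M)) {0..R}"
    using assms by (intro polar_circle_integral) auto
  moreover have "((\<lambda>r. r * (2 * pi * M)) has_integral ((R\<^sup>2 - 0\<^sup>2)/2) * (2 * pi * M)) {0..R}"
    using assms by (intro has_integral_mult_left ident_has_integral) auto
  ultimately have "integral (ball c R) (\<lambda>_. M) = ((R\<^sup>2 - 0\<^sup>2)/2) * (2 * pi * M)"
    by (intro has_integral_unique) (auto simp: circle_integral_def)
  then show ?thesis by simp
qed

text \<open>The half Laplacian is twice the square of the spherical derivative |f'|/(1 + |f|^2), so
  the function is subharmonic. The summand 1 keeps it smooth and nonnegative at the zeros of f,
  unlike ln |f|.\<close>

lemma log_norm_potential: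
  assumes df: "\<And>z. (f has_field_derivative f' z) (at z)" and df': "\<And>z. (f' has_field_derivative f'' z) (at z)"
    and cf'': "continuous_on UNIV f''"
  shows "plane_potential (\<lambda>z. ln (1 + (norm (f z))\<^sup>2)) (\<lambda>z. 2 * f' z * cnj (f z) / of_real (1 + (norm (f z))\<^sup>2))
     (\<lambda>z. 2 * f'' z * cnj (f z) / of_real (1 + (norm (f z))\<^sup>2) - 2 * (f' z * cnj (f z))\<^sup>2 / (of_real (1 + (norm (f z))\<^sup>2))\<^sup>2)
     (\<lambda>z. 2 * (norm (f' z))\<^sup>2 / (1 + (norm (f z))\<^sup>2)\<^sup>2)"
proof
  fix z
  note d = df[unfolded has_field_derivative_def] df'[unfolded has_field_derivative_def]
  define N where "N = (\<lambda>z. 1 + (norm (f z))\<^sup>2)"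
  have Neq: "1 + (norm (f z))\<^sup>2 = N z" for z by (simp add: N_def)
  have Nf: "N z = 1 + Re (f z * cnj (f z))" for z
    unfolding N_def cmod_power2 by (simp add: power2_eq_square)
  have N0: "N z > 0" for z by (simp add: N_def add_pos_nonneg)
  have cN: "complex_of_real (N z) = 1 + f z * cnj (f z)" for z
    by (simp add: N_def complex_norm_square del: of_real_power flip: of_real_power)
  have dN: "(N has_derivative (\<lambda>v. 2 * Re (f' z * cnj (f z) * v))) (at z)"
    unfolding Nf[abs_def]
  proof (rule has_derivative_eq_rhs)
    show "((\<lambda>z. 1 + Re (f z * cnj (f z))) has_derivative (\<lambda>v. 0 + Re (f z * cnj (f' z * v) + f' z * v * cnj (f z)))) (at z)"
      by (intro has_derivative_add has_derivative_const has_derivative_Re has_derivative_mult has_derivative_cnj d)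
  qed (auto simp: fun_eq_iff algebra_simps)
  have "((\<lambda>z. ln (N z)) has_derivative (\<lambda>v. 2 * Re (f' z * cnj (f z) * v) / N z)) (at z)"
    using N0[of z] by (auto intro!: derivative_eq_intros dN simp: fun_eq_iff divide_simps)
  then show "((\<lambda>z. ln (1 + (norm (f z))\<^sup>2)) has_derivative
     (\<lambda>v. Re (2 * f' z * cnj (f z) / of_real (1 + (norm (f z))\<^sup>2) * v))) (at z)"
    unfolding Neq by (rule has_derivative_eq_rhs) (simp add: fun_eq_iff Re_divide_of_real[symmetric] mult.assoc)
  have dcN: "((\<lambda>z. 1 + f z * cnj (f z)) has_derivative (\<lambda>v. f z * cnj (f' z * v) + f' z * v * cnj (f z))) (at z)"
  proof (rule has_derivative_eq_rhs)
    show "((\<lambda>z. 1 + f z * cnj (f z)) has_derivative (\<lambda>v. 0 + (f z * cnj (f' z * v) + f' z * v * cnj (f z)))) (at z)"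
      by (intro has_derivative_add has_derivative_const has_derivative_mult has_derivative_cnj d)
  qed simp
  have nz: "1 + f z * cnj (f z) \<noteq> 0" using N0[of z] cN[of z] by (metis less_irrefl of_real_eq_0_iff)
  have nn: "complex_of_real ((norm w)\<^sup>2) = w * cnj w" for w by (rule complex_norm_square)
  show "((\<lambda>z. 2 * f' z * cnj (f z) / of_real (1 + (norm (f z))\<^sup>2)) has_derivative
     (\<lambda>v. (2 * f'' z * cnj (f z) / of_real (1 + (norm (f z))\<^sup>2) - 2 * (f' z * cnj (f z))\<^sup>2 / (of_real (1 + (norm (f z))\<^sup>2))\<^sup>2) * v +
      of_real (2 * (norm (f' z))\<^sup>2 / (1 + (norm (f z))\<^sup>2)\<^sup>2) * cnj v)) (at z)"
  proof -
    have num: "((\<lambda>z. 2 * f' z * cnj (f z)) has_derivative (\<lambda>v. 2 * f' z * cnj (f' z * v) + 2 * (f'' z * v) * cnj (f z))) (at z)"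
      by (intro has_derivative_mult has_derivative_mult_right has_derivative_cnj d)
    have "((\<lambda>z. 2 * f' z * cnj (f z) / (1 + f z * cnj (f z))) has_derivative
       (\<lambda>v. ((2 * f' z * cnj (f' z * v) + 2 * (f'' z * v) * cnj (f z)) * (1 + f z * cnj (f z)) -
             2 * f' z * cnj (f z) * (f z * cnj (f' z * v) + f' z * v * cnj (f z))) / ((1 + f z * cnj (f z)) * (1 + f z * cnj (f z))))) (at z)"
      by (rule has_derivative_divide'[OF num dcN nz])
    moreover have "(\<lambda>v. ((2 * f' z * cnj (f' z * v) + 2 * (f'' z * v) * cnj (f z)) * (1 + f z * cnj (f z)) -
             2 * f' z * cnj (f z) * (f z * cnj (f' z * v) + f' z * v * cnj (f z))) / ((1 + f z * cnj (f z)) * (1 + f z * cnj (f z)))) =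
       (\<lambda>v. (2 * f'' z * cnj (f z) / (1 + f z * cnj (f z)) - 2 * (f' z * cnj (f z))\<^sup>2 / (1 + f z * cnj (f z))\<^sup>2) * v +
      2 * (f' z * cnj (f' z)) / (1 + f z * cnj (f z))\<^sup>2 * cnj v)"
      using nz by (simp add: fun_eq_iff divide_simps power2_eq_square) (simp add: algebra_simps)
    moreover have "complex_of_real (2 * (norm (f' z))\<^sup>2 / (1 + (norm (f z))\<^sup>2)\<^sup>2) = 2 * (f' z * cnj (f' z)) / (1 + f z * cnj (f z))\<^sup>2"
      unfolding Neq of_real_divide of_real_mult of_real_power cN nn[symmetric] by simp
    ultimately show ?thesis
      unfolding Neq cN by simp
  qed
next
  have cf: "continuous_on UNIV f" "continuous_on UNIV f'"
    using df df' by (auto intro!: continuous_at_imp_continuous_on DERIV_isCont)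
  have nz: "complex_of_real (1 + (norm (f z))\<^sup>2) \<noteq> 0" "1 + (norm (f z))\<^sup>2 \<noteq> 0" for z
    by (metis add_pos_nonneg less_irrefl of_real_eq_0_iff zero_le_power2 zero_less_one)+
  show "continuous_on UNIV (\<lambda>z. 2 * f'' z * cnj (f z) / of_real (1 + (norm (f z))\<^sup>2) - 2 * (f' z * cnj (f z))\<^sup>2 / (of_real (1 + (norm (f z))\<^sup>2))\<^sup>2)"
    by (intro continuous_intros cf cf'') (use nz in auto)
  show "continuous_on UNIV (\<lambda>z. 2 * (norm (f' z))\<^sup>2 / (1 + (norm (f z))\<^sup>2)\<^sup>2)"
    by (intro continuous_intros cf) (use nz in auto)
qed

context hcmu_plane
begin

lemma phi_potential: "plane_potential \<phi> q p (\<lambda>z. - (K z * exp (2 * \<phi> z) / 2))"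
proof
  show "continuous_on UNIV (\<lambda>z. - (K z * exp (2 * \<phi> z) / 2))" by (intro continuous_intros cont_K cont_phi) auto
qed (fact dphi dq cont_p)+

definition total :: real where "total = (LINT z|lborel. exp (2 * \<phi> z))"

lemma cont_E: "continuous_on A (\<lambda>z. exp (2 * \<phi> z))"
  by (intro continuous_intros cont_phi)

lemma E_integrable_UNIV: "(\<lambda>z. exp (2 * \<phi> z)) integrable_on UNIV" "integral UNIV (\<lambda>z. exp (2 * \<phi> z)) = total"
proof -
  have "set_integrable lborel UNIV (\<lambda>z. exp (2 * \<phi> z))" using area by (simp add: set_integrable_def)
  from set_borel_integral_eq_integral[OF this]
  show "(\<lambda>z. exp (2 * \<phi> z)) integrable_on UNIV" "integral UNIV (\<lambda>z. exp (2 * \<phi> z)) = total"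
    by (simp_all add: total_def set_lebesgue_integral_def)
qed

lemma E_ball_le: "integral (ball c r) (\<lambda>z. exp (2 * \<phi> z)) \<le> total"
  unfolding E_integrable_UNIV(2)[symmetric]
  by (rule integral_subset_le) (auto intro: continuous_integrable_ball cont_E E_integrable_UNIV)

text \<open>The subharmonic function w is bounded by its area mean, and the pointwise comparison
  \<open>w_le\<close> replaces that mean by means of -2 phi and exp(2 phi). The first is controlled
  by \<open>finite_charge_area_mean\<close>, the second by the total area.\<close>

lemma ln_growth:
  "\<exists>B\<ge>0. \<forall>z. norm z \<ge> 1 \<longrightarrow> ln (1 + (norm (f z))\<^sup>2) \<le> B * (1 + ln (norm z))"
proof -
  define E where "E = (\<lambda>z. exp (2 * \<phi> z))"
  define w where "w = (\<lambda>z. ln (1 + (norm (f z))\<^sup>2))"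
  interpret phi: plane_potential \<phi> q p "\<lambda>z. - (K z * exp (2 * \<phi> z) / 2)" by (rule phi_potential)
  have "continuous_on UNIV (deriv f')"
    by (metis df' deriv_f holo_f holomorphic_deriv holomorphic_on_imp_continuous_on open_UNIV)
  then interpret w: plane_potential w "\<lambda>z. 2 * f' z * cnj (f z) / of_real (1 + (norm (f z))\<^sup>2)"
     "\<lambda>z. 2 * deriv f' z * cnj (f z) / of_real (1 + (norm (f z))\<^sup>2) - 2 * (f' z * cnj (f z))\<^sup>2 / (of_real (1 + (norm (f z))\<^sup>2))\<^sup>2"
     "\<lambda>z. 2 * (norm (f' z))\<^sup>2 / (1 + (norm (f z))\<^sup>2)\<^sup>2"
    unfolding w_def by (rule log_norm_potential[OF df df'])
  have cE: "continuous_on UNIV E" unfolding E_def by (rule cont_E)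
  define MK where "MK = \<bar>K1\<bar> + \<bar>K2\<bar>"
  have MK: "MK \<ge> 0" "\<bar>K z\<bar> \<le> MK" for z using K_range(5,6)[of z] by (auto simp: MK_def)
  have "\<exists>B\<ge>0. \<forall>R\<ge>1. integral (ball 0 R) \<phi> \<ge> - B * (1 + ln R) * R\<^sup>2"
  proof (rule phi.finite_charge_area_mean[of "MK" E total])
    show "\<bar>- (K z * exp (2 * \<phi> z) / 2)\<bar> \<le> MK * E z" for z
    proof -
      have "\<bar>K z\<bar> * E z \<le> MK * E z" using MK by (intro mult_right_mono) (auto simp: E_def)
      moreover have "\<bar>K z\<bar> * E z \<ge> 0" by (simp add: E_def)
      ultimately show ?thesis by (simp add: abs_mult E_def)
    qed
  qed (use cE E_ball_le MK in \<open>auto simp: E_def\<close>)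
  then obtain B where B: "B \<ge> 0" "\<And>R. R \<ge> 1 \<Longrightarrow> integral (ball 0 R) \<phi> \<ge> - B * (1 + ln R) * R\<^sup>2" by blast
  have "compact (P ` {K2..K1})" by (intro compact_continuous_image cont_P) auto
  then have "bounded (P ` {K2..K1})" by (rule compact_imp_bounded)
  then obtain M where "\<forall>x\<in>P ` {K2..K1}. norm x \<le> M" unfolding bounded_iff by blast
  then have M: "P (K z) \<le> M" for z using K_range(5,6)[of z] by force
  have M0: "M \<ge> 0" using M[of 0] P_nonneg[of 0] by linarith
  \<comment> \<open>By \<open>P_eq\<close>, 1 + |f|^2 is the quotient of E + P(K)/2 by E. The
    logarithm of the numerator is estimated by ln x \<le> x - 1, and that of E is 2 phi.\<close>
  have w_le: "w z \<le> - 2 * \<phi> z + E z + M" for z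
  proof -
    have pos: "E z + P (K z) / 2 > 0" using P_nonneg[of z] by (simp add: E_def add_pos_nonneg)
    have "1 + (norm (f z))\<^sup>2 = (E z + P (K z) / 2) / E z"
      unfolding P_eq by (simp add: E_def field_simps)
    then have "w z = ln (E z + P (K z) / 2) - 2 * \<phi> z"
      unfolding w_def using pos by (simp add: ln_div E_def)
    also have "\<dots> \<le> E z + P (K z) / 2 - 2 * \<phi> z"
      using ln_le_minus_one[OF pos] by simp
    also have "\<dots> \<le> - 2 * \<phi> z + E z + M" using M[of z] M0 by simp
    finally show ?thesis .
  qed
  have w0: "w z \<ge> 0" for z by (simp add: w_def)
  have total0: "total \<ge> 0" unfolding total_def by simp
  define B1 where "B1 = 4 / pi * (2 * B * (1 + ln 2) + total + pi * M) + 4 / pi * (2 * B)"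
  have "w z \<le> B1 * (1 + ln (norm z))" if z: "norm z \<ge> 1" for z
  proof -
    \<comment> \<open>With this R the disk of radius R/2 about z lies in the disk of radius R about
      0. The area pi R^2/4 of the small disk is the source of the factor 4/pi in
      \<open>B1\<close>.\<close>
    define R where "R = 2 * norm z"
    have R: "R \<ge> 1" "R > 0" using z by (auto simp: R_def)
    have sub: "ball z (R/2) \<subseteq> ball 0 R"
    proof
      fix x assume "x \<in> ball z (R/2)"
      then show "x \<in> ball 0 R" using norm_triangle_ineq[of "x - z" z] by (auto simp: R_def dist_norm norm_minus_commute)
    qed
    have lin: "integral (ball 0 R) (\<lambda>z. - 2 * \<phi> z + E z + M) = - 2 * integral (ball 0 R) \<phi> + integral (ball 0 R) E + pi * R\<^sup>2 * M"
    proof -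
      have i: "(\<lambda>z. - 2 * \<phi> z) integrable_on ball 0 R" "E integrable_on ball 0 R" "(\<lambda>z. - 2 * \<phi> z + E z) integrable_on ball 0 R"
        by (intro continuous_integrable_ball continuous_intros cont_phi cE)+
      have "integral (ball 0 R) (\<lambda>z. - 2 * \<phi> z + E z + M) = integral (ball 0 R) (\<lambda>z. - 2 * \<phi> z + E z) + integral (ball (0::complex) R) (\<lambda>_. M)"
        using Henstock_Kurzweil_Integration.integral_add[OF i(3) continuous_integrable_ball[OF continuous_on_const]] .
      also have "integral (ball 0 R) (\<lambda>z. - 2 * \<phi> z + E z) = integral (ball 0 R) (\<lambda>z. - 2 * \<phi> z) + integral (ball 0 R) E"
        by (rule Henstock_Kurzweil_Integration.integral_add[OF i(1,2)])
      also have "integral (ball 0 R) (\<lambda>z. - 2 * \<phi> z) = - 2 * integral (ball 0 R) \<phi>" by (rule integral_mult_right)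
      finally show ?thesis by (simp add: integral_const_ball[OF R(2)])
    qed
    have "pi * (R/2)\<^sup>2 * w z \<le> integral (ball z (R/2)) w"
      by (rule w.subharmonic_area_mean) (use R in auto)
    also have "\<dots> \<le> integral (ball 0 R) w"
      using w0 by (intro integral_subset_le sub continuous_integrable_ball w.cont_u) auto
    also have "\<dots> \<le> integral (ball 0 R) (\<lambda>z. - 2 * \<phi> z + E z + M)"
      by (intro integral_le continuous_integrable_ball w.cont_u continuous_intros cont_phi cE w_le)
    also have "\<dots> \<le> 2 * (B * (1 + ln R) * R\<^sup>2) + total + pi * R\<^sup>2 * M"
      unfolding lin using B(2)[OF R(1)] E_ball_le[of 0 R, folded E_def] by simp
    also have "total \<le> total * R\<^sup>2"
      using mult_left_mono[of 1 "R\<^sup>2" total] total0 R by simp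
    also have "2 * (B * (1 + ln R) * R\<^sup>2) + total * R\<^sup>2 + pi * R\<^sup>2 * M = R\<^sup>2 * (2 * B * (1 + ln R) + total + pi * M)"
      by (simp add: algebra_simps)
    finally have "R\<^sup>2 * (pi / 4 * w z) \<le> R\<^sup>2 * (2 * B * (1 + ln R) + total + pi * M)"
      by (simp add: power2_eq_square mult_ac)
    then have "pi / 4 * w z \<le> 2 * B * (1 + ln R) + total + pi * M" using R by simp
    then have "w z \<le> 4 / pi * (2 * B * (1 + ln R) + total + pi * M)" by (simp add: field_simps)
    also have "ln R = ln 2 + ln (norm z)" unfolding R_def using z by (subst ln_mult) auto
    also have "4 / pi * (2 * B * (1 + (ln 2 + ln (norm z))) + total + pi * M) =
       4 / pi * (2 * B * (1 + ln 2) + total + pi * M) + 4 / pi * (2 * B) * ln (norm z)" by (simp add: algebra_simps)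
    also have "\<dots> \<le> B1 * (1 + ln (norm z))"
    proof -
      have l: "ln (norm z) \<ge> 0" using z by simp
      define X where "X = 4 / pi * (2 * B * (1 + ln 2) + total + pi * M)"
      define Y where "Y = 4 / pi * (2 * B)"
      have XY: "X \<ge> 0" "Y \<ge> 0" using B(1) total0 M0 by (auto simp: X_def Y_def)
      have "X * ln (norm z) \<ge> 0" using XY(1) l by simp
      moreover have "(X + Y) * (1 + ln (norm z)) = X + Y * ln (norm z) + X * ln (norm z) + Y" by (simp add: algebra_simps)
      ultimately have "X + Y * ln (norm z) \<le> (X + Y) * (1 + ln (norm z))" using XY(2) by linarith
      then show ?thesis by (simp add: X_def Y_def B1_def)
    qed
    finally show ?thesis .
  qed
  moreover have "B1 \<ge> 0" using B(1) total0 M0 by (auto simp: B1_def)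
  ultimately show ?thesis unfolding w_def by blast
qed

lemma f_polynomial: "\<exists>F. f = poly F"
proof -
  obtain B where B: "B \<ge> 0" "\<And>z. norm z \<ge> 1 \<Longrightarrow> ln (1 + (norm (f z))\<^sup>2) \<le> B * (1 + ln (norm z))"
    using ln_growth by blast
  obtain n :: nat where n: "B \<le> real n" using real_arch_simple by blast
  have "norm (f z) \<le> exp B * norm z ^ n" if z: "1 \<le> norm z" for z
  proof -
    have "norm (f z) \<le> 1 + (norm (f z))\<^sup>2"
    proof (cases "norm (f z) \<le> 1")
      case False
      then have "norm (f z) * 1 \<le> norm (f z) * norm (f z)" by (intro mult_left_mono) auto
      then show ?thesis by (simp add: power2_eq_square)
    qed (simp add: add_increasing2)
    also have "1 + (norm (f z))\<^sup>2 = exp (ln (1 + (norm (f z))\<^sup>2))" by (simp add: add_pos_nonneg)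
    also have "\<dots> \<le> exp (B * (1 + ln (norm z)))" using B(2)[OF z] by simp
    also have "\<dots> = exp B * exp (B * ln (norm z))" by (simp add: algebra_simps exp_add)
    also have "\<dots> \<le> exp B * exp (real n * ln (norm z))" using n z by (simp add: mult_right_mono)
    also have "exp (real n * ln (norm z)) = norm z ^ n" using z by (subst exp_of_nat_mult) (subst exp_ln, auto)
    finally show ?thesis .
  qed
  from Liouville_polynomial[OF holo_f this]
  have "f \<xi> = (\<Sum>k\<le>n. (deriv ^^ k) f 0 / fact k * \<xi> ^ k)" for \<xi> .
  then have "f = poly (\<Sum>k\<le>n. monom ((deriv ^^ k) f 0 / fact k) k)"
    by (auto simp: fun_eq_iff poly_sum poly_monom)
  then show ?thesis by blast
qed

text \<open>For constant f the metric is invariant under the translations along i f, and so has infinite area.\<close>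

lemma f_nonconst: "\<exists>z. f z \<noteq> c"
proof (rule ccontr)
  assume "\<not> ?thesis"
  then have fc: "f z = c" for z by blast
  then have "c \<noteq> 0" using ex_f_nonzero by auto
  have "f' z = 0" for z using df DERIV_unique fc by (metis DERIV_const ext)
  then have qc: "Im (q z * c) = 0" for z using real[of z] fc by simp
  define E where "E = (\<lambda>z. exp (2 * \<phi> z))"
  have cE: "continuous_on UNIV E" unfolding E_def by (rule cont_E)
  \<comment> \<open>Since q c is real, the derivative of phi in the direction i c, which is Re (q i
    c), vanishes.\<close>
  have "\<phi> (z + of_real t * (\<i> * c)) = \<phi> z" for z t
  proof -
    have "((\<lambda>t. \<phi> (z + of_real t * (\<i> * c))) has_real_derivative 0) (at t)" for t
    proof -
      have "((\<lambda>t. z + of_real t * (\<i> * c)) has_derivative (\<lambda>x. of_real x * (\<i> * c))) (at t)"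
        by (auto intro!: derivative_eq_intros)
      from has_derivative_compose[OF this dphi]
      have "((\<lambda>t. \<phi> (z + of_real t * (\<i> * c))) has_derivative (\<lambda>x. Re (q (z + of_real t * (\<i> * c)) * (of_real x * (\<i> * c))))) (at t)" .
      moreover have "Re (q w * (of_real x * (\<i> * c))) = 0" for w x
      proof -
        have "q w * (of_real x * (\<i> * c)) = \<i> * (of_real x * (q w * c))" by simp
        then have "Re (q w * (of_real x * (\<i> * c))) = - (x * Im (q w * c))" by (simp only: Re_i_times) simp
        then show ?thesis using qc[of w] by simp
      qed
      ultimately show ?thesis by (simp add: has_field_derivative_def fun_eq_iff lambda_zero)
    qed
    then have "\<phi> (z + of_real t * (\<i> * c)) = \<phi> (z + of_real 0 * (\<i> * c))"
      by (intro DERIV_isconst_all[of "\<lambda>t. \<phi> (z + of_real t * (\<i> * c))"]) blast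
    then show ?thesis by simp
  qed
  then have Et: "E (z + of_real t * (\<i> * c)) = E z" for z t by (simp add: E_def)
  define I where "I = integral (ball 0 1) E"
  have ball: "integral (ball (of_real t * (\<i> * c)) 1) E = I" for t
    unfolding I_def using Et[of "of_real _ * cis _" t]
    by (subst (1 2) polar_integral_ball[OF cE]) (auto simp: add.commute)
  have "I > 0"
  proof -
    obtain x where x: "\<And>y. y \<in> cball 0 1 \<Longrightarrow> E x \<le> E y"
      using continuous_attains_inf[of "cball 0 1" E] continuous_on_subset[OF cE] compact_cball by (metis cball_eq_empty not_one_less_zero top_greatest)
    have "integral (ball (0::complex) 1) (\<lambda>_. E x) \<le> I"
      unfolding I_def using x by (intro integral_le continuous_integrable_ball cE) auto
    moreover have "0 < pi * 1\<^sup>2 * E x" by (simp add: E_def)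
    ultimately show ?thesis by (simp add: integral_const_ball)
  qed
  \<comment> \<open>Translations by multiples of L i c move centres by multiples of 2, so the unit
    disks about them are disjoint. All of them have the same area I.\<close>
  define L where "L = 2 / norm c"
  have disj: "ball (of_real (L * real m) * (\<i> * c)) 1 \<inter> ball (of_real (L * real n) * (\<i> * c)) 1 = {}" if "m \<noteq> n" for m n :: nat
  proof -
    have "dist (of_real (L * real m) * (\<i> * c)) (of_real (L * real n) * (\<i> * c)) = norm (of_real (L * (real m - real n)) * (\<i> * c))"
      by (simp add: dist_norm algebra_simps)
    also have "\<dots> = 2 * \<bar>real m - real n\<bar>" using \<open>c \<noteq> 0\<close>
      unfolding norm_mult norm_of_real abs_mult by (simp add: L_def)
    finally have d: "dist (of_real (L * real m) * (\<i> * c)) (of_real (L * real n) * (\<i> * c)) = 2 * \<bar>real m - real n\<bar>" .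
    have "real m + 1 \<le> real n \<or> real n + 1 \<le> real m" using that by (metis Suc_leI nat_neq_iff of_nat_Suc of_nat_mono add.commute)
    then have "\<bar>real m - real n\<bar> \<ge> 1" by (elim disjE) (simp_all add: abs_if)
    then have "1 + 1 \<le> dist (of_real (L * real m) * (\<i> * c)) (of_real (L * real n) * (\<i> * c))" unfolding d by simp
    then show ?thesis by (rule disjoint_ballI)
  qed
  have "real N * I \<le> total" for N
  proof -
    let ?B = "\<lambda>n::nat. ball (of_real (L * real n) * (\<i> * c)) 1"
    have "(E has_integral (\<Sum>n<N. I)) (\<Union>n<N. ?B n)"
    proof (rule has_integral_UN)
      show "(E has_integral I) (?B n)" for n
        using ball[of "L * real n"] continuous_integrable_ball[OF cE] by (simp only: has_integral_integrable_integral)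
      show "pairwise (\<lambda>m n. negligible (?B m \<inter> ?B n)) {..<N}"
        unfolding pairwise_def using disj by (metis negligible_empty)
    qed simp
    then have 1: "real N * I = integral (\<Union>n<N. ?B n) E" and 2: "E integrable_on (\<Union>n<N. ?B n)"
      by (simp_all add: integral_unique has_integral_integrable)
    have "integral (\<Union>n<N. ?B n) E \<le> integral UNIV E"
      by (rule integral_subset_le) (use 2 E_integrable_UNIV(1) in \<open>auto simp: E_def\<close>)
    then show ?thesis using 1 E_integrable_UNIV(2) by (simp add: E_def)
  qed
  moreover obtain N where "real N * I > total" using \<open>I > 0\<close> reals_Archimedean3 by blast
  ultimately show False by (meson not_le)
qed

end

section \<open>Polynomials with prescribed derivatives at their roots\<close>

lemma poly_eq_0_of_roots:
  fixes p :: "complex poly"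
  assumes "finite Z" "\<And>z. z \<in> Z \<Longrightarrow> poly p z = 0" "degree p < card Z"
  shows "p = 0"
proof (rule ccontr)
  assume p: "p \<noteq> 0"
  have "card Z \<le> card {x. poly p x = 0}" using assms by (intro card_mono poly_roots_finite p) auto
  also have "\<dots> \<le> degree p" by (rule card_poly_roots_bound) (rule p)
  finally show False using assms(3) by simp
qed

lemma monic_root_product:
  assumes "finite Z"
  shows "degree (\<Prod>z\<in>Z. [:- z, 1:]) = card Z" "lead_coeff (\<Prod>z\<in>Z. [:- z, 1:]) = (1::complex)"
proof -
  show "degree (\<Prod>z\<in>Z. [:- z, 1:]) = card Z" by (subst degree_prod_sum_eq) auto
  show "lead_coeff (\<Prod>z\<in>Z. [:- z, 1:]) = (1::complex)" by (subst lead_coeff_prod) simp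
qed

lemma coeff_mult_pderiv_top:
  fixes p r :: "complex poly"
  assumes "degree r \<ge> 1"
  shows "coeff (p * pderiv r) (degree p + degree r - 1) = of_nat (degree r) * lead_coeff p * lead_coeff r"
proof -
  have d: "degree (pderiv r) = degree r - 1" by (rule degree_pderiv)
  have "coeff (p * pderiv r) (degree p + degree r - 1) = coeff (p * pderiv r) (degree p + degree (pderiv r))"
    using assms by (simp add: d)
  also have "\<dots> = lead_coeff p * lead_coeff (pderiv r)" by (rule coeff_mult_degree_sum)
  also have "lead_coeff (pderiv r) = of_nat (degree r) * lead_coeff r"
    using assms by (simp add: d coeff_pderiv)
  finally show ?thesis by (simp add: mult_ac)
qed

text \<open>Put D = Q^k - R, of degree below k deg Q. Then D' Q - k D Q' = c, where the leading terms on the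
  left cannot cancel, so that deg D + deg Q = 1.\<close>

lemma degree_bound_of_power_identity:
  fixes Q R :: "complex poly"
  assumes id: "smult (of_nat k) (R * pderiv Q) - pderiv R * Q = [:c:]" and c: "c \<noteq> 0"
    and deg: "degree R = k * degree Q" "lead_coeff Q = 1" "lead_coeff R = 1" "degree R \<ge> 1"
  shows "degree Q \<le> 1"
proof -
  define D where "D = Q ^ k - R"
  have k: "k \<ge> 1" "degree Q \<ge> 1" using deg(1,4) by (cases k; cases "degree Q"; simp)+
  have Q0: "Q \<noteq> 0" using deg(2) by auto
  have degQk: "degree (Q ^ k) = degree R" "lead_coeff (Q ^ k) = 1"
    using deg k Q0 by (simp add: degree_power_eq, simp only: lead_coeff_power power_one)
  \<comment> \<open>R drops out of the Wronskian of R and D, and what remains, R (Q^k)' - R' Q^k, is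
    Q^(k-1) times the left-hand side of \<open>id\<close>.\<close>
  have main: "R * pderiv D - pderiv R * D = smult c (Q ^ (k - 1))"
  proof -
    have Qk: "Q ^ k = Q ^ (k - 1) * Q" using k by (metis One_nat_def Suc_pred mult.commute power_Suc not_gr0 not_one_le_zero)
    have "pderiv (Q ^ k) = smult (of_nat k) (Q ^ (k - 1) * pderiv Q)"
      by (cases k) (use k pderiv_power_Suc[of Q] in \<open>simp_all del: power_Suc\<close>)
    then have "R * pderiv D - pderiv R * D = Q ^ (k - 1) * (smult (of_nat k) (R * pderiv Q) - pderiv R * Q)"
      unfolding D_def pderiv_diff by (simp add: Qk algebra_simps)
    then show ?thesis unfolding id by simp
  qed
  have D0: "D \<noteq> 0"
  proof
    assume "D = 0"
    then have "smult c (Q ^ (k - 1)) = 0" using main by simp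
    then show False using c Q0 by simp
  qed
  \<comment> \<open>Q^k and R have the same degree and are both monic, so the leading terms of D
    cancel.\<close>
  have "degree D < degree R"
  proof (rule ccontr)
    assume "\<not> ?thesis"
    then have "degree D = degree R"
      using degree_diff_le[of "Q ^ k" "degree R" R] degQk(1) by (simp add: D_def)
    moreover have "coeff D (degree R) = 0" using degQk deg(3) by (simp add: D_def)
    ultimately show False using D0 by (metis leading_coeff_0_iff)
  qed
  define m where "m = degree D + degree R - 1"
  \<comment> \<open>The coefficient equals (deg D - deg R) times the leading coefficient of D. A
    constant D is treated apart because its derivative has no leading term.\<close>
  have "coeff (R * pderiv D - pderiv R * D) m \<noteq> 0"
  proof (cases "degree D = 0")
    case True
    then have "pderiv D = 0" by (simp add: pderiv_eq_0_iff)
    then show ?thesis using coeff_mult_pderiv_top[OF deg(4), of D] D0 deg(3,4) by (simp add: m_def mult.commute)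
  next
    case False
    then have "coeff (R * pderiv D - pderiv R * D) m = (of_nat (degree D) - of_nat (degree R)) * lead_coeff D"
      using coeff_mult_pderiv_top[of D R] coeff_mult_pderiv_top[OF deg(4), of D] deg(3)
      by (simp add: m_def mult.commute add.commute algebra_simps)
    then show ?thesis using D0 \<open>degree D < degree R\<close> by (simp flip: of_nat_diff)
  qed
  then have "m \<le> degree (smult c (Q ^ (k - 1)))" unfolding main by (rule le_degree)
  also have "\<dots> = (k - 1) * degree Q" using c Q0 by (simp add: degree_power_eq)
  \<comment> \<open>As (k - 1) deg Q = deg R - deg Q, this says deg D + deg Q \<le> 1.\<close>
  finally have "degree D + degree R - 1 \<le> degree R - degree Q" by (simp add: m_def deg(1) diff_mult_distrib)
  then show ?thesis using deg(1,4) k by (cases k) auto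
qed

text \<open>The polynomial a Q1 Q2' - b Q1' Q2 takes the value a b / c at all roots of c Q1 Q2,
  so it is constant; its top coefficient balances the residues of 1/(c Q1 Q2).\<close>

lemma simple_root_balance:
  fixes Z1 Z2 :: "complex set" and a b :: real and c :: complex
  assumes fin: "finite Z1" "finite Z2" and disj: "Z1 \<inter> Z2 = {}" and ab: "a > 0" "b \<ge> 0" and c: "c \<noteq> 0"
    and F: "F = smult c ((\<Prod>z\<in>Z1. [:- z, 1:]) * (\<Prod>z\<in>Z2. [:- z, 1:]))"
    and F1: "\<And>z. z \<in> Z1 \<Longrightarrow> poly (pderiv F) z = - of_real a"
    and F2: "\<And>z. z \<in> Z2 \<Longrightarrow> poly (pderiv F) z = of_real b"
    and b0: "Z2 \<noteq> {} \<Longrightarrow> b > 0" and two: "card Z1 + card Z2 \<ge> 2"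
  shows "Z1 \<noteq> {}" "Z2 \<noteq> {}" "a * real (card Z2) = b * real (card Z1)"
    "card Z2 dvd card Z1 \<Longrightarrow> card Z2 = 1"
proof -
  define Q1 where "Q1 = (\<Prod>z\<in>Z1. [:- z, 1:])"
  define Q2 where "Q2 = (\<Prod>z\<in>Z2. [:- z, 1:])"
  note Q = monic_root_product[OF fin(1), folded Q1_def] monic_root_product[OF fin(2), folded Q2_def]
  have FQ: "F = smult c (Q1 * Q2)" by (simp add: F Q1_def Q2_def)
  have Q0: "Q1 \<noteq> 0" "Q2 \<noteq> 0" using Q(2,4) by auto
  have degF: "degree F = card Z1 + card Z2" using Q0 c by (simp add: FQ degree_mult_eq Q)
  have cardU: "card (Z1 \<union> Z2) = card Z1 + card Z2" using fin disj by (rule card_Un_disjoint)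
  \<comment> \<open>F' has degree one less than the number of roots of F, so it would be constant if
    it took a single value at all of them. Since F has degree at least 2, both prescribed values
    must occur.\<close>
  have noconst: False if "\<And>z. z \<in> Z1 \<union> Z2 \<Longrightarrow> poly (pderiv F) z = d" for d
  proof -
    have "pderiv F - [:d:] = 0"
    proof (rule poly_eq_0_of_roots[of "Z1 \<union> Z2"])
      have "degree (pderiv F - [:d:]) \<le> degree F - 1"
        by (rule degree_diff_le) (auto simp: degree_pderiv)
      then show "degree (pderiv F - [:d:]) < card (Z1 \<union> Z2)" using degF two cardU by linarith
    qed (use that fin in auto)
    then have "degree (pderiv F) = 0" by simp
    then show False using degF two by (simp add: degree_pderiv)
  qed
  show "Z1 \<noteq> {}"
  proof
    assume "Z1 = {}"
    then show False using noconst[of "of_real b"] F2 by auto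
  qed
  show "Z2 \<noteq> {}"
  proof
    assume "Z2 = {}"
    then show False using noconst[of "- of_real a"] F1 by auto
  qed
  then have b: "b > 0" by (rule b0)
  have card: "card Z1 \<ge> 1" "card Z2 \<ge> 1"
    using \<open>Z1 \<noteq> {}\<close> \<open>Z2 \<noteq> {}\<close> fin by (simp_all add: Suc_le_eq card_gt_0_iff)
  have z1: "poly Q1 z = 0" if "z \<in> Z1" for z
    unfolding Q1_def poly_prod by (rule prod_zero[OF fin(1)]) (use that in auto)
  have z2: "poly Q2 z = 0" if "z \<in> Z2" for z
    unfolding Q2_def poly_prod by (rule prod_zero[OF fin(2)]) (use that in auto)
  have pF: "poly (pderiv F) z = c * (poly (pderiv Q1) z * poly Q2 z + poly Q1 z * poly (pderiv Q2) z)" for z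
    by (simp add: FQ pderiv_smult pderiv_mult algebra_simps)
  define G where "G = smult (of_real a) (Q1 * pderiv Q2) - smult (of_real b) (pderiv Q1 * Q2)"
  have "G - [:of_real (a * b) / c:] = 0"
  proof (rule poly_eq_0_of_roots[of "Z1 \<union> Z2"])
    have d: "degree (Q1 * pderiv Q2) \<le> card Z1 + card Z2 - 1" "degree (pderiv Q1 * Q2) \<le> card Z1 + card Z2 - 1"
      using degree_mult_le[of Q1 "pderiv Q2"] degree_mult_le[of "pderiv Q1" Q2] card by (auto simp: Q degree_pderiv)
    have "degree (G - [:of_real (a * b) / c:]) \<le> card Z1 + card Z2 - 1"
      unfolding G_def using d by (intro degree_diff_le) (auto intro: order_trans[OF degree_smult_le])
    then show "degree (G - [:of_real (a * b) / c:]) < card (Z1 \<union> Z2)" using two cardU by linarith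
    fix z assume "z \<in> Z1 \<union> Z2"
    then show "poly (G - [:of_real (a * b) / c:]) z = 0"
    proof
      assume z: "z \<in> Z1"
      then have "c * (poly (pderiv Q1) z * poly Q2 z) = - of_real a" using F1[OF z] z1[OF z] by (simp add: pF)
      then have "poly (pderiv Q1) z * poly Q2 z = - of_real a / c" using c by (simp add: field_simps)
      then show ?thesis using z1[OF z] by (simp add: G_def)
    next
      assume z: "z \<in> Z2"
      then have "c * (poly Q1 z * poly (pderiv Q2) z) = of_real b" using F2[OF z] z2[OF z] by (simp add: pF)
      then have "poly Q1 z * poly (pderiv Q2) z = of_real b / c" using c by (simp add: field_simps)
      then show ?thesis using z2[OF z] by (simp add: G_def)
    qed
  qed (use fin in auto)
  then have G: "G = [:of_real (a * b) / c:]" by simp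
  show bal: "a * real (card Z2) = b * real (card Z1)"
  proof -
    let ?m = "card Z1 + card Z2 - 1"
    have "coeff G ?m = 0" using two unfolding G by (cases ?m) auto
    moreover have "coeff (Q1 * pderiv Q2) ?m = of_nat (card Z2)"
      using coeff_mult_pderiv_top[of Q2 Q1] card Q by simp
    moreover have "coeff (pderiv Q1 * Q2) ?m = of_nat (card Z1)"
      using coeff_mult_pderiv_top[of Q1 Q2] card Q by (simp add: mult.commute add.commute)
    ultimately have "complex_of_real a * of_nat (card Z2) - of_real b * of_nat (card Z1) = 0"
      by (simp add: G_def)
    then have "complex_of_real (a * real (card Z2)) = of_real (b * real (card Z1))" by simp
    then show ?thesis by (simp only: of_real_eq_iff)
  qed
  show "card Z2 = 1" if dvd: "card Z2 dvd card Z1"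
  proof -
    obtain k where "card Z1 = card Z2 * k" using dvd unfolding dvd_def by blast
    then have k: "card Z1 = k * card Z2" by (simp only: mult.commute)
    then have abk: "a = b * real k" using bal card by simp
    \<comment> \<open>With a = k b, dividing the constant G by b gives the identity of
      \<open>degree_bound_of_power_identity\<close>, with \<open>Q2\<close> as Q and
      \<open>Q1\<close> as R.\<close>
    have "smult (of_real b) (smult (of_nat k) (Q1 * pderiv Q2) - pderiv Q1 * Q2) = smult (of_real b) [:of_real a / c:]"
      using G by (simp add: G_def abk smult_diff_right mult_ac)
    then have "smult (of_nat k) (Q1 * pderiv Q2) - pderiv Q1 * Q2 = [:of_real a / c:]"
      using b smult_cancel[of "complex_of_real b"] by simp
    from degree_bound_of_power_identity[OF this] have "degree Q2 \<le> 1" using k ab c Q card by simp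
    then show ?thesis using card Q by simp
  qed
qed

section \<open>Metrics with many zeros and radial metrics\<close>

lemma tendsto_at_infinity_inverse:
  fixes g :: "complex \<Rightarrow> 'a::topological_space"
  assumes "((\<lambda>x. g (inverse x)) \<longlongrightarrow> l) (at 0)"
  shows "(g \<longlongrightarrow> l) at_infinity"
  using filterlim_compose[OF assms filterlim_inverse_at_iff[THEN iffD2, OF filterlim_ident]] by simp

text \<open>A bounded derivative makes v Lipschitz on the punctured disk, hence uniformly
  continuous, hence extendable to the centre. The constant grows from B to 3 B because a segment
  through the puncture is replaced by a detour.\<close>

lemma lipschitz_punctured_limit:
  fixes v :: "complex \<Rightarrow> real"
  assumes \<rho>: "\<rho> > 0" and der: "\<And>x. x \<in> ball 0 \<rho> - {0} \<Longrightarrow> (v has_derivative D x) (at x)"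
    and bnd: "\<And>x h. x \<in> ball 0 \<rho> - {0} \<Longrightarrow> \<bar>D x h\<bar> \<le> B * norm h"
  shows "\<exists>l. (v \<longlongrightarrow> l) (at 0)"
proof -
  have B: "B \<ge> 0"
  proof -
    have "of_real (\<rho>/2) \<in> ball (0::complex) \<rho> - {0}" using \<rho> by auto
    from bnd[OF this, of 1] show ?thesis by simp
  qed
  have seg: "\<bar>v y - v x\<bar> \<le> B * norm (y - x)" if S: "closed_segment x y \<subseteq> ball 0 \<rho> - {0}" for x y
  proof -
    have "norm (v (x + (y - x)) - v x) \<le> norm (y - x) * B"
    proof (rule differentiable_bound_segment[where G="closed_segment x y" and f'=D])
      show "x + t *\<^sub>R (y - x) \<in> closed_segment x y" if "t \<in> {0..1}" for t
        using that unfolding closed_segment_def by (auto intro!: exI[of _ t] simp: algebra_simps)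
      show "(v has_derivative D z) (at z within closed_segment x y)" if "z \<in> closed_segment x y" for z
        using der that S has_derivative_at_withinI by blast
      show "onorm (D (x + t *\<^sub>R (y - x))) \<le> B" if "t \<in> {0..1}" for t
      proof (rule onorm_le)
        have "x + t *\<^sub>R (y - x) \<in> closed_segment x y"
          using that unfolding closed_segment_def by (auto intro!: exI[of _ t] simp: algebra_simps)
        then have "x + t *\<^sub>R (y - x) \<in> ball 0 \<rho> - {0}" using S by blast
        then show "norm (D (x + t *\<^sub>R (y - x)) h) \<le> B * norm h" for h
          using bnd by simp
      qed
    qed
    then show ?thesis by (simp add: mult.commute)
  qed
  have lip: "\<bar>v y - v x\<bar> \<le> 3 * B * norm (y - x)" if xy: "x \<in> ball 0 \<rho> - {0}" "y \<in> ball 0 \<rho> - {0}" for x y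
  proof (cases "0 \<in> closed_segment x y")
    case False
    have "closed_segment x y \<subseteq> ball 0 \<rho>" using xy by (intro closed_segment_subset) auto
    then have "\<bar>v y - v x\<bar> \<le> B * norm (y - x)" using False by (intro seg) auto
    moreover have "0 \<le> B * norm (y - x)" using B by simp
    ultimately show ?thesis by linarith
  next
    case True
    then obtain t where t: "0 \<le> t" "t \<le> 1" "0 = (1 - t) *\<^sub>R x + t *\<^sub>R y" by (auto simp: closed_segment_def)
    have t01: "t \<noteq> 0" "t \<noteq> 1" using t(3) xy by auto
    define r where "r = (1 - t) / t"
    have r: "r > 0" using t t01 by (simp add: r_def)
    have yx: "y = - of_real r * x"
    proof -
      have "t *\<^sub>R y = - ((1 - t) *\<^sub>R x)" using t(3) by (metis add.commute eq_neg_iff_add_eq_0)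
      then have "y = (1/t) *\<^sub>R (- ((1 - t) *\<^sub>R x))" using t01 by (metis divide_self_if mult.commute scaleR_one scaleR_scaleR times_divide_eq_left mult_1)
      then show ?thesis by (simp add: r_def scaleR_conv_of_real)
    qed
    have nyx: "norm (y - x) = norm x + norm y"
    proof -
      have "y - x = - of_real (r + 1) * x" by (simp add: yx algebra_simps)
      then have "norm (y - x) = (r + 1) * norm x" using r by (simp only: norm_mult norm_minus_cancel norm_of_real)
      moreover have "norm y = r * norm x" using r by (simp add: yx norm_mult)
      ultimately show ?thesis by (simp add: algebra_simps)
    qed
    \<comment> \<open>If the segment from x to y meets 0, then y is a negative multiple of x. The
      detour passes through x turned by a right angle, and neither of its two legs meets 0.\<close>
    define z where "z = \<i> * x"
    have z: "z \<in> ball 0 \<rho> - {0}" using xy by (auto simp: z_def norm_mult)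
    have s1: "0 \<notin> closed_segment x z"
    proof
      assume "0 \<in> closed_segment x z"
      then obtain u where "0 = ((1 - u) *\<^sub>R 1 + u *\<^sub>R \<i>) * x" by (auto simp: closed_segment_def z_def algebra_simps)
      then have "(1 - u) *\<^sub>R 1 + u *\<^sub>R \<i> = 0" using xy by auto
      then show False by (auto simp: complex_eq_iff)
    qed
    have s2: "0 \<notin> closed_segment z y"
    proof
      assume "0 \<in> closed_segment z y"
      then obtain u where "0 = ((1 - u) *\<^sub>R \<i> - (u * r) *\<^sub>R 1) * x" by (auto simp: closed_segment_def z_def yx algebra_simps scaleR_conv_of_real)
      then have "(1 - u) *\<^sub>R \<i> - (u * r) *\<^sub>R 1 = 0" using xy by auto
      then show False using r by (auto simp: complex_eq_iff)
    qed
    have "closed_segment x z \<subseteq> ball 0 \<rho>" "closed_segment z y \<subseteq> ball 0 \<rho>" using xy z by (intro closed_segment_subset; auto)+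
    then have "\<bar>v z - v x\<bar> \<le> B * norm (z - x)" "\<bar>v y - v z\<bar> \<le> B * norm (y - z)"
      using s1 s2 by (intro seg; auto)+
    moreover have "norm (z - x) + norm (y - z) \<le> 3 * norm (y - x)"
    proof -
      have "norm z = norm x" by (simp add: z_def norm_mult)
      then have "norm (z - x) \<le> norm x + norm x" "norm (y - z) \<le> norm y + norm x"
        using norm_triangle_ineq4[of z x] norm_triangle_ineq4[of y z] by simp_all
      then show ?thesis using nyx norm_ge_zero[of y] by linarith
    qed
    then have "B * norm (z - x) + B * norm (y - z) \<le> 3 * B * norm (y - x)"
      using mult_left_mono[OF _ B] by (fastforce simp: algebra_simps)
    ultimately show ?thesis by linarith
  qed
  have "uniformly_continuous_on (ball (0::complex) \<rho> - {0}) v"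
    unfolding uniformly_continuous_on_def
  proof (intro allI impI)
    fix e :: real assume e: "e > 0"
    show "\<exists>d>0. \<forall>x\<in>ball (0::complex) \<rho> - {0}. \<forall>x'\<in>ball (0::complex) \<rho> - {0}. dist x' x < d \<longrightarrow> dist (v x') (v x) < e"
    proof (intro exI[of _ "e / (3 * B + 1)"] conjI ballI impI)
      fix x x' :: complex assume x: "x \<in> ball 0 \<rho> - {0}" "x' \<in> ball 0 \<rho> - {0}" "dist x' x < e / (3 * B + 1)"
      have "\<bar>v x' - v x\<bar> \<le> 3 * B * norm (x' - x)" using lip x by blast
      also have "\<dots> \<le> (3 * B + 1) * norm (x' - x)" by (intro mult_right_mono) auto
      also have "\<dots> < e" using x(3) B by (simp add: dist_norm pos_less_divide_eq mult.commute)
      finally show "dist (v x') (v x) < e" by (simp add: dist_real_def)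
    qed (use e B in auto)
  qed
  moreover have "0 \<in> closure (ball 0 \<rho> - {0::complex})"
    unfolding closure_approachable
  proof (intro allI impI)
    fix e :: real assume "e > 0"
    then show "\<exists>y\<in>ball 0 \<rho> - {0::complex}. dist y 0 < e"
      using \<rho> by (intro bexI[of _ "of_real (min (e/2) (\<rho>/2))"]) (auto simp: min_def)
  qed
  ultimately obtain l where "(v \<longlongrightarrow> l) (at 0 within ball 0 \<rho> - {0})"
    by (rule uniformly_continuous_on_extension_at_closure)
  moreover have "at 0 within ball 0 \<rho> - {0} = at (0::complex)"
    using \<rho> at_within_open[of 0 "ball 0 \<rho>"] by (metis at_within_def centre_in_ball Diff_insert2 Diff_idemp open_ball)
  ultimately show ?thesis by auto
qed

section \<open>Zeros of f and the behaviour at infinity\<close>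

context hcmu_plane
begin

definition F :: "complex poly" where "F = (SOME F. f = poly F)"

lemma f_F: "f z = poly F z"
proof -
  have "f = poly F" unfolding F_def by (rule someI_ex) (rule f_polynomial)
  then show ?thesis by (rule fun_cong)
qed

lemma f'_F: "f' z = poly (pderiv F) z"
proof (rule DERIV_unique[OF df])
  show "(f has_field_derivative poly (pderiv F) z) (at z)"
    using poly_DERIV[of F z] by (simp only: f_F[symmetric])
qed

lemma F_degree: "degree F \<ge> 1"
proof (rule ccontr)
  assume "\<not> ?thesis"
  then have "degree F = 0" by simp
  then obtain c where "F = [:c:]" by (rule degree_eq_zeroE)
  then have "f z = c" for z by (simp add: f_F)
  then show False using f_nonconst[of c] by blast
qed

lemma F_nonzero [simp]: "F \<noteq> 0"
  using F_degree by auto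

definition Zmax :: "complex set" where "Zmax = {z. K z = K1}"
definition Zmin :: "complex set" where "Zmin = {z. K z = K2}"

lemma zeros_F: "{z. poly F z = 0} = Zmax \<union> Zmin"
  using K_at_zero f_zero_iff K_range(2,3) by (auto simp: Zmax_def Zmin_def f_F[symmetric])

lemma finite_Z: "finite Zmax" "finite Zmin"
proof -
  have "finite (Zmax \<union> Zmin)" unfolding zeros_F[symmetric] by (rule poly_roots_finite) simp
  then show "finite Zmax" "finite Zmin" by auto
qed

lemma Z_disjoint: "Zmax \<inter> Zmin = {}"
  using K_range(1) by (auto simp: Zmax_def Zmin_def)

text \<open>All roots are simple because f' does not vanish at a zero of f.\<close>

lemma F_product: "F = smult (lead_coeff F) ((\<Prod>z\<in>Zmax. [:- z, 1:]) * (\<Prod>z\<in>Zmin. [:- z, 1:]))"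
proof -
  have "rsquarefree F"
    unfolding rsquarefree_roots using f'_nonzero by (auto simp: f_F[symmetric] f'_F[symmetric])
  then have "smult (lead_coeff F) (\<Prod>z|poly F z = 0. [:- z, 1:]) = F"
    by (rule complex_poly_decompose_rsquarefree)
  then show ?thesis
    unfolding zeros_F by (subst (asm) prod.union_disjoint) (auto simp: finite_Z Z_disjoint)
qed

lemma degree_F_card: "degree F = card Zmax + card Zmin"
proof -
  let ?A = "\<Prod>z\<in>Zmax. [:- z, 1:]" and ?B = "\<Prod>z\<in>Zmin. [:- z, 1:]"
  have "?A \<noteq> 0" "?B \<noteq> 0" using finite_Z by auto
  then have "degree (smult (lead_coeff F) (?A * ?B)) = card Zmax + card Zmin"
    by (simp add: degree_mult_eq monic_root_product finite_Z)
  then show ?thesis using F_product by metis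
qed

lemma Zmax_zero: "z \<in> Zmax \<Longrightarrow> f z = 0" and Zmin_zero: "z \<in> Zmin \<Longrightarrow> f z = 0"
  using f_zero_iff K_range by (auto simp: Zmax_def Zmin_def)

lemma many_zeros:
  assumes "degree F \<ge> 2"
  shows "card Zmin \<ge> 1" "card Zmax > card Zmin" "card Zmin dvd card Zmax \<Longrightarrow> card Zmin = 1"
proof -
  have lc: "lead_coeff F \<noteq> 0" by simp
  have 1: "poly (pderiv F) z = - of_real a" if "z \<in> Zmax" for z
    using K_at_zero[OF Zmax_zero[OF that]] that K_range(1) by (auto simp: Zmax_def f'_F[symmetric])
  have 2: "poly (pderiv F) z = of_real b" "b > 0" if "z \<in> Zmin" for z
    using K_at_zero[OF Zmin_zero[OF that]] that K_range(1) by (auto simp: Zmin_def f'_F[symmetric])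
  have 3: "Zmin \<noteq> {} \<Longrightarrow> b > 0" using 2(2) by blast
  note B = simple_root_balance[OF finite_Z Z_disjoint ab(1,2) lc F_product 1 2(1) 3 assms[unfolded degree_F_card]]
  show Zm: "card Zmin \<ge> 1" using B(2) finite_Z(2) by (simp add: Suc_le_eq card_gt_0_iff)
  show "card Zmin dvd card Zmax \<Longrightarrow> card Zmin = 1" using B(4) .
  have "b > 0" using B(2) 3 by blast
  \<comment> \<open>This is the balance a |Zmin| = b |Zmax| combined with b < a.\<close>
  show "card Zmax > card Zmin"
  proof (rule ccontr)
    assume "\<not> ?thesis"
    then have "b * real (card Zmax) \<le> b * real (card Zmin)" using \<open>b > 0\<close> by (intro mult_left_mono) auto
    also have "\<dots> < a * real (card Zmin)" using ab(3) Zm by (intro mult_strict_right_mono) auto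
    finally show False using B(3) by simp
  qed
qed

lemma f_inverse:
  assumes "x \<noteq> 0"
  shows "f (inverse x) = poly (reflect_poly F) x / x ^ degree F"
  using poly_reflect_poly_nz[OF assms, of F] assms by (simp add: f_F)

lemma bounded_P'_K: "\<exists>M. \<forall>z. \<bar>P' (K z)\<bar> \<le> M"
proof -
  have "compact (P' ` {K2..K1})" unfolding P'_def by (intro compact_continuous_image continuous_intros) auto
  then have "bounded (P' ` {K2..K1})" by (rule compact_imp_bounded)
  then obtain M where M: "\<forall>x\<in>P' ` {K2..K1}. norm x \<le> M" unfolding bounded_iff by blast
  have "\<bar>P' (K z)\<bar> \<le> M" for z
  proof -
    have "P' (K z) \<in> P' ` {K2..K1}" using K_range(5,6)[of z] by auto
    then show ?thesis using M by force
  qed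
  then show ?thesis by blast
qed

lemma q_eq: "f z \<noteq> 0 \<Longrightarrow> q z = (of_real (P' (K z) / 2) - f' z) / f z"
  using A_eq[of z] by (simp add: field_simps)

text \<open>By \<open>q_eq\<close>, z q is P'(K) z/(2 f) - z f'/f. In degree at least 2 the first
  term vanishes at infinity because P'(K) is bounded, and the logarithmic derivative of a polynomial
  gives the degree.\<close>

lemma many_q_limit:
  assumes d: "degree F \<ge> 2"
  shows "((\<lambda>z. z * q z) \<longlongrightarrow> - of_nat (degree F)) at_infinity"
proof -
  define d where "d = degree F"
  define R where "R = reflect_poly F"
  define R1 where "R1 = reflect_poly (pderiv F)"
  have R0: "poly R 0 \<noteq> 0" by (simp add: R_def)
  have d1: "degree (pderiv F) = d - 1" by (simp add: degree_pderiv d_def)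
  have R10: "poly R1 0 = of_nat d * poly R 0"
    using d by (simp add: R1_def R_def degree_pderiv coeff_pderiv d_def)
  obtain M where M: "\<And>z. \<bar>P' (K z)\<bar> \<le> M" using bounded_P'_K by blast
  have cR: "isCont (poly R) 0" "isCont (poly R1) 0" by (rule poly_isCont)+
  have "\<forall>\<^sub>F x in at 0. poly R x \<noteq> 0"
    using cR(1) R0 unfolding isCont_def by (rule tendsto_imp_eventually_ne)
  then have ev: "\<forall>\<^sub>F x in at 0. of_real (P' (K (inverse x)) / 2) * (x ^ (d - 1) / poly R x) - poly R1 x / poly R x = inverse x * q (inverse x)"
    using eventually_neq_at_within[of 0 0 UNIV]
  proof eventually_elim
    case (elim x)
    have fx: "f (inverse x) = poly R x / x ^ d" using elim by (simp add: f_inverse R_def d_def)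
    have f'x: "f' (inverse x) = poly R1 x / x ^ (d - 1)"
      using poly_reflect_poly_nz[of x "pderiv F"] elim by (simp add: f'_F R1_def d1)
    have xd: "x ^ d = x * x ^ (d - 1)" using d by (metis d_def One_nat_def Suc_1 Suc_le_lessD Suc_pred less_imp_Suc_add power_Suc zero_less_Suc)
    have "f (inverse x) \<noteq> 0" using fx elim by simp
    note qx = q_eq[OF this]
    define y where "y = x ^ (d - 1)"
    have "y \<noteq> 0" using elim by (simp add: y_def)
    then show ?case
      unfolding qx fx f'x xd y_def[symmetric] using elim by (simp add: field_simps)
  qed
  have "((\<lambda>x. of_real (P' (K (inverse x)) / 2) * (x ^ (d - 1) / poly R x)) \<longlongrightarrow> 0) (at 0)"
  proof (rule Lim_null_comparison[where g="\<lambda>x. (M / 2) * norm (x ^ (d - 1) / poly R x)"])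
    show "\<forall>\<^sub>F x in at 0. norm (of_real (P' (K (inverse x)) / 2) * (x ^ (d - 1) / poly R x)) \<le> (M / 2) * norm (x ^ (d - 1) / poly R x)"
      unfolding norm_mult norm_of_real using M by (intro always_eventually allI mult_right_mono) auto
    have "((\<lambda>x. (M / 2) * norm (x ^ (d - 1) / poly R x)) \<longlongrightarrow> (M / 2) * norm (0 ^ (d - 1) / poly R 0)) (at 0)"
      using cR(1) R0 by (intro tendsto_intros) (auto simp: isCont_def)
    then show "((\<lambda>x. (M / 2) * norm (x ^ (d - 1) / poly R x)) \<longlongrightarrow> 0) (at 0)"
    proof -
      have "(0::complex) ^ (d - 1) = 0" using d by (simp add: d_def)
      then show ?thesis using \<open>((\<lambda>x. (M / 2) * norm (x ^ (d - 1) / poly R x)) \<longlongrightarrow> (M / 2) * norm (0 ^ (d - 1) / poly R 0)) (at 0)\<close>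
        by (simp only: div_0 norm_zero mult_zero_right)
    qed
  qed
  moreover have "((\<lambda>x. poly R1 x / poly R x) \<longlongrightarrow> poly R1 0 / poly R 0) (at 0)"
    using cR R0 by (intro tendsto_intros) (auto simp: isCont_def)
  ultimately have "((\<lambda>x. of_real (P' (K (inverse x)) / 2) * (x ^ (d - 1) / poly R x) - poly R1 x / poly R x) \<longlongrightarrow> 0 - poly R1 0 / poly R 0) (at 0)"
    by (rule tendsto_diff)
  then have "((\<lambda>x. inverse x * q (inverse x)) \<longlongrightarrow> 0 - poly R1 0 / poly R 0) (at 0)"
    by (rule Lim_transform_eventually) (rule ev)
  then show ?thesis
    unfolding lim_at_infinity_0 using R0 by (simp add: R10 o_def d_def)
qed

text \<open>The function v = ln ((K - K2)/(K1 - K)) has differential (K1 - K2)(K - K0)/6 Re (dz/f).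
  With x = 1/z the form dz/f is - x^(d-2) dx / R(x), which is bounded near 0 because d \<ge> 2. So v
  has a finite limit, and finite v means an intermediate value of K.\<close>

lemma many_K_limit:
  assumes d: "degree F \<ge> 2"
  shows "\<exists>l. K2 < l \<and> l < K1 \<and> (K \<longlongrightarrow> l) at_infinity"
proof -
  define d where "d = degree F"
  define R where "R = reflect_poly F"
  have R0: "poly R 0 \<noteq> 0" by (simp add: R_def)
  have "isCont (poly R) 0" by (rule poly_isCont)
  then have "((\<lambda>x. norm (poly R x)) \<longlongrightarrow> norm (poly R 0)) (at 0)" unfolding isCont_def by (rule tendsto_norm)
  then have "\<forall>\<^sub>F x in at 0. norm (poly R x) > norm (poly R 0) / 2"
    by (rule order_tendstoD) (use R0 in simp)
  then obtain \<rho>1 where \<rho>1: "\<rho>1 > 0" "\<And>x. x \<noteq> 0 \<Longrightarrow> dist x 0 < \<rho>1 \<Longrightarrow> norm (poly R x) > norm (poly R 0) / 2"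
    by (auto simp: eventually_at)
  define \<rho> where "\<rho> = min \<rho>1 1"
  have \<rho>: "\<rho> > 0" using \<rho>1 by (simp add: \<rho>_def)
  define v where "v = (\<lambda>x. ln (K (inverse x) - K2) - ln (K1 - K (inverse x)))"
  define D where "D = (\<lambda>x h. (K1 - K2) * (K (inverse x) - K0) / 6 * Re (- h * x ^ (d - 2) / poly R x))"
  define B where "B = (K1 - K2) * (K1 - K0) / 6 * (2 / norm (poly R 0))"
  have x: "x \<noteq> 0 \<and> norm x < 1 \<and> norm (poly R x) > norm (poly R 0) / 2 \<and> f (inverse x) \<noteq> 0 \<and> poly R x \<noteq> 0" if "x \<in> ball 0 \<rho> - {0}" for x :: complex
  proof -
    have "x \<noteq> 0" "norm x < 1" "norm (poly R x) > norm (poly R 0) / 2" using that \<rho>1(2)[of x] by (auto simp: \<rho>_def)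
    moreover from this have "poly R x \<noteq> 0" by (metis norm_eq_zero norm_ge_zero not_less half_gt_zero_iff R0 zero_less_norm_iff order_less_trans order_less_irrefl)
    ultimately show ?thesis by (simp add: f_inverse R_def)
  qed
  have xd: "x ^ d = x * x * x ^ (d - 2)" for x :: complex
    using d by (metis d_def add_diff_inverse_nat not_less power_add power2_eq_square)
  have "\<exists>l. (v \<longlongrightarrow> l) (at 0)"
  proof (rule lipschitz_punctured_limit[OF \<rho>, of v D B])
    fix x :: complex assume xx: "x \<in> ball 0 \<rho> - {0}"
    note xs = x[OF xx]
    let ?z = "inverse x"
    have Ks: "K2 < K ?z" "K ?z < K1" using K_strict xs by auto
    have 1: "(inverse has_derivative (\<lambda>h. - (inverse x * h * inverse x))) (at x)"
      by (rule has_derivative_inverse'[OF conjunct1[OF xs]])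
    have "((\<lambda>x. K (inverse x)) has_derivative (\<lambda>h. P (K ?z) * Re (- (inverse x * h * inverse x) / f ?z))) (at x)"
      by (rule has_derivative_compose[OF 1 dK_eq]) (use xs in simp)
    moreover have "- (inverse x * h * inverse x) / f ?z = - h * x ^ (d - 2) / poly R x" for h
    proof -
      have "f ?z = poly R x / (x * x * x ^ (d - 2))" using xs by (simp add: f_inverse R_def d_def[symmetric] xd[symmetric])
      then show ?thesis using xs by (simp add: field_simps)
    qed
    ultimately have 2: "((\<lambda>x. K (inverse x)) has_derivative (\<lambda>h. P (K ?z) * Re (- h * x ^ (d - 2) / poly R x))) (at x)"
      by (simp only:)
    have "(v has_derivative (\<lambda>h. P (K ?z) * Re (- h * x ^ (d - 2) / poly R x) / (K ?z - K2) + P (K ?z) * Re (- h * x ^ (d - 2) / poly R x) / (K1 - K ?z))) (at x)"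
      unfolding v_def using Ks by (auto intro!: derivative_eq_intros 2 simp: fun_eq_iff divide_inverse mult_ac)
    moreover have "P (K ?z) * w / (K ?z - K2) + P (K ?z) * w / (K1 - K ?z) = (K1 - K2) * (K ?z - K0) / 6 * w" for w
    proof -
      define s t where "s = K ?z - K2" and "t = K1 - K ?z"
      have st: "s > 0" "t > 0" "K1 - K2 = s + t" using Ks by (auto simp: s_def t_def)
      define y where "y = K ?z - K0"
      have Py: "P (K ?z) = t * s * y / 6" by (simp add: P_factor s_def t_def y_def)
      show ?thesis using st(1,2) unfolding s_def[symmetric] t_def[symmetric] y_def[symmetric] st(3) Py
        by (simp add: field_simps)
    qed
    ultimately show "(v has_derivative D x) (at x)" by (simp only: D_def)
    show "\<bar>D x h\<bar> \<le> B * norm h" for h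
    proof -
      have "\<bar>Re (- h * x ^ (d - 2) / poly R x)\<bar> \<le> norm (- h * x ^ (d - 2) / poly R x)" by (rule abs_Re_le_cmod)
      also have "\<dots> = norm h * norm x ^ (d - 2) / norm (poly R x)" by (simp add: norm_mult norm_divide norm_power)
      also have "\<dots> \<le> norm h * 1 / (norm (poly R 0) / 2)"
        using xs R0 by (intro frac_le mult_mono power_le_one) auto
      finally have 3: "\<bar>Re (- h * x ^ (d - 2) / poly R x)\<bar> \<le> norm h * (2 / norm (poly R 0))" by simp
      have "\<bar>D x h\<bar> = (K1 - K2) * (K ?z - K0) / 6 * \<bar>Re (- h * x ^ (d - 2) / poly R x)\<bar>"
        using K_range(1) K0_le Ks by (simp add: D_def abs_mult)
      also have "\<dots> \<le> (K1 - K2) * (K1 - K0) / 6 * (norm h * (2 / norm (poly R 0)))"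
        using K_range(1) K0_le Ks 3 by (intro mult_mono divide_right_mono) auto
      finally show ?thesis by (simp add: B_def mult_ac)
    qed
  qed
  then obtain l where l: "(v \<longlongrightarrow> l) (at 0)" by blast
  \<comment> \<open>g recovers K from v; its values lie strictly between \<open>K2\<close> and
    \<open>K1\<close>.\<close>
  define g where "g = (\<lambda>u. (K1 * exp u + K2) / (exp u + 1))"
  have pos: "exp u + 1 > 0" for u :: real by (simp add: add_pos_pos)
  have nz: "exp u + 1 \<noteq> 0" for u :: real using pos[of u] by simp
  have "((\<lambda>x. g (v x)) \<longlongrightarrow> g l) (at 0)"
    unfolding g_def by (intro tendsto_intros l) (use nz in auto)
  moreover have "\<forall>\<^sub>F x in at 0. g (v x) = K (inverse x)"
  proof -
    have "g (v x) = K (inverse x)" if "x \<noteq> 0" "dist x 0 < \<rho>" for x :: complex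
    proof -
      have "x \<in> ball 0 \<rho> - {0}" using that by simp
      from x[OF this] have "f (inverse x) \<noteq> 0" by blast
      from K_strict[OF this] have Ks: "K2 < K (inverse x)" "K (inverse x) < K1" by auto
      define s t where "s = K (inverse x) - K2" and "t = K1 - K (inverse x)"
      have st: "s > 0" "t > 0" "K1 = K2 + s + t" "K (inverse x) = K2 + s" using Ks by (auto simp: s_def t_def)
      have "exp (v x) = s / t" unfolding v_def s_def[symmetric] t_def[symmetric] using st(1,2) by (simp add: exp_diff)
      then have "g (v x) = (K1 * (s / t) + K2) / (s / t + 1)" by (simp add: g_def)
      also have "\<dots> = K2 + s" using st(1,2) unfolding st(3) by (simp add: divide_simps add_pos_pos) (simp add: algebra_simps)
      finally show ?thesis by (simp only: st(4))
    qed
    then show ?thesis unfolding eventually_at using \<rho> by auto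
  qed
  ultimately have "((\<lambda>x. K (inverse x)) \<longlongrightarrow> g l) (at 0)" by (rule Lim_transform_eventually)
  then have "(K \<longlongrightarrow> g l) at_infinity" by (rule tendsto_at_infinity_inverse)
  moreover have "K2 < g l" "g l < K1"
    using K_range(1) pos[of l] by (simp_all add: g_def field_simps)
  ultimately show ?thesis by blast
qed

end

text \<open>The time function of the flow on the open interval between the two extremal values:
  an antiderivative of 1/P that depends only on the roots of P.\<close>

definition flow_time :: "real \<Rightarrow> real \<Rightarrow> real \<Rightarrow> real" where
  "flow_time k1 k2 = (SOME T. \<forall>k. k2 < k \<and> k < k1 \<longrightarrow>
     (T has_real_derivative 6 / ((k1 - k) * (k - k2) * (k + k1 + k2))) (at k))"

section \<open>Radial metrics\<close>

context hcmu_plane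
begin

abbreviation T :: "real \<Rightarrow> real" where "T \<equiv> flow_time K1 K2"

lemma T_deriv:
  assumes "K2 < k" "k < K1"
  shows "(T has_real_derivative 1 / P k) (at k)"
proof -
  let ?g = "\<lambda>k. 6 / ((K1 - k) * (k - K2) * (k + K1 + K2))"
  have g: "?g k = 1 / P k" for k by (simp add: P_factor K0_def add.assoc)
  have "\<exists>T. \<forall>k::real. ereal K2 < ereal k \<longrightarrow> ereal k < ereal K1 \<longrightarrow> (T has_vector_derivative ?g k) (at k)"
  proof (rule einterval_antiderivative)
    fix k assume "ereal K2 < ereal k" "ereal k < ereal K1"
    then have "P k > 0" by (intro K_range(4)) auto
    then have "K1 - k \<noteq> 0" "k - K2 \<noteq> 0" "k - K0 \<noteq> 0" by (auto simp: P_factor)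
    moreover have "k + K1 + K2 = k - K0" by (simp add: K0_def)
    ultimately have "(K1 - k) * (k - K2) * (k + K1 + K2) \<noteq> 0" by simp
    then show "isCont ?g k" by (intro continuous_intros) auto
  qed (use K_range(1) in simp)
  then have "\<exists>T. \<forall>k. K2 < k \<and> k < K1 \<longrightarrow> (T has_real_derivative ?g k) (at k)"
    by (auto simp: has_real_derivative_iff_has_vector_derivative)
  from someI_ex[OF this] assms show ?thesis by (simp add: flow_time_def g)
qed

lemma T_strict_mono: "K2 < x \<Longrightarrow> x < y \<Longrightarrow> y < K1 \<Longrightarrow> T x < T y"
proof (rule DERIV_pos_imp_increasing[of x y T])
  fix k assume "K2 < x" "x < y" "y < K1" "x \<le> k" "k \<le> y"
  then show "\<exists>d. (T has_real_derivative d) (at k) \<and> d > 0"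
    using K_range(4)[of k] T_deriv[of k] by (intro exI[of _ "1 / P k"]) auto
qed

lemma T_less_iff:
  assumes "K2 < x" "x < K1" "K2 < y" "y < K1"
  shows "T x < T y \<longleftrightarrow> x < y"
  using T_strict_mono[of x y] T_strict_mono[of y x] assms by (metis less_asym linorder_neqE_linordered_idom)

lemma T_inj:
  assumes "K2 < x" "x < K1" "K2 < y" "y < K1" "T x = T y"
  shows "x = y"
  using T_less_iff[of x y] T_less_iff[of y x] assms by (metis less_irrefl linorder_neqE_linordered_idom)

text \<open>The last conjunct integrates dK/P(K) = Re (dz/f). The constant \<open>c0\<close> is the
  only trace of the scale: a dilation about \<open>z0\<close> shifts it.\<close>

definition radial :: "complex \<Rightarrow> real \<Rightarrow> real \<Rightarrow> bool" where
  "radial z0 \<beta> c0 \<longleftrightarrow> \<beta> \<noteq> 0 \<and> (\<forall>z. f z = of_real \<beta> * (z - z0)) \<and>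
     (\<forall>z. z \<noteq> z0 \<longrightarrow> T (K z) = ln (norm (z - z0)) / \<beta> + c0)"

text \<open>Substituting z = z0 + exp w replaces the punctured plane by its universal cover, where
  T(K) has differential Re (dw)/\<beta>. Thus H has zero derivative on the whole plane, and no
  monodromy has to be discussed.\<close>

lemma linear_radial:
  assumes \<beta>: "\<beta> \<noteq> 0" and f: "\<And>z. f z = of_real \<beta> * (z - z0)"
  shows "\<exists>c0. radial z0 \<beta> c0"
proof -
  define H where "H = (\<lambda>w. T (K (z0 + exp w)) - Re w / \<beta>)"
  have fz: "f (z0 + exp w) = of_real \<beta> * exp w" for w by (simp add: f)
  have "(H has_derivative (\<lambda>v. 0)) (at w within UNIV)" for w
  proof -
    let ?z = "z0 + exp w"
    have nz: "f ?z \<noteq> 0" using \<beta> by (simp add: fz)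
    have Ks: "K2 < K ?z" "K ?z < K1" using K_strict[OF nz] by auto
    have "((\<lambda>w. z0 + exp w) has_derivative (\<lambda>v. exp w * v)) (at w)"
      using DERIV_exp[of w] by (auto intro!: derivative_eq_intros simp: has_field_derivative_def)
    from has_derivative_compose[OF this dK_eq[OF nz]]
    have "((\<lambda>w. K (z0 + exp w)) has_derivative (\<lambda>v. P (K ?z) * Re (exp w * v / f ?z))) (at w)" .
    from has_derivative_compose[OF this T_deriv[OF Ks, unfolded has_field_derivative_def]]
    have 1: "((\<lambda>w. T (K (z0 + exp w))) has_derivative (\<lambda>v. 1 / P (K ?z) * (P (K ?z) * Re (exp w * v / f ?z)))) (at w)" .
    have "(H has_derivative (\<lambda>v. 1 / P (K ?z) * (P (K ?z) * Re (exp w * v / f ?z)) - Re v / \<beta>)) (at w)"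
      unfolding H_def by (intro has_derivative_diff 1) (use \<beta> in \<open>auto intro!: derivative_eq_intros\<close>)
    moreover have "1 / P (K ?z) * (P (K ?z) * Re (exp w * v / f ?z)) - Re v / \<beta> = 0" for v
      using K_range(4)[OF Ks] \<beta> by (simp add: fz Re_divide_of_real)
    ultimately show ?thesis by simp
  qed
  from has_derivative_zero_constant[OF convex_UNIV this]
  have H: "H w = H 0" for w by (metis UNIV_I)
  have "T (K z) = ln (norm (z - z0)) / \<beta> + H 0" if "z \<noteq> z0" for z
  proof -
    have "exp (Ln (z - z0)) = z - z0" using that by simp
    then have "H (Ln (z - z0)) = T (K z) - ln (norm (z - z0)) / \<beta>" using that by (simp add: H_def)
    then show ?thesis using H[of "Ln (z - z0)"] by simp
  qed
  then show ?thesis unfolding radial_def using \<beta> f by blast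
qed

lemma single_zero:
  assumes "degree F = 1"
  shows "(\<exists>z0 c0. radial z0 (- a) c0 \<and> K z0 = K1) \<or> (b > 0 \<and> (\<exists>z0 c0. radial z0 b c0 \<and> K z0 = K2))"
proof -
  obtain \<beta> z0 where f: "\<And>z. f z = \<beta> * (z - z0)" and \<beta>: "\<beta> \<noteq> 0"
  proof -
    define d where "d = coeff F 1"
    have d: "d \<noteq> 0" using assms by (metis d_def F_nonzero leading_coeff_0_iff)
    have "F = [:coeff F 0, d:]"
      using assms by (intro poly_eqI) (auto simp: coeff_pCons d_def coeff_eq_0 split: nat.split)
    then have "f z = coeff F 0 + z * d" for z by (metis f_F poly_pCons poly_0 mult_zero_right add_0_right)
    then have "f z = d * (z - (- coeff F 0 / d))" for z using d by (simp add: field_simps)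
    then show ?thesis using that d by blast
  qed
  have f0: "f z0 = 0" by (simp add: f)
  have "f' z0 = \<beta>"
    by (rule DERIV_unique[OF df]) (auto intro!: derivative_eq_intros simp: f[abs_def])
  with K_at_zero[OF f0] consider "K z0 = K1" "\<beta> = of_real (- a)" | "K z0 = K2" "\<beta> = of_real b" "b > 0" by auto
  then show ?thesis
  proof cases
    case 1
    then show ?thesis using linear_radial[of "- a" z0] f ab(1) by auto
  next
    case 2
    then show ?thesis using linear_radial[of b z0] f by auto
  qed
qed

lemma radial_nonzero: "radial z0 \<beta> c0 \<Longrightarrow> z \<noteq> z0 \<Longrightarrow> f z \<noteq> 0"
  by (simp add: radial_def)

lemma radial_strict: "radial z0 \<beta> c0 \<Longrightarrow> z \<noteq> z0 \<Longrightarrow> K2 < K z \<and> K z < K1"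
  by (rule K_strict) (rule radial_nonzero)

text \<open>T is increasing in K, and ln |z - z0|/\<beta> tends to minus or plus infinity according
  to the sign of \<beta>. So K passes every intermediate value k, outside a disk whose radius B
  solves T(K) = T k.\<close>

lemma radial_K_limit:
  assumes r: "radial z0 \<beta> c0"
  shows "(K \<longlongrightarrow> (if \<beta> < 0 then K2 else K1)) at_infinity"
proof (rule tendstoI)
  fix e :: real assume e: "e > 0"
  have \<beta>: "\<beta> \<noteq> 0" using r by (simp add: radial_def)
  define m where "m = min e (K1 - K2)"
  have m: "0 < m" "m \<le> K1 - K2" "m \<le> e" using e K_range(1) by (auto simp: m_def)
  define k where "k = (if \<beta> < 0 then K2 + m / 2 else K1 - m / 2)"
  have k: "K2 < k" "k < K1" using m by (auto simp: k_def)
  define B where "B = exp (\<beta> * (T k - c0))"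
  have "dist (K z) (if \<beta> < 0 then K2 else K1) < e" if z: "norm z \<ge> norm z0 + B + 1" for z
  proof -
    have n: "norm (z - z0) > B" using z norm_triangle_ineq2[of z z0] by linarith
    have zz: "z \<noteq> z0" using n by (auto simp: B_def dest: order_less_trans[OF exp_gt_zero])
    have TK: "T (K z) = ln (norm (z - z0)) / \<beta> + c0" using r zz by (simp add: radial_def)
    have "ln (norm (z - z0)) > \<beta> * (T k - c0)"
      using n zz by (metis B_def exp_gt_zero ln_exp ln_less_cancel_iff order_less_trans)
    then have "if \<beta> < 0 then T (K z) < T k else T k < T (K z)"
      unfolding TK using \<beta> by (auto simp: field_simps)
    moreover note Ks = radial_strict[OF r zz]
    ultimately have "if \<beta> < 0 then K z < k else k < K z"
      using T_less_iff k by (auto split: if_splits)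
    then show ?thesis using Ks m by (auto simp: k_def dist_real_def split: if_splits)
  qed
  then show "\<forall>\<^sub>F z in at_infinity. dist (K z) (if \<beta> < 0 then K2 else K1) < e"
    unfolding eventually_at_infinity by blast
qed

text \<open>Here f grows only linearly, so the term with P'(K) survives in the limit, in contrast to
  \<open>many_q_limit\<close>. This is why the angle need not be a multiple of 2 pi.\<close>

lemma radial_q_limit:
  assumes r: "radial z0 \<beta> c0"
  shows "((\<lambda>z. z * q z) \<longlongrightarrow> of_real (P' (if \<beta> < 0 then K2 else K1) / (2 * \<beta>) - 1)) at_infinity"
proof -
  let ?l = "if \<beta> < 0 then K2 else K1"
  have \<beta>: "\<beta> \<noteq> 0" and f: "\<And>z. f z = of_real \<beta> * (z - z0)" using r by (auto simp: radial_def)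
  have f': "f' z = of_real \<beta>" for z
    by (rule DERIV_unique[OF df]) (auto intro!: derivative_eq_intros simp: f[abs_def])
  have 1: "((\<lambda>z. P' (K z)) \<longlongrightarrow> P' ?l) at_infinity"
    unfolding P'_def by (intro tendsto_intros radial_K_limit[OF r]) simp
  have 2: "((\<lambda>z. z / (z - z0)) \<longlongrightarrow> 1) at_infinity"
  proof -
    have "((\<lambda>x. 1 / (1 - x * z0)) \<longlongrightarrow> 1 / (1 - 0 * z0)) (at 0)" by (intro tendsto_intros) auto
    moreover have "\<forall>\<^sub>F x in at 0. 1 / (1 - x * z0) = inverse x / (inverse x - z0)"
      using eventually_neq_at_within[of 0 0 UNIV] by eventually_elim (simp add: field_simps)
    ultimately have "((\<lambda>x. inverse x / (inverse x - z0)) \<longlongrightarrow> 1 / (1 - 0 * z0)) (at 0)"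
      by (rule Lim_transform_eventually)
    then show ?thesis by (simp add: lim_at_infinity_0 o_def)
  qed
  have "((\<lambda>z. (z / (z - z0)) * of_real ((P' (K z) / 2 - \<beta>) / \<beta>)) \<longlongrightarrow> 1 * of_real ((P' ?l / 2 - \<beta>) / \<beta>)) at_infinity"
    by (intro tendsto_intros 1 2) (use \<beta> in auto)
  moreover have "\<forall>\<^sub>F z in at_infinity. (z / (z - z0)) * of_real ((P' (K z) / 2 - \<beta>) / \<beta>) = z * q z"
  proof -
    have "(z / (z - z0)) * of_real ((P' (K z) / 2 - \<beta>) / \<beta>) = z * q z" if "norm z \<ge> norm z0 + 1" for z
    proof -
      have "z \<noteq> z0" using that by auto
      then have nz: "f z \<noteq> 0" by (rule radial_nonzero[OF r])
      show ?thesis unfolding q_eq[OF nz] f f' using \<open>z \<noteq> z0\<close> \<beta> by (simp add: field_simps)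
    qed
    then show ?thesis unfolding eventually_at_infinity by blast
  qed
  ultimately have "((\<lambda>z. z * q z) \<longlongrightarrow> 1 * of_real ((P' ?l / 2 - \<beta>) / \<beta>)) at_infinity"
    by (rule Lim_transform_eventually)
  moreover have "(P' ?l / 2 - \<beta>) / \<beta> = P' ?l / (2 * \<beta>) - 1" using \<beta> by (simp add: field_simps)
  ultimately show ?thesis by simp
qed

lemma radial_E:
  assumes "radial z0 \<beta> c0" "z \<noteq> z0"
  shows "exp (2 * \<phi> z) = P (K z) / (2 * \<beta>\<^sup>2 * (norm (z - z0))\<^sup>2)"
  using exp_phi[OF radial_nonzero[OF assms]] assms(1) by (simp add: radial_def norm_mult power_mult_distrib)

text \<open>Along a ray dK/ds = P(K)/(\<beta> s), so by \<open>radial_E\<close> the area density of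
  the circles is (pi/\<beta>) dK/ds. The area of a disk telescopes to a difference of two values of
  K.\<close>

lemma radial_area:
  assumes r: "radial z0 \<beta> c0"
  shows "total = pi / \<beta> * ((if \<beta> < 0 then K2 else K1) - K z0)"
proof -
  let ?l = "if \<beta> < 0 then K2 else K1"
  define E where "E = (\<lambda>z. exp (2 * \<phi> z))"
  have cE: "continuous_on UNIV E" unfolding E_def by (rule cont_E)
  have \<beta>: "\<beta> \<noteq> 0" and f: "\<And>z. f z = of_real \<beta> * (z - z0)" using r by (auto simp: radial_def)
  have radK: "K (z0 + of_real s * cis \<theta>) = K (z0 + of_real s)" if "s > 0" for s \<theta>
  proof (rule T_inj)
    have ne: "z0 + of_real s * cis \<theta> \<noteq> z0" "z0 + of_real s \<noteq> z0" using that by auto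
    show "T (K (z0 + of_real s * cis \<theta>)) = T (K (z0 + of_real s))"
      using r ne that unfolding radial_def by (simp add: norm_mult)
  qed (use radial_strict[OF r] that in auto)
  have ball: "integral (ball z0 R) E = pi / \<beta> * (K (z0 + of_real R) - K z0)" if R: "R > 0" for R
  proof -
    have "((\<lambda>s. s * circle_integral E z0 s) has_integral (pi / \<beta> * K (z0 + of_real R) - pi / \<beta> * K (z0 + of_real 0))) {0..R}"
    proof (rule fundamental_theorem_of_calculus_interior)
      show "continuous_on {0..R} (\<lambda>s. pi / \<beta> * K (z0 + of_real s))"
        by (intro continuous_intros continuous_on_compose2[OF cont_K[of UNIV]]) auto
      fix s assume "s \<in> {0<..<R}"
      then have s: "s > 0" by simp
      let ?z = "z0 + of_real s"
      have nz: "f ?z \<noteq> 0" using s \<beta> by (simp add: f)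
      have E: "E (z0 + of_real s * cis \<theta>) = P (K ?z) / (2 * \<beta>\<^sup>2 * s\<^sup>2)" for \<theta>
        unfolding E_def using s by (subst radial_E[OF r]) (auto simp: radK norm_mult)
      have 1: "s * circle_integral E z0 s = pi / \<beta> * (P (K ?z) / (\<beta> * s))"
        unfolding circle_integral_def E using s \<beta> by (simp add: power2_eq_square field_simps)
      have "((\<lambda>s. z0 + of_real s) has_derivative (\<lambda>x. of_real x)) (at s)"
        by (auto intro!: derivative_eq_intros)
      from has_derivative_compose[OF this dK_eq[OF nz]]
      have "((\<lambda>s. K (z0 + of_real s)) has_derivative (\<lambda>x. P (K ?z) * Re (of_real x / f ?z))) (at s)" .
      moreover have "P (K ?z) * Re (of_real x / f ?z) = (P (K ?z) / (\<beta> * s)) * x" for x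
      proof -
        have "complex_of_real x / f ?z = of_real (x / (\<beta> * s))" by (simp add: f)
        then show ?thesis by (simp only: Re_complex_of_real) simp
      qed
      ultimately have "((\<lambda>s. K (z0 + of_real s)) has_real_derivative P (K ?z) / (\<beta> * s)) (at s)"
        by (simp only: has_field_derivative_def)
      then have "((\<lambda>s. pi / \<beta> * K (z0 + of_real s)) has_real_derivative pi / \<beta> * (P (K ?z) / (\<beta> * s))) (at s)"
        by (rule DERIV_cmult)
      then show "((\<lambda>s. pi / \<beta> * K (z0 + of_real s)) has_vector_derivative s * circle_integral E z0 s) (at s)"
        unfolding 1 by (simp only: has_real_derivative_iff_has_vector_derivative)
    qed (use R in simp)
    from has_integral_unique[OF polar_circle_integral[OF cE R, of z0] this] show ?thesis
      by (simp add: algebra_simps)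
  qed
  \<comment> \<open>Exhaustion of the plane by disks about \<open>z0\<close>; E dominates all its
    truncations.\<close>
  have "(\<lambda>n. integral UNIV (\<lambda>x. if x \<in> ball z0 (real (Suc n)) then E x else 0)) \<longlonglongrightarrow> integral UNIV E"
  proof (rule dominated_convergence(2)[where h=E])
    show "(\<lambda>x. if x \<in> ball z0 (real (Suc n)) then E x else 0) integrable_on UNIV" for n
      unfolding integrable_restrict_UNIV by (rule continuous_integrable_ball[OF cE])
    show "E integrable_on UNIV" unfolding E_def by (rule E_integrable_UNIV)
    show "norm (if x \<in> ball z0 (real (Suc n)) then E x else 0) \<le> E x" for x n by (simp add: E_def)
    show "(\<lambda>n. if x \<in> ball z0 (real (Suc n)) then E x else 0) \<longlonglongrightarrow> E x" for x
    proof (rule tendsto_eventually)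
      obtain N :: nat where "dist z0 x < real N" using reals_Archimedean2 by blast
      moreover have "real N \<le> real (Suc n)" if "n \<ge> N" for n using that by simp
      ultimately have "dist z0 x < real (Suc n)" if "n \<ge> N" for n using that order_less_le_trans by blast
      then show "\<forall>\<^sub>F n in sequentially. (if x \<in> ball z0 (real (Suc n)) then E x else 0) = E x"
        unfolding eventually_sequentially by auto
    qed
  qed
  then have "(\<lambda>n. integral (ball z0 (real (Suc n))) E) \<longlonglongrightarrow> total"
    unfolding integral_restrict_UNIV E_integrable_UNIV(2)[folded E_def] .
  then have 1: "(\<lambda>n. pi / \<beta> * (K (z0 + of_real (real (Suc n))) - K z0)) \<longlonglongrightarrow> total"
    by (simp add: ball)
  have "filterlim (\<lambda>n. z0 + of_real (real (Suc n))) at_infinity sequentially"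
  proof (rule tendsto_add_filterlim_at_infinity[of _ z0])
    show "filterlim (\<lambda>n. complex_of_real (real (Suc n))) at_infinity sequentially"
      using filterlim_compose[OF tendsto_of_nat filterlim_Suc] by (simp del: of_nat_Suc)
  qed simp
  from filterlim_compose[OF radial_K_limit[OF r] this]
  have "(\<lambda>n. pi / \<beta> * (K (z0 + of_real (real (Suc n))) - K z0)) \<longlonglongrightarrow> pi / \<beta> * (?l - K z0)"
    by (intro tendsto_intros)
  with 1 show ?thesis by (rule LIMSEQ_unique)
qed

end

section \<open>Comparison of two radial metrics\<close>

locale hcmu_plane_pair =
  A: hcmu_plane \<phi> K f f' q p + B: hcmu_plane \<psi> L g g' r s
  for \<phi> K :: "complex \<Rightarrow> real" and f f' q p :: "complex \<Rightarrow> complex"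
  and \<psi> L :: "complex \<Rightarrow> real" and g g' r s :: "complex \<Rightarrow> complex"
begin

text \<open>T is chosen from the roots alone, so equal roots give both metrics literally the same T.
  The similarity with factor \<mu> shifts the constant by ln |\<mu>|/\<beta>, hence matches the
  curvatures, and \<open>radial_E\<close> then matches the conformal factors.\<close>

lemma radial_isometry:
  assumes rA: "A.radial x0 \<beta> c" and rB: "B.radial y0 \<beta> d"
    and K1: "A.K1 = B.K1" and K2: "A.K2 = B.K2"
    and \<mu>: "\<mu> \<noteq> 0" "ln (norm \<mu>) / \<beta> + d = c"
  shows "\<psi> (y0 + \<mu> * (z - x0)) + ln (norm \<mu>) = \<phi> z"
proof -
  let ?h = "\<lambda>z. y0 + \<mu> * (z - x0)"
  have PP: "A.P k = B.P k" for k
    unfolding A.P_factor B.P_factor A.K0_def B.K0_def K1 K2 ..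
  have ne: "\<psi> (?h z) + ln (norm \<mu>) = \<phi> z" if z: "z \<noteq> x0" for z
  proof -
    have hz: "?h z \<noteq> y0" using z \<mu> by simp
    have "L (?h z) = K z"
    proof (rule A.T_inj)
      have "B.T (L (?h z)) = ln (norm (\<mu> * (z - x0))) / \<beta> + d"
        using rB hz unfolding B.radial_def by simp
      also have "\<dots> = ln (norm (z - x0)) / \<beta> + c"
        using z \<mu> by (simp add: norm_mult ln_mult add_divide_distrib)
      also have "\<dots> = A.T (K z)" using rA z unfolding A.radial_def by simp
      finally show "A.T (L (?h z)) = A.T (K z)" unfolding K1 K2 .
    qed (use A.radial_strict[OF rA z] B.radial_strict[OF rB hz] K1 K2 in auto)
    then have "exp (2 * (\<psi> (?h z) + ln (norm \<mu>))) = exp (2 * \<phi> z)"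
      using A.radial_E[OF rA z] B.radial_E[OF rB hz] \<mu> z
      by (simp add: distrib_left exp_add PP norm_mult power_mult_distrib exp_double)
    then show ?thesis by simp
  qed
  show ?thesis
  proof (cases "z = x0")
    \<comment> \<open>At the centre the vector field vanishes and \<open>radial_E\<close> says
      nothing, so the equation is extended by continuity.\<close>
    case True
    have "continuous_on UNIV (\<lambda>z. \<psi> (?h z) + ln (norm \<mu>))"
      by (intro continuous_intros continuous_on_compose2[OF B.cont_phi[of UNIV]]) auto
    then have "isCont (\<lambda>z. \<psi> (?h z) + ln (norm \<mu>)) x0"
      by (simp add: continuous_on_eq_continuous_at)
    then have "((\<lambda>z. \<psi> (?h z) + ln (norm \<mu>)) \<longlongrightarrow> \<psi> (?h x0) + ln (norm \<mu>)) (at x0)"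
      unfolding isCont_def .
    moreover have "(\<phi> \<longlongrightarrow> \<phi> x0) (at x0)"
      using A.cont_phi[of UNIV] by (simp add: continuous_on_eq_continuous_at isCont_def)
    then have "((\<lambda>z. \<psi> (?h z) + ln (norm \<mu>)) \<longlongrightarrow> \<phi> x0) (at x0)"
    proof (rule Lim_transform_eventually)
      show "\<forall>\<^sub>F z in at x0. \<phi> z = \<psi> (?h z) + ln (norm \<mu>)"
        using eventually_neq_at_within[of x0 x0 UNIV] by eventually_elim (simp add: ne)
    qed
    ultimately show ?thesis using True by (metis LIM_unique)
  qed (rule ne)
qed

end

section \<open>Smooth functions and Wirtinger derivatives\<close>

lemma frechet_derivative_cong_open:
  assumes "open S" "x \<in> S" "\<And>y. y \<in> S \<Longrightarrow> f y = g y"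
  shows "frechet_derivative f (at x) = frechet_derivative g (at x)"
proof -
  have "(f has_derivative D) (at x) \<longleftrightarrow> (g has_derivative D) (at x)" for D
    using has_derivative_transform_within_open[OF _ assms(1,2), of f D UNIV g]
      has_derivative_transform_within_open[OF _ assms(1,2), of g D UNIV f] assms(3) by auto
  then show ?thesis by (simp add: frechet_derivative_def)
qed

lemma frechet_derivative_eq: "(f has_derivative D) (at x) \<Longrightarrow> frechet_derivative f (at x) = D"
  using frechet_derivative_at by metis

text \<open>Formulas for derivatives are available only on S, whereas
  \<open>frechet_derivative\<close> is a total function. This is what lets such formulas be
  substituted under further derivatives.\<close>

lemma k_times_cong:
  assumes "open S"
  shows "(\<And>y. y \<in> S \<Longrightarrow> f y = g y) \<Longrightarrow> k_times_differentiable_on k S f \<Longrightarrow> k_times_differentiable_on k S g"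
proof (induction k arbitrary: f g)
  case 0
  then show ?case by (simp cong: continuous_on_cong)
next
  case (Suc k)
  have "g differentiable (at x)" if "x \<in> S" for x
  proof -
    have "f differentiable (at x)" using Suc.prems(2) that by simp
    then show ?thesis
      unfolding differentiable_def
      using has_derivative_transform_within_open[OF _ assms that, of f _ UNIV g] Suc.prems(1) by blast
  qed
  moreover have "k_times_differentiable_on k S (\<lambda>x. frechet_derivative g (at x) v)" for v
    by (rule Suc.IH[of "\<lambda>x. frechet_derivative f (at x) v"])
      (use Suc.prems frechet_derivative_cong_open[OF assms _ Suc.prems(1)] in auto)
  ultimately show ?case by simp
qed

lemma k_times_Suc_imp: "k_times_differentiable_on (Suc k) S f \<Longrightarrow> k_times_differentiable_on k S f"
proof (induction k arbitrary: f)
  case 0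
  then show ?case by (auto intro!: continuous_at_imp_continuous_on differentiable_imp_continuous_within)
qed simp

lemma k_times_const: "k_times_differentiable_on k S (\<lambda>_. c)"
  by (induction k arbitrary: c) auto

lemma k_times_add:
  assumes "open S"
  shows "k_times_differentiable_on k S f \<Longrightarrow> k_times_differentiable_on k S g \<Longrightarrow>
     k_times_differentiable_on k S (\<lambda>x. f x + g x)"
proof (induction k arbitrary: f g)
  case (Suc k)
  have d: "((\<lambda>x. f x + g x) has_derivative (\<lambda>v. frechet_derivative f (at x) v + frechet_derivative g (at x) v)) (at x)"
    if "x \<in> S" for x
    using Suc.prems that by (intro has_derivative_add) (auto simp: frechet_derivative_works[symmetric])
  have "k_times_differentiable_on k S (\<lambda>x. frechet_derivative (\<lambda>x. f x + g x) (at x) v)" for v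
    by (rule k_times_cong[OF assms, of "\<lambda>x. frechet_derivative f (at x) v + frechet_derivative g (at x) v"])
       (use Suc in \<open>auto simp: frechet_derivative_eq[OF d]\<close>)
  then show ?case using differentiableI[OF d] by simp
qed (auto intro: continuous_intros)

lemma k_times_mult:
  fixes f g :: "'a::real_normed_vector \<Rightarrow> 'b::real_normed_algebra"
  assumes "open S"
  shows "k_times_differentiable_on k S f \<Longrightarrow> k_times_differentiable_on k S g \<Longrightarrow>
     k_times_differentiable_on k S (\<lambda>x. f x * g x)"
proof (induction k arbitrary: f g)
  case (Suc k)
  have d: "((\<lambda>x. f x * g x) has_derivative (\<lambda>v. f x * frechet_derivative g (at x) v + frechet_derivative f (at x) v * g x)) (at x)"
    if "x \<in> S" for x
    using Suc.prems that by (intro has_derivative_mult) (auto simp: frechet_derivative_works[symmetric])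
  have "k_times_differentiable_on k S (\<lambda>x. frechet_derivative (\<lambda>x. f x * g x) (at x) v)" for v
  proof (rule k_times_cong[OF assms, of "\<lambda>x. f x * frechet_derivative g (at x) v + frechet_derivative f (at x) v * g x"])
    have fg: "k_times_differentiable_on k S f" "k_times_differentiable_on k S g"
      by (rule k_times_Suc_imp, rule Suc.prems)+
    have "k_times_differentiable_on k S (\<lambda>x. frechet_derivative f (at x) v)"
      "k_times_differentiable_on k S (\<lambda>x. frechet_derivative g (at x) v)" using Suc.prems by simp_all
    then show "k_times_differentiable_on k S (\<lambda>x. f x * frechet_derivative g (at x) v + frechet_derivative f (at x) v * g x)"
      by (intro k_times_add[OF assms] Suc.IH fg)
  qed (simp add: frechet_derivative_eq[OF d])
  then show ?case using differentiableI[OF d] by simp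
qed (auto intro: continuous_intros)

lemma k_times_exp:
  fixes f :: "'a::real_normed_vector \<Rightarrow> real"
  assumes "open S"
  shows "k_times_differentiable_on k S f \<Longrightarrow> k_times_differentiable_on k S (\<lambda>x. exp (f x))"
proof (induction k arbitrary: f)
  case (Suc k)
  have d: "((\<lambda>x. exp (f x)) has_derivative (\<lambda>v. exp (f x) * frechet_derivative f (at x) v)) (at x)"
    if "x \<in> S" for x
  proof -
    have "(f has_derivative frechet_derivative f (at x)) (at x)"
      using Suc.prems that by (simp add: frechet_derivative_works[symmetric])
    from has_derivative_exp[OF this] show ?thesis by (simp add: mult.commute)
  qed
  have "k_times_differentiable_on k S (\<lambda>x. frechet_derivative (\<lambda>x. exp (f x)) (at x) v)" for v
  proof (rule k_times_cong[OF assms, of "\<lambda>x. exp (f x) * frechet_derivative f (at x) v"])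
    show "k_times_differentiable_on k S (\<lambda>x. exp (f x) * frechet_derivative f (at x) v)"
      using Suc.prems k_times_Suc_imp[OF Suc.prems] by (intro k_times_mult[OF assms] Suc.IH) auto
  qed (simp add: frechet_derivative_eq[OF d])
  then show ?case using differentiableI[OF d] by simp
qed (auto intro: continuous_intros)

lemma smooth_on_continuous: "smooth_on S f \<Longrightarrow> continuous_on S f"
  unfolding smooth_on_def by (metis k_times_differentiable_on.simps(1))

lemma smooth_on_derivative: "smooth_on S f \<Longrightarrow> smooth_on S (\<lambda>x. frechet_derivative f (at x) v)"
  unfolding smooth_on_def by (metis k_times_differentiable_on.simps(2))

lemma smooth_on_has_derivative:
  "smooth_on S f \<Longrightarrow> x \<in> S \<Longrightarrow> (f has_derivative frechet_derivative f (at x)) (at x)"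
  unfolding smooth_on_def by (metis k_times_differentiable_on.simps(2) frechet_derivative_works)

lemma smooth_on_chart_curv:
  assumes "open S" "smooth_on S u"
  shows "smooth_on S (chart_curv u)"
proof -
  have L: "smooth_on S (\<lambda>z. frechet_derivative (\<lambda>w. frechet_derivative u (at w) v) (at z) v)" for v
    by (intro smooth_on_derivative assms)
  have "k_times_differentiable_on k S (\<lambda>z. (-1 * exp (-2 * u z)) * (frechet_derivative (\<lambda>w. frechet_derivative u (at w) 1) (at z) 1 + frechet_derivative (\<lambda>w. frechet_derivative u (at w) \<i>) (at z) \<i>))" for k
    using L assms(2) unfolding smooth_on_def
    by (intro k_times_mult k_times_add k_times_exp k_times_const assms(1)) auto
  then show ?thesis
    unfolding smooth_on_def chart_curv_def[abs_def] laplacian_def by simp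
qed

lemma smooth_on_holomorphic:
  assumes "open S" "f holomorphic_on S"
  shows "smooth_on S f"
  unfolding smooth_on_def
proof
  fix k
  show "k_times_differentiable_on k S f"
    using assms(2)
  proof (induction k arbitrary: f)
    case 0
    then show ?case by (simp add: holomorphic_on_imp_continuous_on)
  next
    case (Suc k)
    have d: "(f has_derivative (\<lambda>v. deriv f x * v)) (at x)" if "x \<in> S" for x
      using holomorphic_derivI[OF Suc.prems assms(1) that] by (simp add: has_field_derivative_def)
    have "k_times_differentiable_on k S (\<lambda>x. frechet_derivative f (at x) v)" for v
      by (rule k_times_cong[OF assms(1), of "\<lambda>x. deriv f x * v"])
         (auto simp: frechet_derivative_eq[OF d] intro!: Suc.IH holomorphic_intros holomorphic_deriv Suc.prems assms(1))
    then show ?case using differentiableI[OF d] by simp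
  qed
qed

lemma linear_complex_expand:
  fixes D :: "complex \<Rightarrow> 'b::real_vector"
  assumes "linear D"
  shows "D v = Re v *\<^sub>R D 1 + Im v *\<^sub>R D \<i>"
proof -
  have "v = Re v *\<^sub>R 1 + Im v *\<^sub>R \<i>" by (simp add: complex_eq_iff)
  then have "D v = D (Re v *\<^sub>R 1 + Im v *\<^sub>R \<i>)" by simp
  then show ?thesis using assms by (simp only: linear_add linear_scale)
qed

lemma smooth_expand:
  fixes u :: "complex \<Rightarrow> real"
  assumes "smooth_on S u" "z \<in> S"
  shows "(u has_derivative (\<lambda>v. Re v * frechet_derivative u (at z) 1 + Im v * frechet_derivative u (at z) \<i>)) (at z)"
proof -
  note d = smooth_on_has_derivative[OF assms]
  have "frechet_derivative u (at z) v = Re v * frechet_derivative u (at z) 1 + Im v * frechet_derivative u (at z) \<i>" for v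
    using linear_complex_expand[OF has_derivative_linear[OF d], of v] by (simp only: real_scaleR_def)
  then show ?thesis by (intro has_derivative_eq_rhs[OF d] ext)
qed

text \<open>The second difference of u over a small square is expressed in two ways by applying the
  mean value theorem twice, once for each order of differentiation; continuity then identifies the
  limits.\<close>

lemma mixed_partials_symmetric:
  fixes u :: "complex \<Rightarrow> real"
  assumes S: "open S" and u: "smooth_on S u" and z: "z \<in> S"
  shows "frechet_derivative (\<lambda>w. frechet_derivative u (at w) 1) (at z) \<i> =
         frechet_derivative (\<lambda>w. frechet_derivative u (at w) \<i>) (at z) 1"
proof -
  define X where "X = (\<lambda>w. frechet_derivative u (at w) 1)"
  define Y where "Y = (\<lambda>w. frechet_derivative u (at w) \<i>)"
  define A where "A = (\<lambda>w. frechet_derivative X (at w) \<i>)"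
  define B where "B = (\<lambda>w. frechet_derivative Y (at w) 1)"
  have sm: "smooth_on S X" "smooth_on S Y" unfolding X_def Y_def by (intro smooth_on_derivative u)+
  have cont: "continuous_on S A" "continuous_on S B"
    unfolding A_def B_def by (intro smooth_on_continuous smooth_on_derivative sm)+
  define e where "e = (\<lambda>s t. z + of_real s + \<i> * of_real t)"
  obtain \<rho> where \<rho>: "\<rho> > 0" "ball z \<rho> \<subseteq> S" using S z open_contains_ball by blast
  have inS: "e s t \<in> S" if "0 \<le> s" "s \<le> h" "0 \<le> t" "t \<le> h" "h < \<rho> / 2" for s t h
  proof -
    have "norm (of_real s + \<i> * of_real t) \<le> s + t"
      using norm_triangle_ineq[of "of_real s" "\<i> * of_real t"] that by (simp add: norm_mult)
    also have "\<dots> < \<rho>" using that by linarith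
    finally have "norm (of_real s + \<i> * of_real t) < \<rho>" .
    moreover have "dist z (z + w) = norm w" for w by (simp add: dist_norm)
    ultimately have "dist z (z + (of_real s + \<i> * of_real t)) < \<rho>" by (simp only:)
    then have "e s t \<in> ball z \<rho>" by (simp only: e_def add.assoc mem_ball)
    then show ?thesis using \<rho>(2) by blast
  qed
  have ds: "((\<lambda>s. w (e s t)) has_real_derivative frechet_derivative w (at (e s t)) 1) (at s)"
    if "smooth_on S w" "e s t \<in> S" for w :: "complex \<Rightarrow> real" and s t
  proof -
    have "((\<lambda>s. e s t) has_derivative of_real) (at s)" unfolding e_def by (auto intro!: derivative_eq_intros)
    from has_derivative_compose[OF this smooth_expand[OF that]] show ?thesis
      by (simp add: has_field_derivative_def mult.commute[of _ "frechet_derivative _ _ _"])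
  qed
  have dt: "((\<lambda>t. w (e s t)) has_real_derivative frechet_derivative w (at (e s t)) \<i>) (at t)"
    if "smooth_on S w" "e s t \<in> S" for w :: "complex \<Rightarrow> real" and s t
  proof -
    have "((\<lambda>t. e s t) has_derivative (\<lambda>x. \<i> * of_real x)) (at t)" unfolding e_def by (auto intro!: derivative_eq_intros)
    from has_derivative_compose[OF this smooth_expand[OF that]] show ?thesis
      by (simp add: has_field_derivative_def mult.commute[of _ "frechet_derivative _ _ _"])
  qed
  \<comment> \<open>The second difference over the square of side h equals h^2 A(p) and also h^2
    B(p'), for two points of the square.\<close>
  have ex: "\<exists>p p'. dist p z \<le> 2 * h \<and> dist p' z \<le> 2 * h \<and> p \<in> S \<and> p' \<in> S \<and> A p = B p'" if h: "0 < h" "h < \<rho> / 2" for h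
  proof -
    have "\<exists>s. 0 < s \<and> s < h \<and> (u (e h h) - u (e h 0)) - (u (e 0 h) - u (e 0 0)) = (h - 0) * (X (e s h) - X (e s 0))"
      by (rule MVT2[where f="\<lambda>s. u (e s h) - u (e s 0)"]) (use h in \<open>auto simp: X_def intro!: derivative_intros ds u inS[of _ h]\<close>)
    then obtain s where s: "0 < s" "s < h" "(u (e h h) - u (e h 0)) - (u (e 0 h) - u (e 0 0)) = h * (X (e s h) - X (e s 0))" by auto
    have "\<exists>t. 0 < t \<and> t < h \<and> X (e s h) - X (e s 0) = (h - 0) * A (e s t)"
      by (rule MVT2[where f="\<lambda>t. X (e s t)"]) (use h s in \<open>auto simp: A_def intro!: dt sm inS[of _ h]\<close>)
    then obtain t where t: "0 < t" "t < h" "X (e s h) - X (e s 0) = h * A (e s t)" by auto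
    have "\<exists>t. 0 < t \<and> t < h \<and> (u (e h h) - u (e 0 h)) - (u (e h 0) - u (e 0 0)) = (h - 0) * (Y (e h t) - Y (e 0 t))"
      by (rule MVT2[where f="\<lambda>t. u (e h t) - u (e 0 t)"]) (use h in \<open>auto simp: Y_def intro!: derivative_intros dt u inS[of _ h]\<close>)
    then obtain t' where t': "0 < t'" "t' < h" "(u (e h h) - u (e 0 h)) - (u (e h 0) - u (e 0 0)) = h * (Y (e h t') - Y (e 0 t'))" by auto
    have "\<exists>s. 0 < s \<and> s < h \<and> Y (e h t') - Y (e 0 t') = (h - 0) * B (e s t')"
      by (rule MVT2[where f="\<lambda>s. Y (e s t')"]) (use h t' in \<open>auto simp: B_def intro!: ds sm inS[of _ h]\<close>)
    then obtain s' where s': "0 < s'" "s' < h" "Y (e h t') - Y (e 0 t') = h * B (e s' t')" by auto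
    have "h * (h * A (e s t)) = h * (h * B (e s' t'))" using s(3) t'(3) unfolding t(3) s'(3) by linarith
    then have "A (e s t) = B (e s' t')" using h by simp
    moreover have "dist (e x y) z \<le> 2 * h" if "0 < x" "x < h" "0 < y" "y < h" for x y
      using norm_triangle_ineq[of "of_real x" "\<i> * of_real y"] that by (simp add: e_def dist_norm norm_mult add.assoc)
    ultimately show ?thesis
      using s(1,2) t(1,2) s'(1,2) t'(1,2) h
      by (intro exI[of _ "e s t"] exI[of _ "e s' t'"] conjI inS[of _ h]) auto
  qed
  have "A z = B z"
  proof (rule ccontr)
    assume ne: "A z \<noteq> B z"
    define \<epsilon> where "\<epsilon> = \<bar>A z - B z\<bar> / 2"
    have "\<epsilon> > 0" using ne by (simp add: \<epsilon>_def)
    obtain d1 where d1: "d1 > 0" "\<And>w. w \<in> S \<Longrightarrow> dist w z < d1 \<Longrightarrow> dist (A w) (A z) < \<epsilon>"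
      using cont(1) z \<open>\<epsilon> > 0\<close> unfolding continuous_on_iff by blast
    obtain d2 where d2: "d2 > 0" "\<And>w. w \<in> S \<Longrightarrow> dist w z < d2 \<Longrightarrow> dist (B w) (B z) < \<epsilon>"
      using cont(2) z \<open>\<epsilon> > 0\<close> unfolding continuous_on_iff by blast
    \<comment> \<open>The quarter keeps the square inside the ball about z and both points within
      the continuity radii \<open>d1\<close> and \<open>d2\<close>.\<close>
    define h where "h = min \<rho> (min d1 d2) / 4"
    have h: "0 < h" "h < \<rho> / 2" "2 * h < d1" "2 * h < d2" using \<rho>(1) d1(1) d2(1) by (auto simp: h_def)
    obtain p p' where p: "dist p z \<le> 2 * h" "dist p' z \<le> 2 * h" "p \<in> S" "p' \<in> S" "A p = B p'"
      using ex[OF h(1,2)] by blast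
    have "dist (A p) (A z) < \<epsilon>" "dist (B p') (B z) < \<epsilon>" using d1(2)[of p] d2(2)[of p'] p h by auto
    then have "\<bar>A z - B z\<bar> < 2 * \<epsilon>" using p(5) by (simp add: dist_real_def abs_if split: if_splits)
    then show False by (simp add: \<epsilon>_def)
  qed
  then show ?thesis by (simp add: A_def B_def X_def Y_def)
qed

text \<open>As in the plane potentials above, q is twice the Wirtinger derivative of u and s half of its Laplacian.\<close>

definition potential_on :: "complex set \<Rightarrow> (complex \<Rightarrow> real) \<Rightarrow> (complex \<Rightarrow> complex) \<Rightarrow> (complex \<Rightarrow> complex) \<Rightarrow> (complex \<Rightarrow> real) \<Rightarrow> bool" where
  "potential_on V u q p s \<longleftrightarrow> continuous_on V p \<and> (\<forall>z\<in>V. (u has_derivative (\<lambda>v. Re (q z * v))) (at z) \<and>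
     (q has_derivative (\<lambda>v. p z * v + of_real (s z) * cnj v)) (at z))"

lemma laplacian_potential:
  assumes V: "open V" and pot: "potential_on V u q p s" and z: "z \<in> V"
  shows "laplacian u z = 2 * s z"
proof -
  have du: "frechet_derivative u (at w) v = Re (q w * v)" if "w \<in> V" for w v
    using pot that frechet_derivative_eq[of u "\<lambda>v. Re (q w * v)" w] by (simp add: potential_on_def)
  have dq: "(q has_derivative (\<lambda>v. p z * v + of_real (s z) * cnj v)) (at z)"
    using pot z by (simp add: potential_on_def)
  have 1: "frechet_derivative (\<lambda>w. frechet_derivative u (at w) v) (at z) h = Re ((p z * h + of_real (s z) * cnj h) * v)" for v h
  proof -
    have "frechet_derivative (\<lambda>w. frechet_derivative u (at w) v) (at z) = frechet_derivative (\<lambda>w. Re (q w * v)) (at z)"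
      by (rule frechet_derivative_cong_open[OF V z]) (rule du)
    also have "\<dots> = (\<lambda>h. Re ((p z * h + of_real (s z) * cnj h) * v))"
      by (rule frechet_derivative_eq) (intro has_derivative_Re has_derivative_mult_left dq)
    finally show ?thesis by simp
  qed
  show ?thesis unfolding laplacian_def 1 by simp
qed

text \<open>Symmetry of the mixed partials makes the coefficient of cnj v in the derivative of q
  real, namely half the Laplacian.\<close>

lemma smooth_potential:
  assumes S: "open S" and u: "smooth_on S u"
  shows "\<exists>q p. potential_on S u q p (\<lambda>z. laplacian u z / 2)"
proof -
  define X where "X = (\<lambda>w. frechet_derivative u (at w) 1)"
  define Y where "Y = (\<lambda>w. frechet_derivative u (at w) \<i>)"
  define XX where "XX = (\<lambda>w. frechet_derivative X (at w) 1)"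
  define XY where "XY = (\<lambda>w. frechet_derivative X (at w) \<i>)"
  define YX where "YX = (\<lambda>w. frechet_derivative Y (at w) 1)"
  define YY where "YY = (\<lambda>w. frechet_derivative Y (at w) \<i>)"
  have sm: "smooth_on S X" "smooth_on S Y" unfolding X_def Y_def by (intro smooth_on_derivative u)+
  have cont: "continuous_on S XX" "continuous_on S XY" "continuous_on S YX" "continuous_on S YY"
    unfolding XX_def XY_def YX_def YY_def by (intro smooth_on_continuous smooth_on_derivative sm)+
  define q where "q = (\<lambda>z. complex_of_real (X z) - \<i> * complex_of_real (Y z))"
  define p where "p = (\<lambda>z. complex_of_real ((XX z - YY z) / 2) - \<i> * complex_of_real (XY z))"
  have "potential_on S u q p (\<lambda>z. laplacian u z / 2)"
    unfolding potential_on_def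
  proof (intro conjI ballI)
    show "continuous_on S p" unfolding p_def by (intro continuous_intros cont) auto
    fix z assume z: "z \<in> S"
    show "(u has_derivative (\<lambda>v. Re (q z * v))) (at z)"
      using smooth_expand[OF u z] by (rule has_derivative_eq_rhs) (simp add: q_def X_def Y_def fun_eq_iff algebra_simps)
    have sym: "XY z = YX z" using mixed_partials_symmetric[OF S u z] by (simp add: XY_def YX_def X_def Y_def)
    have L: "laplacian u z = XX z + YY z" by (simp add: laplacian_def XX_def YY_def X_def Y_def)
    have "(q has_derivative (\<lambda>v. of_real (Re v * XX z + Im v * XY z) - \<i> * of_real (Re v * YX z + Im v * YY z))) (at z)"
      unfolding q_def using smooth_expand[OF sm(1) z] smooth_expand[OF sm(2) z] unfolding XX_def XY_def YX_def YY_def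
      by (intro has_derivative_diff has_derivative_mult_right has_derivative_of_real)
    then show "(q has_derivative (\<lambda>v. p z * v + of_real (laplacian u z / 2) * cnj v)) (at z)"
      by (rule has_derivative_eq_rhs) (auto simp: fun_eq_iff complex_eq_iff p_def L sym field_simps)
  qed
  then show ?thesis by blast
qed

lemma ln_norm_has_derivative:
  assumes g: "(g has_derivative (\<lambda>v. D * v)) (at z)" and g0: "g z \<noteq> (0::complex)"
  shows "((\<lambda>z. ln (norm (g z))) has_derivative (\<lambda>v. Re (D * v / g z))) (at z)"
proof -
  define N where "N = (\<lambda>z. Re (g z * cnj (g z)))"
  have Nn: "N z = (norm (g z))\<^sup>2" for z unfolding N_def cmod_power2 by (simp add: power2_eq_square)
  have N0: "N z > 0" using g0 by (simp add: Nn)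
  have lnN: "ln (norm (g z)) = ln (N z) / 2" for z by (simp add: Nn ln_realpow)
  have "(N has_derivative (\<lambda>v. Re (g z * cnj (D * v) + D * v * cnj (g z)))) (at z)"
    unfolding N_def by (intro has_derivative_Re has_derivative_mult has_derivative_cnj g)
  from has_derivative_compose[OF this DERIV_ln[OF N0, unfolded has_field_derivative_def]]
  have "((\<lambda>z. ln (N z)) has_derivative (\<lambda>v. inverse (N z) * Re (g z * cnj (D * v) + D * v * cnj (g z)))) (at z)" .
  from has_derivative_mult_left[OF this, of "1/2"]
  have "((\<lambda>z. ln (N z) / 2) has_derivative (\<lambda>v. inverse (N z) * Re (g z * cnj (D * v) + D * v * cnj (g z)) / 2)) (at z)" by simp
  moreover have "inverse (N z) * Re (g z * cnj (D * v) + D * v * cnj (g z)) / 2 = Re (D * v / g z)" for v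
  proof -
    define X where "X = Re (D * v * cnj (g z))"
    have A: "Re (D * v / g z) = Re (D * v * cnj (g z)) / N z"
      unfolding Nn by (simp add: complex_div_cnj[of "D * v" "g z"])
    have B: "Re (g z * cnj (D * v)) = X" by (simp add: X_def algebra_simps)
    show ?thesis unfolding A plus_complex.sel B X_def[symmetric] using N0 by (simp add: field_simps)
  qed
  ultimately show ?thesis unfolding lnN by (rule has_derivative_eq_rhs[OF _ ext])
qed

text \<open>The added term ln |h'| is harmonic with complex derivative h''/h', so it enters q and p
  but not s, which only picks up the conformal factor |h'|^2.\<close>

lemma potential_pullback:
  assumes V: "open V" and h: "h holomorphic_on V" and hU: "\<And>z. z \<in> V \<Longrightarrow> h z \<in> U" and h0: "\<And>z. z \<in> V \<Longrightarrow> deriv h z \<noteq> 0"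
    and pot: "potential_on U u q p s"
  shows "potential_on V (\<lambda>z. u (h z) + ln (norm (deriv h z)))
     (\<lambda>z. q (h z) * deriv h z + deriv (deriv h) z / deriv h z)
     (\<lambda>z. p (h z) * (deriv h z)\<^sup>2 + q (h z) * deriv (deriv h) z + deriv (\<lambda>z. deriv (deriv h) z / deriv h z) z)
     (\<lambda>z. s (h z) * (norm (deriv h z))\<^sup>2)"
  unfolding potential_on_def
proof (intro conjI ballI)
  have h': "deriv h holomorphic_on V" and h'': "deriv (deriv h) holomorphic_on V"
    by (intro holomorphic_deriv h V)+
  have l: "(\<lambda>z. deriv (deriv h) z / deriv h z) holomorphic_on V"
    by (intro holomorphic_intros h' h'' h0)
  have cq: "continuous_on U q" and cp: "continuous_on U p"
    using pot by (auto simp: potential_on_def intro!: continuous_at_imp_continuous_on has_derivative_continuous)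
  show "continuous_on V (\<lambda>z. p (h z) * (deriv h z)\<^sup>2 + q (h z) * deriv (deriv h) z + deriv (\<lambda>z. deriv (deriv h) z / deriv h z) z)"
    using hU by (intro continuous_intros continuous_on_compose2[OF cp] continuous_on_compose2[OF cq]
        holomorphic_on_imp_continuous_on h h' h'' holomorphic_deriv[OF l V]) auto
  fix z assume z: "z \<in> V"
  have dh: "(h has_derivative (\<lambda>v. deriv h z * v)) (at z)"
    using holomorphic_derivI[OF h V z] by (simp add: has_field_derivative_def)
  have dh': "(deriv h has_derivative (\<lambda>v. deriv (deriv h) z * v)) (at z)"
    using holomorphic_derivI[OF h' V z] by (simp add: has_field_derivative_def)
  have dl: "((\<lambda>z. deriv (deriv h) z / deriv h z) has_derivative (\<lambda>v. deriv (\<lambda>z. deriv (deriv h) z / deriv h z) z * v)) (at z)"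
    using holomorphic_derivI[OF l V z] by (simp add: has_field_derivative_def)
  have du: "(u has_derivative (\<lambda>v. Re (q (h z) * v))) (at (h z))"
    and dq: "(q has_derivative (\<lambda>v. p (h z) * v + of_real (s (h z)) * cnj v)) (at (h z))"
    using pot hU[OF z] by (auto simp: potential_on_def)
  have hz: "deriv h z \<noteq> 0" by (rule h0[OF z])
  have 1: "((\<lambda>z. u (h z)) has_derivative (\<lambda>v. Re (q (h z) * (deriv h z * v)))) (at z)"
    by (rule has_derivative_compose[OF dh du])
  have 2: "((\<lambda>z. ln (norm (deriv h z))) has_derivative (\<lambda>v. Re (deriv (deriv h) z / deriv h z * v))) (at z)"
    using ln_norm_has_derivative[OF dh' hz] by (simp only: times_divide_eq_left)
  show "((\<lambda>z. u (h z) + ln (norm (deriv h z))) has_derivative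
       (\<lambda>v. Re ((q (h z) * deriv h z + deriv (deriv h) z / deriv h z) * v))) (at z)"
    by (rule has_derivative_eq_rhs, rule has_derivative_add[OF 1 2]) (simp add: fun_eq_iff algebra_simps)
  have 3: "((\<lambda>z. q (h z)) has_derivative (\<lambda>v. p (h z) * (deriv h z * v) + of_real (s (h z)) * cnj (deriv h z * v))) (at z)"
    by (rule has_derivative_compose[OF dh dq])
  show "((\<lambda>z. q (h z) * deriv h z + deriv (deriv h) z / deriv h z) has_derivative
      (\<lambda>v. (p (h z) * (deriv h z)\<^sup>2 + q (h z) * deriv (deriv h) z + deriv (\<lambda>z. deriv (deriv h) z / deriv h z) z) * v +
           of_real (s (h z) * (norm (deriv h z))\<^sup>2) * cnj v)) (at z)"
  proof (rule has_derivative_eq_rhs, rule has_derivative_add[OF has_derivative_mult[OF 3 dh'] dl])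
    have "of_real (s (h z) * (norm (deriv h z))\<^sup>2) = of_real (s (h z)) * (deriv h z * cnj (deriv h z))"
      unfolding of_real_mult complex_norm_square ..
    then show "(\<lambda>v. q (h z) * (deriv (deriv h) z * v) + (p (h z) * (deriv h z * v) + of_real (s (h z)) * cnj (deriv h z * v)) * deriv h z +
          deriv (\<lambda>z. deriv (deriv h) z / deriv h z) z * v) =
       (\<lambda>v. (p (h z) * (deriv h z)\<^sup>2 + q (h z) * deriv (deriv h) z + deriv (\<lambda>z. deriv (deriv h) z / deriv h z) z) * v +
           of_real (s (h z) * (norm (deriv h z))\<^sup>2) * cnj v)"
      by (simp only:) (simp add: fun_eq_iff algebra_simps power2_eq_square)
  qed
qed

text \<open>The Laplacian is multiplied by |h'|^2 and exp(-2 w) by its inverse.\<close>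

lemma chart_curv_pullback:
  assumes V: "open V" and h: "h holomorphic_on V" and U: "open U" and hU: "\<And>z. z \<in> V \<Longrightarrow> h z \<in> U" and h0: "\<And>z. z \<in> V \<Longrightarrow> deriv h z \<noteq> 0"
    and u: "smooth_on U u" and w: "\<And>z. z \<in> V \<Longrightarrow> w z = u (h z) + ln (norm (deriv h z))" and z: "z \<in> V"
  shows "chart_curv w z = chart_curv u (h z)"
proof -
  obtain q p where pot: "potential_on U u q p (\<lambda>z. laplacian u z / 2)" using smooth_potential[OF U u] by blast
  note P = potential_pullback[OF V h hU h0 pot]
  have "laplacian w z = laplacian (\<lambda>z. u (h z) + ln (norm (deriv h z))) z"
  proof -
    have "frechet_derivative w (at x) = frechet_derivative (\<lambda>z. u (h z) + ln (norm (deriv h z))) (at x)" if "x \<in> V" for x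
      by (rule frechet_derivative_cong_open[OF V that w])
    then have "frechet_derivative (\<lambda>x. frechet_derivative w (at x) v) (at z) =
       frechet_derivative (\<lambda>x. frechet_derivative (\<lambda>z. u (h z) + ln (norm (deriv h z))) (at x) v) (at z)" for v
      by (intro frechet_derivative_cong_open[OF V z]) simp
    then show ?thesis by (simp add: laplacian_def)
  qed
  also have "\<dots> = laplacian u (h z) * (norm (deriv h z))\<^sup>2"
    using laplacian_potential[OF V P z] by simp
  finally show ?thesis
    using h0[OF z] by (simp add: chart_curv_def w[OF z] distrib_left exp_diff exp_double)
qed

section \<open>The HCMU equation in a coordinate\<close>

text \<open>The local assumptions of \<open>hcmu_plane\<close>, restricted to V.\<close>

definition hcmu_on :: "complex set \<Rightarrow> (complex \<Rightarrow> real) \<Rightarrow> (complex \<Rightarrow> real) \<Rightarrow>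
    (complex \<Rightarrow> complex) \<Rightarrow> (complex \<Rightarrow> complex) \<Rightarrow> (complex \<Rightarrow> complex) \<Rightarrow> (complex \<Rightarrow> complex) \<Rightarrow> bool" where
  "hcmu_on V \<phi> K f f' q p \<longleftrightarrow> potential_on V \<phi> q p (\<lambda>z. - (K z * exp (2 * \<phi> z) / 2)) \<and>
     (\<forall>z\<in>V. (f has_field_derivative f' z) (at z) \<and>
            (K has_derivative (\<lambda>v. 2 * exp (2 * \<phi> z) * Re (cnj (f z) * v))) (at z) \<and>
            Im (q z * f z + f' z) = 0)"

lemma Re_of_real_mult: "Re (of_real x * w) = x * Re w"
  by simp

lemma wirtinger_real_potential:
  assumes "(u has_derivative (\<lambda>v. Re (q * v))) (at z)"
  shows "wirtinger (\<lambda>z. complex_of_real (u z)) z = q / 2"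
proof -
  have "frechet_derivative (\<lambda>z. complex_of_real (u z)) (at z) = (\<lambda>v. complex_of_real (Re (q * v)))"
    by (intro frechet_derivative_eq has_derivative_of_real assms)
  then show ?thesis by (simp add: wirtinger_def complex_eq_iff)
qed

text \<open>With q = 2 phi_z and r = 2 K_z the HCMU equation reads t = q r. Precisely then the cnj v
  terms cancel in the derivative of f, so f is holomorphic. Moreover q f + f' equals exp(-2 phi) s/2
  with s real, which gives the last condition of \<open>hcmu_on\<close>.\<close>

lemma chart_hcmu_on:
  assumes U: "open U" and sm: "smooth_on U \<phi>" and K: "\<And>z. z \<in> U \<Longrightarrow> K z = chart_curv \<phi> z"
    and eq: "\<And>z. z \<in> U \<Longrightarrow> wirtinger (wirtinger (\<lambda>z. complex_of_real (K z))) z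
        - 2 * wirtinger (\<lambda>z. complex_of_real (\<phi> z)) z * wirtinger (\<lambda>z. complex_of_real (K z)) z = 0"
  shows "\<exists>f f' q p. hcmu_on U \<phi> K f f' q p"
proof -
  obtain q p where \<phi>: "potential_on U \<phi> q p (\<lambda>z. laplacian \<phi> z / 2)" using smooth_potential[OF U sm] by blast
  have "smooth_on U K"
    using smooth_on_chart_curv[OF U sm] k_times_cong[OF U, of "chart_curv \<phi>" K] K by (auto simp: smooth_on_def)
  then obtain r t where Kp: "potential_on U K r t (\<lambda>z. laplacian K z / 2)" using smooth_potential[OF U] by blast
  define s where "s = (\<lambda>z. laplacian K z / 2)"
  have L: "laplacian \<phi> z / 2 = - (K z * exp (2 * \<phi> z) / 2)" if "z \<in> U" for z
    by (simp add: K[OF that] chart_curv_def exp_minus)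
  have d\<phi>: "(\<phi> has_derivative (\<lambda>v. Re (q z * v))) (at z)" if "z \<in> U" for z
    using \<phi> that by (simp add: potential_on_def)
  have dK: "(K has_derivative (\<lambda>v. Re (r z * v))) (at z)" if "z \<in> U" for z
    using Kp that by (simp add: potential_on_def)
  have dr: "(r has_derivative (\<lambda>v. t z * v + of_real (s z) * cnj v)) (at z)" if "z \<in> U" for z
    using Kp that by (simp add: potential_on_def s_def)
  have t: "t z = q z * r z" if z: "z \<in> U" for z
  proof -
    have "frechet_derivative (wirtinger (\<lambda>z. complex_of_real (K z))) (at z) = frechet_derivative (\<lambda>z. r z / 2) (at z)"
      by (rule frechet_derivative_cong_open[OF U z]) (rule wirtinger_real_potential[OF dK])
    also have "\<dots> = (\<lambda>v. (t z * v + of_real (s z) * cnj v) / 2)"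
      using has_derivative_mult_left[OF dr[OF z], of "1/2"] by (intro frechet_derivative_eq) simp
    finally have "wirtinger (wirtinger (\<lambda>z. complex_of_real (K z))) z = t z / 2"
      by (simp add: wirtinger_def[of "wirtinger _"] field_simps)
    then show ?thesis
      using eq[OF z] wirtinger_real_potential[OF dK[OF z]] wirtinger_real_potential[OF d\<phi>[OF z]] by simp
  qed
  define f where "f = (\<lambda>z. of_real (exp (- 2 * \<phi> z) / 2) * cnj (r z))"
  define f' where "f' = (\<lambda>z. of_real (exp (- 2 * \<phi> z) / 2) * (of_real (s z) - q z * cnj (r z)))"
  have "hcmu_on U \<phi> K f f' q p"
    unfolding hcmu_on_def
  proof (intro conjI ballI)
    show "potential_on U \<phi> q p (\<lambda>z. - (K z * exp (2 * \<phi> z) / 2))"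
      using \<phi> L by (simp add: potential_on_def)
    fix z assume z: "z \<in> U"
    have de: "((\<lambda>z. exp (- 2 * \<phi> z) / 2) has_derivative (\<lambda>v. - exp (- 2 * \<phi> z) * Re (q z * v))) (at z)"
      by (auto intro!: derivative_eq_intros d\<phi>[OF z] simp: fun_eq_iff field_simps)
    show "(f has_field_derivative f' z) (at z)"
      unfolding has_field_derivative_def
    proof (rule has_derivative_eq_rhs)
      show "(f has_derivative (\<lambda>v. of_real (exp (- 2 * \<phi> z) / 2) * cnj (t z * v + of_real (s z) * cnj v) +
          of_real (- exp (- 2 * \<phi> z) * Re (q z * v)) * cnj (r z))) (at z)"
        unfolding f_def by (intro has_derivative_mult has_derivative_of_real de has_derivative_cnj dr z)
      show "(\<lambda>v. of_real (exp (- 2 * \<phi> z) / 2) * cnj (t z * v + of_real (s z) * cnj v) +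
          of_real (- exp (- 2 * \<phi> z) * Re (q z * v)) * cnj (r z)) = (*) (f' z)"
      proof
        fix v
        define e where "e = complex_of_real (exp (- 2 * \<phi> z) / 2)"
        have "complex_of_real (- exp (- 2 * \<phi> z) * Re (q z * v)) = - e * of_real (2 * Re (q z * v))"
          by (simp add: e_def)
        also have "\<dots> = - e * (q z * v + cnj (q z * v))" by (simp only: complex_add_cnj)
        finally have w: "complex_of_real (- exp (- 2 * \<phi> z) * Re (q z * v)) = - e * (q z * v + cnj (q z * v))" .
        show "of_real (exp (- 2 * \<phi> z) / 2) * cnj (t z * v + of_real (s z) * cnj v) +
          of_real (- exp (- 2 * \<phi> z) * Re (q z * v)) * cnj (r z) = f' z * v"
          unfolding w f'_def e_def[symmetric] t[OF z] by (simp add: algebra_simps)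
      qed
    qed
    show "(K has_derivative (\<lambda>v. 2 * exp (2 * \<phi> z) * Re (cnj (f z) * v))) (at z)"
    proof (rule has_derivative_eq_rhs[OF dK[OF z]], rule ext)
      fix v
      have "cnj (f z) * v = of_real (exp (- 2 * \<phi> z) / 2) * (r z * v)" by (simp add: f_def)
      then have "Re (cnj (f z) * v) = exp (- 2 * \<phi> z) / 2 * Re (r z * v)" by (simp only: Re_of_real_mult)
      moreover have "2 * exp (2 * \<phi> z) * (exp (- 2 * \<phi> z) / 2 * X) = X" for X by (simp add: exp_minus)
      ultimately show "Re (r z * v) = 2 * exp (2 * \<phi> z) * Re (cnj (f z) * v)" by (simp only:)
    qed
    have "q z * f z + f' z = of_real (exp (- 2 * \<phi> z) / 2) * of_real (s z)"
      unfolding f_def f'_def right_diff_distrib by (simp only: mult_ac) simp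
    then show "Im (q z * f z + f' z) = 0" by (simp only: of_real_mult[symmetric] Im_complex_of_real)
  qed
  then show ?thesis by blast
qed

text \<open>f transforms as a vector field, that is into f(h)/h'. The second derivatives of h cancel
  in q f + f', which is therefore a scalar and stays real.\<close>

lemma hcmu_on_pullback:
  assumes V: "open V" and h: "h holomorphic_on V" and hU: "\<And>z. z \<in> V \<Longrightarrow> h z \<in> U" and h0: "\<And>z. z \<in> V \<Longrightarrow> deriv h z \<noteq> 0"
    and H: "hcmu_on U \<phi> K f f' q p"
  shows "\<exists>f f' q p. hcmu_on V (\<lambda>z. \<phi> (h z) + ln (norm (deriv h z))) (\<lambda>z. K (h z)) f f' q p"
proof -
  let ?\<psi> = "\<lambda>z. \<phi> (h z) + ln (norm (deriv h z))"
  have h': "deriv h holomorphic_on V" by (intro holomorphic_deriv h V)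
  have pot: "potential_on U \<phi> q p (\<lambda>z. - (K z * exp (2 * \<phi> z) / 2))" using H by (simp add: hcmu_on_def)
  have e: "exp (2 * ?\<psi> z) = exp (2 * \<phi> (h z)) * (norm (deriv h z))\<^sup>2" if "z \<in> V" for z
    using h0[OF that] by (simp add: distrib_left exp_add exp_double)
  define g where "g = (\<lambda>z. f (h z) / deriv h z)"
  define g' where "g' = (\<lambda>z. f' (h z) - f (h z) * deriv (deriv h) z / (deriv h z)\<^sup>2)"
  define q' where "q' = (\<lambda>z. q (h z) * deriv h z + deriv (deriv h) z / deriv h z)"
  define p' where "p' = (\<lambda>z. p (h z) * (deriv h z)\<^sup>2 + q (h z) * deriv (deriv h) z + deriv (\<lambda>z. deriv (deriv h) z / deriv h z) z)"
  have "hcmu_on V ?\<psi> (\<lambda>z. K (h z)) g g' q' p'"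
    unfolding hcmu_on_def
  proof (intro conjI ballI)
    have "potential_on V ?\<psi> q' p' (\<lambda>z. - (K (h z) * exp (2 * \<phi> (h z)) / 2) * (norm (deriv h z))\<^sup>2)"
      unfolding q'_def p'_def by (rule potential_pullback[OF V h hU h0 pot])
    then show "potential_on V ?\<psi> q' p' (\<lambda>z. - (K (h z) * exp (2 * ?\<psi> z) / 2))"
      unfolding potential_on_def using e by (simp add: mult.assoc)
    fix z assume z: "z \<in> V"
    have dh: "(h has_field_derivative deriv h z) (at z)" by (rule holomorphic_derivI[OF h V z])
    have dh': "(deriv h has_field_derivative deriv (deriv h) z) (at z)" by (rule holomorphic_derivI[OF h' V z])
    note hz = h0[OF z]
    have fz: "(f has_field_derivative f' (h z)) (at (h z))"
      and Kz: "(K has_derivative (\<lambda>v. 2 * exp (2 * \<phi> (h z)) * Re (cnj (f (h z)) * v))) (at (h z))"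
      and rz: "Im (q (h z) * f (h z) + f' (h z)) = 0"
      using H hU[OF z] by (auto simp: hcmu_on_def)
    have "(g has_field_derivative (f' (h z) * deriv h z * deriv h z - f (h z) * deriv (deriv h) z) / (deriv h z * deriv h z)) (at z)"
      unfolding g_def by (rule DERIV_divide[OF DERIV_chain2[OF fz dh] dh' hz])
    then show "(g has_field_derivative g' z) (at z)"
      using hz by (simp add: g'_def diff_divide_distrib power2_eq_square)
    have "((\<lambda>z. K (h z)) has_derivative (\<lambda>v. 2 * exp (2 * \<phi> (h z)) * Re (cnj (f (h z)) * (deriv h z * v)))) (at z)"
      by (rule has_derivative_compose[OF dh[unfolded has_field_derivative_def] Kz])
    then show "((\<lambda>z. K (h z)) has_derivative (\<lambda>v. 2 * exp (2 * ?\<psi> z) * Re (cnj (g z) * v))) (at z)"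
    proof (rule has_derivative_eq_rhs, intro ext)
      fix v
      have "of_real ((norm (deriv h z))\<^sup>2) * (cnj (g z) * v) = cnj (f (h z)) * (deriv h z * v)"
        unfolding complex_norm_square g_def using hz by simp
      then have "(norm (deriv h z))\<^sup>2 * Re (cnj (g z) * v) = Re (cnj (f (h z)) * (deriv h z * v))"
        by (metis Re_of_real_mult)
      then show "2 * exp (2 * \<phi> (h z)) * Re (cnj (f (h z)) * (deriv h z * v)) = 2 * exp (2 * ?\<psi> z) * Re (cnj (g z) * v)"
        unfolding e[OF z] by (simp only: mult.assoc)
    qed
    have "q' z * g z + g' z = q (h z) * f (h z) + f' (h z)"
      using hz by (simp add: q'_def g_def g'_def field_simps power2_eq_square)
    then show "Im (q' z * g z + g' z) = 0" using rz by simp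
  qed
  then show ?thesis by blast
qed

definition phi_deriv :: "(complex \<Rightarrow> real) \<Rightarrow> complex \<Rightarrow> complex" where
  "phi_deriv \<phi> z = of_real (frechet_derivative \<phi> (at z) 1) - \<i> * of_real (frechet_derivative \<phi> (at z) \<i>)"

text \<open>This is exp(-2 phi) K_zbar; the half compensates for \<open>phi_deriv\<close> being
  twice the Wirtinger derivative.\<close>

definition hcmu_field :: "(complex \<Rightarrow> real) \<Rightarrow> (complex \<Rightarrow> real) \<Rightarrow> complex \<Rightarrow> complex" where
  "hcmu_field \<phi> K z = of_real (exp (- 2 * \<phi> z) / 2) * cnj (phi_deriv K z)"

lemma phi_deriv_eq:
  assumes "(u has_derivative (\<lambda>v. Re (q * v))) (at z)"
  shows "phi_deriv u z = q"
  unfolding phi_deriv_def frechet_derivative_eq[OF assms] by (simp add: complex_eq_iff)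

lemma has_derivative_eq_on_open:
  assumes "open V" "z \<in> V" "\<And>w. w \<in> V \<Longrightarrow> f w = g w" "(f has_derivative D) (at z)"
  shows "(g has_derivative D) (at z)"
  using has_derivative_transform_within_open[OF assms(4,1,2,3)] by simp

text \<open>f, f', q and p are determined on V by phi and K. Replacing the local witnesses by global
  formulas makes those on different open sets agree, so that local statements can be glued in
  \<open>hcmu_plane_of_local\<close>.\<close>

lemma hcmu_on_canonical:
  assumes V: "open V" and H: "hcmu_on V \<phi> K f f' q p"
  shows "hcmu_on V \<phi> K (hcmu_field \<phi> K) (deriv (hcmu_field \<phi> K)) (phi_deriv \<phi>) (wirtinger (phi_deriv \<phi>))"
proof -
  have d: "(\<phi> has_derivative (\<lambda>v. Re (q z * v))) (at z)"
    "(q has_derivative (\<lambda>v. p z * v + of_real (- (K z * exp (2 * \<phi> z) / 2)) * cnj v)) (at z)"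
    "(f has_field_derivative f' z) (at z)"
    "(K has_derivative (\<lambda>v. 2 * exp (2 * \<phi> z) * Re (cnj (f z) * v))) (at z)"
    "Im (q z * f z + f' z) = 0" if "z \<in> V" for z
    using H that by (auto simp: hcmu_on_def potential_on_def)
  have q: "q z = phi_deriv \<phi> z" if "z \<in> V" for z using phi_deriv_eq[OF d(1)[OF that]] by simp
  have f: "f z = hcmu_field \<phi> K z" if "z \<in> V" for z
  proof -
    have "(K has_derivative (\<lambda>v. Re (of_real (2 * exp (2 * \<phi> z)) * cnj (f z) * v))) (at z)"
      using d(4)[OF that] by (rule has_derivative_eq_rhs) (simp add: fun_eq_iff algebra_simps)
    from phi_deriv_eq[OF this] show ?thesis by (simp add: hcmu_field_def exp_minus)
  qed
  have dq: "(phi_deriv \<phi> has_derivative (\<lambda>v. p z * v + of_real (- (K z * exp (2 * \<phi> z) / 2)) * cnj v)) (at z)" if "z \<in> V" for z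
    by (rule has_derivative_eq_on_open[OF V that q d(2)[OF that]])
  have p: "p z = wirtinger (phi_deriv \<phi>) z" if "z \<in> V" for z
    unfolding wirtinger_def frechet_derivative_eq[OF dq[OF that]] by (simp add: algebra_simps)
  have df: "(hcmu_field \<phi> K has_field_derivative f' z) (at z)" if "z \<in> V" for z
    using has_derivative_eq_on_open[OF V that f] d(3)[OF that] by (simp add: has_field_derivative_def)
  have f': "f' z = deriv (hcmu_field \<phi> K) z" if "z \<in> V" for z
    using DERIV_imp_deriv[OF df[OF that]] by simp
  have "continuous_on V p" using H by (simp add: hcmu_on_def potential_on_def)
  then have "continuous_on V (wirtinger (phi_deriv \<phi>))" using p by (simp cong: continuous_on_cong)
  then show ?thesis
    unfolding hcmu_on_def potential_on_def
    using d(1) dq df d(4,5) q f p f' by auto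
qed

lemma hcmu_on_cong:
  assumes V: "open V" and eq: "\<And>z. z \<in> V \<Longrightarrow> \<phi> z = \<psi> z" "\<And>z. z \<in> V \<Longrightarrow> K z = L z" and H: "hcmu_on V \<phi> K f f' q p"
  shows "hcmu_on V \<psi> L f f' q p"
proof -
  have 1: "(\<psi> has_derivative (\<lambda>v. Re (q z * v))) (at z)" if "z \<in> V" for z
    by (rule has_derivative_eq_on_open[OF V that eq(1)]) (use H that in \<open>auto simp: hcmu_on_def potential_on_def\<close>)
  have 2: "(L has_derivative (\<lambda>v. 2 * exp (2 * \<psi> z) * Re (cnj (f z) * v))) (at z)" if "z \<in> V" for z
    by (rule has_derivative_eq_on_open[OF V that eq(2)])
       (use H that eq(1)[OF that] in \<open>auto simp: hcmu_on_def potential_on_def\<close>)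
  show ?thesis
    using H 1 2 eq unfolding hcmu_on_def potential_on_def by simp
qed

lemma hcmu_plane_of_local:
  assumes loc: "\<And>z. \<exists>V f f' q p. open V \<and> z \<in> V \<and> hcmu_on V \<phi> K f f' q p"
    and area: "integrable lborel (\<lambda>z. exp (2 * \<phi> z))" and nc: "\<exists>z w. K z \<noteq> K w"
  shows "hcmu_plane \<phi> K (hcmu_field \<phi> K) (deriv (hcmu_field \<phi> K)) (phi_deriv \<phi>) (wirtinger (phi_deriv \<phi>))"
proof -
  have loc': "\<exists>V. open V \<and> z \<in> V \<and> hcmu_on V \<phi> K (hcmu_field \<phi> K) (deriv (hcmu_field \<phi> K)) (phi_deriv \<phi>) (wirtinger (phi_deriv \<phi>))" for z
  proof -
    obtain V f f' q p where V: "open V" "z \<in> V" "hcmu_on V \<phi> K f f' q p" using loc[of z] by metis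
    show ?thesis using V(1,2) hcmu_on_canonical[OF V(1,3)] by (intro exI conjI)
  qed
  let ?f = "hcmu_field \<phi> K" and ?q = "phi_deriv \<phi>" and ?p = "wirtinger (phi_deriv \<phi>)"
  have pt: "(?f has_field_derivative deriv ?f z) (at z)" "(\<phi> has_derivative (\<lambda>v. Re (?q z * v))) (at z)"
    "(?q has_derivative (\<lambda>v. ?p z * v + of_real (- (K z * exp (2 * \<phi> z) / 2)) * cnj v)) (at z)"
    "(K has_derivative (\<lambda>v. 2 * exp (2 * \<phi> z) * Re (cnj (?f z) * v))) (at z)"
    "Im (?q z * ?f z + deriv ?f z) = 0" "isCont ?p z" for z
  proof -
    obtain V where V: "open V" "z \<in> V" "hcmu_on V \<phi> K ?f (deriv ?f) ?q ?p" using loc'[of z] by blast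
    note H = V(3)[unfolded hcmu_on_def potential_on_def]
    show "isCont ?p z" using conjunct1[OF conjunct1[OF H]] V(1,2) continuous_on_eq_continuous_at by blast
    show "(\<phi> has_derivative (\<lambda>v. Re (?q z * v))) (at z)"
      "(?q has_derivative (\<lambda>v. ?p z * v + of_real (- (K z * exp (2 * \<phi> z) / 2)) * cnj v)) (at z)"
      using bspec[OF conjunct2[OF conjunct1[OF H]] V(2)] by blast+
    show "(?f has_field_derivative deriv ?f z) (at z)"
      "(K has_derivative (\<lambda>v. 2 * exp (2 * \<phi> z) * Re (cnj (?f z) * v))) (at z)"
      "Im (?q z * ?f z + deriv ?f z) = 0"
      using bspec[OF conjunct2[OF H] V(2)] by blast+
  qed
  have "continuous_on UNIV ?p" by (rule continuous_at_imp_continuous_on, rule ballI, rule pt(6))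
  then show ?thesis by (intro hcmu_plane.intro pt area nc)
qed

section \<open>Moebius maps of the sphere\<close>

text \<open>The point with homogeneous coordinates u and v. With \<open>hnum\<close> and
  \<open>hden\<close> both charts are treated alike, and a Moebius map acts linearly on pairs. The
  pair of zeros denotes no point and falls to \<open>None\<close> by default, whence the side
  conditions that follow.\<close>

definition hproj :: "complex \<Rightarrow> complex \<Rightarrow> sphere" where
  "hproj u v = (if v = 0 then None else Some (u / v))"

fun hnum :: "chart \<Rightarrow> complex \<Rightarrow> complex" where
  "hnum Std z = z" | "hnum Inf z = 1"

fun hden :: "chart \<Rightarrow> complex \<Rightarrow> complex" where
  "hden Std z = 1" | "hden Inf z = z"

lemma param_hproj: "param k z = hproj (hnum k z) (hden k z)"
  by (cases k) (auto simp: hproj_def)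

lemma hcoord_nonzero: "hnum k z \<noteq> 0 \<or> hden k z \<noteq> 0"
  by (cases k) auto

lemma range_param_Std: "s \<in> range (param Std) \<longleftrightarrow> s \<noteq> None"
  by (cases s) auto

lemma range_param_Inf: "s \<in> range (param Inf) \<longleftrightarrow> s \<noteq> Some 0"
proof (cases s)
  case None
  then have "s = param Inf 0" by simp
  then show ?thesis using None by blast
next
  case (Some z)
  show ?thesis
  proof (cases "z = 0")
    case True
    then show ?thesis using Some by (auto split: if_splits)
  next
    case False
    then have "s = param Inf (1 / z)" using Some by simp
    then have "s \<in> range (param Inf)" by (rule range_eqI)
    then show ?thesis using False Some by simp
  qed
qed

lemma param_coord: "s \<in> range (param k) \<Longrightarrow> param k (coord k s) = s"
  by (cases k; cases s) (auto simp: range_param_Inf)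

lemma coord_param [simp]: "coord k (param k z) = z"
  by (cases k) auto

lemma param_cover: "s \<in> range (param Std) \<or> s \<in> range (param Inf)"
  by (cases s) (auto simp: range_param_Std range_param_Inf)

lemma inj_param: "param k z = param k w \<Longrightarrow> z = w"
  by (metis coord_param)

lemma range_hproj: "u \<noteq> 0 \<or> v \<noteq> 0 \<Longrightarrow> hproj u v \<in> range (param Std) \<longleftrightarrow> v \<noteq> 0"
  "u \<noteq> 0 \<or> v \<noteq> 0 \<Longrightarrow> hproj u v \<in> range (param Inf) \<longleftrightarrow> u \<noteq> 0"
  unfolding range_param_Std range_param_Inf by (auto simp: hproj_def)

lemma coord_hproj: "v \<noteq> 0 \<Longrightarrow> coord Std (hproj u v) = u / v" "u \<noteq> 0 \<Longrightarrow> coord Inf (hproj u v) = v / u"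
  by (auto simp: hproj_def)

lemma hproj_scale: "k \<noteq> 0 \<Longrightarrow> hproj (k * u) (k * v) = hproj u v"
  by (simp add: hproj_def)

definition mob :: "complex \<Rightarrow> complex \<Rightarrow> complex \<Rightarrow> complex \<Rightarrow> sphere \<Rightarrow> sphere" where
  "mob a b c d s = (case s of None \<Rightarrow> hproj a c | Some z \<Rightarrow> hproj (a * z + b) (c * z + d))"

lemma mob_hproj:
  assumes "u \<noteq> 0 \<or> v \<noteq> 0"
  shows "mob a b c d (hproj u v) = hproj (a * u + b * v) (c * u + d * v)"
proof (cases "v = 0")
  case True
  then have "hproj u v = None" by (simp add: hproj_def)
  then show ?thesis using assms hproj_scale[of u a c] True by (simp add: mob_def mult.commute)
next
  case False
  have "hproj (a * (u / v) + b) (c * (u / v) + d) = hproj (v * (a * (u / v) + b)) (v * (c * (u / v) + d))"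
    using hproj_scale[OF False] by simp
  also have "\<dots> = hproj (a * u + b * v) (c * u + d * v)" using False by (simp add: algebra_simps)
  finally show ?thesis using False by (simp add: mob_def hproj_def[of u v])
qed

lemma det_nonzero:
  fixes a b c d u v :: complex
  assumes "a * d - b * c \<noteq> 0" "u \<noteq> 0 \<or> v \<noteq> 0"
  shows "a * u + b * v \<noteq> 0 \<or> c * u + d * v \<noteq> 0"
proof (rule ccontr)
  assume "\<not> ?thesis"
  then have 1: "a * u + b * v = 0" "c * u + d * v = 0" by auto
  have "(a * d - b * c) * u = d * (a * u + b * v) - b * (c * u + d * v)" by (simp add: algebra_simps)
  moreover have "(a * d - b * c) * v = a * (c * u + d * v) - c * (a * u + b * v)" by (simp add: algebra_simps)
  ultimately show False using 1 assms by auto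
qed

lemma mob_comp:
  assumes "a' * d' - b' * c' \<noteq> 0"
  shows "mob a b c d (mob a' b' c' d' s) = mob (a * a' + b * c') (a * b' + b * d') (c * a' + d * c') (c * b' + d * d') s"
proof -
  obtain u v where s: "s = hproj u v" "u \<noteq> 0 \<or> v \<noteq> 0"
    by (cases s) (metis hproj_def one_neq_zero, metis hproj_def div_by_1 one_neq_zero)
  show ?thesis unfolding s(1)
    by (subst mob_hproj[OF s(2)], subst mob_hproj[OF det_nonzero[OF assms s(2)]], subst mob_hproj[OF s(2)]) (simp add: algebra_simps)
qed

lemma mob_scalar: "k \<noteq> 0 \<Longrightarrow> mob k 0 0 k s = s"
  by (cases s) (auto simp: mob_def hproj_def)

definition moebius :: "(sphere \<Rightarrow> sphere) \<Rightarrow> bool" where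
  "moebius h \<longleftrightarrow> (\<exists>a b c d. a * d - b * c \<noteq> 0 \<and> h = mob a b c d)"

lemma moebius_comp: "moebius h \<Longrightarrow> moebius k \<Longrightarrow> moebius (h \<circ> k)"
proof -
  assume "moebius h" "moebius k"
  then obtain a b c d a' b' c' d' where h: "a * d - b * c \<noteq> 0" "h = mob a b c d"
    and k: "a' * d' - b' * c' \<noteq> 0" "k = mob a' b' c' d'" unfolding moebius_def by blast
  have "(a * a' + b * c') * (c * b' + d * d') - (a * b' + b * d') * (c * a' + d * c') = (a * d - b * c) * (a' * d' - b' * c')"
    by (simp add: algebra_simps)
  then show ?thesis unfolding moebius_def h(2) k(2)
    using h(1) k(1) mob_comp[OF k(1), of a b c d]
    by (intro exI[of _ "a * a' + b * c'"] exI[of _ "a * b' + b * d'"] exI[of _ "c * a' + d * c'"] exI[of _ "c * b' + d * d'"])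
       (auto simp: fun_eq_iff)
qed

lemma moebius_inverse:
  assumes "moebius h"
  shows "\<exists>k. moebius k \<and> (\<forall>s. k (h s) = s) \<and> (\<forall>s. h (k s) = s)"
proof -
  obtain a b c d where h: "a * d - b * c \<noteq> 0" "h = mob a b c d" using assms unfolding moebius_def by blast
  \<comment> \<open>The inverse is given by the adjugate matrix: both products are the determinant
    times the identity, and scalar matrices act trivially.\<close>
  have k: "d * a - (- b) * (- c) \<noteq> 0" using h(1) by (simp add: mult.commute)
  have "mob d (- b) (- c) a (h s) = s" for s
    unfolding h(2) using mob_scalar[OF h(1), of s] by (subst mob_comp[OF h(1)]) (simp add: algebra_simps)
  moreover have "h (mob d (- b) (- c) a s) = s" for s
    unfolding h(2) using mob_scalar[OF h(1), of s] by (subst mob_comp[OF k]) (simp add: algebra_simps)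
  ultimately show ?thesis using k unfolding moebius_def by blast
qed

lemma moebius_bij: "moebius h \<Longrightarrow> bij h"
  using moebius_inverse[of h] by (metis bijI')

lemma moebius_inv: "moebius h \<Longrightarrow> moebius (inv h)"
proof -
  assume h: "moebius h"
  then obtain k where k: "moebius k" "\<And>s. k (h s) = s" using moebius_inverse by blast
  have "inv h = k"
  proof
    fix s
    obtain t where "s = h t" using moebius_bij[OF h] by (metis bij_pointE)
    then show "inv h s = k s" using k(2) moebius_bij[OF h] by (simp add: bij_is_inj)
  qed
  then show ?thesis using k(1) by simp
qed

definition chart_dom :: "(sphere \<Rightarrow> sphere) \<Rightarrow> chart \<Rightarrow> chart \<Rightarrow> complex set" where
  "chart_dom h k l = {z. h (param k z) \<in> range (param l)}"

lemma moebius_chart: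
  assumes "moebius h"
  shows "open (chart_dom h k l)" "local_rep h k l holomorphic_on chart_dom h k l"
proof -
  obtain a b c d where h: "a * d - b * c \<noteq> 0" "h = mob a b c d" using assms unfolding moebius_def by blast
  define N where "N = (\<lambda>z. a * hnum k z + b * hden k z)"
  define D where "D = (\<lambda>z. c * hnum k z + d * hden k z)"
  have ND: "N z \<noteq> 0 \<or> D z \<noteq> 0" for z
    unfolding N_def D_def by (rule det_nonzero[OF h(1) hcoord_nonzero])
  have hp: "h (param k z) = hproj (N z) (D z)" for z
    unfolding h(2) param_hproj N_def D_def by (rule mob_hproj[OF hcoord_nonzero])
  have hol: "N holomorphic_on A" "D holomorphic_on A" for A
    unfolding N_def D_def by (cases k; auto intro!: holomorphic_intros)+
  have cont: "continuous_on UNIV N" "continuous_on UNIV D" using hol holomorphic_on_imp_continuous_on by blast+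
  have "open {z. N z \<noteq> 0}" "open {z. D z \<noteq> 0}" using cont by (auto intro!: open_Collect_neq continuous_intros)
  then show "open (chart_dom h k l)"
    by (cases l) (simp_all only: chart_dom_def hp range_hproj[OF ND])
  have "local_rep h k l z = (case l of Std \<Rightarrow> N z / D z | Inf \<Rightarrow> D z / N z)" if "z \<in> chart_dom h k l" for z
  proof (cases l)
    case Std
    then have "D z \<noteq> 0" using that range_hproj(1)[OF ND[of z]] unfolding chart_dom_def hp by blast
    then show ?thesis unfolding local_rep_def hp Std chart.case by (rule coord_hproj)
  next
    case Inf
    then have "N z \<noteq> 0" using that range_hproj(2)[OF ND[of z]] unfolding chart_dom_def hp by blast
    then show ?thesis unfolding local_rep_def hp Inf chart.case by (rule coord_hproj)
  qed
  moreover have "(\<lambda>z. case l of Std \<Rightarrow> N z / D z | Inf \<Rightarrow> D z / N z) holomorphic_on chart_dom h k l"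
  proof (cases l)
    case Std
    have "D z \<noteq> 0" if "z \<in> chart_dom h k Std" for z
      using that range_hproj(1)[OF ND[of z]] unfolding chart_dom_def hp by blast
    then show ?thesis unfolding Std chart.case by (intro holomorphic_intros hol)
  next
    case Inf
    have "N z \<noteq> 0" if "z \<in> chart_dom h k Inf" for z
      using that range_hproj(2)[OF ND[of z]] unfolding chart_dom_def hp by blast
    then show ?thesis unfolding Inf chart.case by (intro holomorphic_intros hol)
  qed
  ultimately show "local_rep h k l holomorphic_on chart_dom h k l" by (simp cong: holomorphic_cong)
qed

lemma local_rep_param: "z \<in> chart_dom h k l \<Longrightarrow> param l (local_rep h k l z) = h (param k z)"
  unfolding local_rep_def chart_dom_def by (simp add: param_coord)

lemma moebius_local_inj:
  assumes "moebius h"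
  shows "inj_on (local_rep h k l) (chart_dom h k l)"
proof (rule inj_onI)
  fix z w assume "z \<in> chart_dom h k l" "w \<in> chart_dom h k l" "local_rep h k l z = local_rep h k l w"
  then have "h (param k z) = h (param k w)" by (metis local_rep_param)
  then have "param k z = param k w" using moebius_bij[OF assms] by (metis bij_is_inj injD)
  then show "z = w" by (rule inj_param)
qed

lemma moebius_deriv_nonzero:
  assumes "moebius h" "z \<in> chart_dom h k l"
  shows "deriv (local_rep h k l) z \<noteq> 0"
  by (rule holomorphic_injective_imp_regular[OF moebius_chart(2,1)[OF assms(1)] moebius_local_inj[OF assms(1)] assms(2)])

section \<open>Charts and topology of the sphere\<close>

lemma topspace_sphere [simp]: "topspace riemann_sphere = UNIV"
  by (auto simp: riemann_sphere_def topspace_Alexandroff_compactification intro: range_eqI split: option.splits)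
     (metis not_None_eq rangeI)

lemma openin_sphere:
  "openin riemann_sphere V \<longleftrightarrow> (\<exists>U. open U \<and> V = Some ` U) \<or> (\<exists>C. compact C \<and> V = insert None (Some ` (- C)))"
  unfolding riemann_sphere_def openin_Alexandroff_compactification
  by (auto simp: compact_imp_closed Compl_eq_Diff_UNIV)

lemma open_inverse_set: "open U \<Longrightarrow> open {z::complex. z \<noteq> 0 \<and> 1 / z \<in> U}"
proof -
  assume "open U"
  moreover have "continuous_on (- {0::complex}) (\<lambda>z. 1 / z)" by (intro continuous_intros) auto
  ultimately have "open ((- {0::complex}) \<inter> (\<lambda>z. 1 / z) -` U)" by (intro continuous_open_preimage) auto
  moreover have "(- {0::complex}) \<inter> (\<lambda>z. 1 / z) -` U = {z. z \<noteq> 0 \<and> 1 / z \<in> U}" by auto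
  ultimately show ?thesis by (simp only:)
qed

lemma open_param_vimage:
  assumes "openin riemann_sphere V"
  shows "open (param k -` V)"
proof (cases k)
  case Std
  from assms consider U where "open U" "V = Some ` U" | C where "compact C" "V = insert None (Some ` (- C))"
    unfolding openin_sphere by blast
  then show ?thesis
  proof cases
    case 1
    then have "param Std -` V = U" by auto
    then show ?thesis using 1 Std by simp
  next
    case 2
    then have "param Std -` V = - C" by auto
    then show ?thesis using 2 Std by (simp add: compact_imp_closed open_Compl)
  qed
next
  case Inf
  from assms consider U where "open U" "V = Some ` U" | C where "compact C" "V = insert None (Some ` (- C))"
    unfolding openin_sphere by blast
  then show ?thesis
  proof cases
    case 1
    then have "param Inf -` V = {z. z \<noteq> 0 \<and> 1 / z \<in> U}" by (auto split: if_splits)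
    then show ?thesis using open_inverse_set[OF 1(1)] Inf by simp
  next
    case 2
    obtain R where R: "R > 0" "\<And>x. x \<in> C \<Longrightarrow> norm x \<le> R" using compact_imp_bounded[OF 2(1)] bounded_pos by blast
    \<comment> \<open>C lies in the disk of radius R, so in the chart at infinity every point of
      modulus less than 1/R belongs to V.\<close>
    have "param Inf -` V = {z. z \<noteq> 0 \<and> 1 / z \<in> - C} \<union> ball 0 (1 / R)"
    proof -
      have "1 / z \<notin> C" if "z \<noteq> 0" "norm z < 1 / R" for z
        using that R(1) R(2)[of "1 / z"] by (auto simp: norm_divide field_simps)
      then show ?thesis using 2 R(1) by (auto split: if_splits)
    qed
    moreover have "open (- C)" using 2(1) by (simp add: compact_imp_closed open_Compl)
    ultimately show ?thesis using open_inverse_set[of "- C"] Inf by (simp add: open_Un)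
  qed
qed

lemma openin_param_image:
  assumes U: "open U"
  shows "openin riemann_sphere (param k ` U)"
proof (cases k)
  case Std
  have "param Std ` U = Some ` U" by auto
  then show ?thesis using U Std unfolding openin_sphere by auto
next
  case Inf
  define W where "W = {z::complex. z \<noteq> 0 \<and> 1 / z \<in> U}"
  have W: "open W" unfolding W_def by (rule open_inverse_set[OF U])
  show ?thesis
  proof (cases "0 \<in> U")
    case False
    have "param Inf ` U = Some ` W"
    proof -
      have "Some z \<in> param Inf ` U" if "z \<in> W" for z
        using that by (intro image_eqI[of _ _ "1 / z"]) (auto simp: W_def)
      then show ?thesis using False by (auto simp: W_def)
    qed
    then show ?thesis using W Inf unfolding openin_sphere by auto
  next
    case True
    then obtain r where r: "r > 0" "ball 0 r \<subseteq> U" using U open_contains_ball by blast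
    have "param Inf ` U = insert None (Some ` (- (- W)))"
    proof -
      have "Some z \<in> param Inf ` U" if "z \<in> W" for z
        using that by (intro image_eqI[of _ _ "1 / z"]) (auto simp: W_def)
      moreover have "None \<in> param Inf ` U" using True by (intro image_eqI[of _ _ 0]) auto
      ultimately show ?thesis by (auto simp: W_def)
    qed
    \<comment> \<open>The set U contains a disk of radius r about 0, so points outside W have
      modulus at most 1/r.\<close>
    moreover have "compact (- W)"
    proof -
      have "norm z \<le> 1 / r" if "z \<in> - W" for z
      proof (cases "z = 0")
        case False
        then have "1 / z \<notin> ball 0 r" using that r(2) by (auto simp: W_def)
        then have "r \<le> 1 / norm z" by (simp add: norm_divide)
        then show ?thesis using False r(1) by (simp add: field_simps)
      qed (use r in simp)
      then have "bounded (- W)" unfolding bounded_iff by blast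
      then show ?thesis using W by (simp add: compact_eq_bounded_closed closed_Compl)
    qed
    ultimately show ?thesis using Inf unfolding openin_sphere by blast
  qed
qed

lemma moebius_continuous:
  assumes h: "moebius h"
  shows "continuous_map riemann_sphere riemann_sphere h"
  unfolding continuous_map_def
proof (intro conjI allI impI)
  fix V assume V: "openin riemann_sphere V"
  show "openin riemann_sphere {s \<in> topspace riemann_sphere. h s \<in> V}"
  proof (subst openin_subopen, intro ballI)
    fix s assume "s \<in> {s \<in> topspace riemann_sphere. h s \<in> V}"
    then have sV: "h s \<in> V" by simp
    obtain k z where s: "s = param k z" using param_cover[of s] by blast
    obtain l where l: "h s \<in> range (param l)" using param_cover[of "h s"] by blast
    define W where "W = chart_dom h k l \<inter> local_rep h k l -` (param l -` V)"
    have W: "open W"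
      unfolding W_def using continuous_open_preimage[OF holomorphic_on_imp_continuous_on[OF moebius_chart(2)[OF h]] moebius_chart(1)[OF h] open_param_vimage[OF V]] .
    have "z \<in> W" using sV l s by (auto simp: W_def chart_dom_def local_rep_def param_coord)
    moreover have "h (param k w) \<in> V" if "w \<in> W" for w
      using that local_rep_param[of w h k l] by (auto simp: W_def)
    ultimately show "\<exists>T. openin riemann_sphere T \<and> s \<in> T \<and> T \<subseteq> {s \<in> topspace riemann_sphere. h s \<in> V}"
      using openin_param_image[OF W, of k] s by (intro exI[of _ "param k ` W"]) auto
  qed
qed auto

lemma moebius_homeomorphic:
  assumes "moebius h"
  shows "homeomorphic_map riemann_sphere riemann_sphere h"
proof -
  obtain k where "moebius k" "\<And>s. k (h s) = s" "\<And>s. h (k s) = s" using moebius_inverse[OF assms] by blast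
  then have "homeomorphic_maps riemann_sphere riemann_sphere h k"
    unfolding homeomorphic_maps_def using assms by (simp add: moebius_continuous)
  then show ?thesis using homeomorphic_map_maps by blast
qed

lemma moebius_biholomorphic: "moebius h \<Longrightarrow> biholomorphic_sphere h"
  unfolding biholomorphic_sphere_def using moebius_homeomorphic moebius_chart(2)[unfolded chart_dom_def] by blast

lemma moebius_homeomorphic_punctured:
  assumes "moebius h" "h p = p'"
  shows "homeomorphic_map (subtopology riemann_sphere (- {p})) (subtopology riemann_sphere (- {p'})) h"
proof (rule homeomorphic_map_subtopologies[OF moebius_homeomorphic[OF assms(1)]])
  show "h ` (topspace riemann_sphere \<inter> - {p}) = topspace riemann_sphere \<inter> - {p'}"
    using moebius_bij[OF assms(1)] assms(2) by (simp add: bij_image_Compl_eq Compl_eq_Diff_UNIV image_set_diff bij_is_inj bij_is_surj)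
qed

section \<open>Sphere metrics in a plane coordinate\<close>

text \<open>The metric and its curvature in the coordinate x of the punctured sphere in which a Moebius map M
  sends x to the point M x and infinity to the marked point.\<close>

definition pull_phi :: "conf_metric \<Rightarrow> (sphere \<Rightarrow> sphere) \<Rightarrow> complex \<Rightarrow> real" where
  "pull_phi g M x = (let k = (if M (Some x) = None then Inf else Std) in
     g k (local_rep M Std k x) + ln (norm (deriv (local_rep M Std k) x)))"

definition pull_K :: "conf_metric \<Rightarrow> (sphere \<Rightarrow> sphere) \<Rightarrow> complex \<Rightarrow> real" where
  "pull_K g M x = gauss_curv g (M (Some x))"

locale marked_metric =
  fixes p :: sphere and g :: conf_metric and M :: "sphere \<Rightarrow> sphere"
  assumes smooth: "smooth_conformal_metric p g" and M: "moebius M" and Mp: "M None = p"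
begin

lemma M_Some: "M (Some x) \<noteq> p"
  using moebius_bij[OF M] Mp by (metis bij_is_inj injD option.distinct(1))

lemma inv_M [simp]: "inv M (M s) = s" "M (inv M s) = s"
  using moebius_bij[OF M] by (simp_all add: bij_is_inj bij_is_surj surj_f_inv_f)

lemma inv_M_p: "inv M p = None"
  using Mp by (metis inv_M(1))

lemma inv_M_Some: "s \<noteq> p \<Longrightarrow> \<exists>x. inv M s = Some x \<and> M (Some x) = s"
  by (metis Mp inv_M(2) not_None_eq)

lemma open_unmarked: "open {z. param k z \<noteq> p}"
proof (cases "p \<in> range (param k)")
  case True
  then have "{z. param k z \<noteq> p} = - {coord k p}" by (auto simp: param_coord dest: inj_param)
  then show ?thesis by (simp add: open_Compl)
next
  case False
  then have "{z. param k z \<noteq> p} = UNIV" by auto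
  then show ?thesis by simp
qed

lemma smooth_chart: "smooth_on {z. param k z \<noteq> p} (g k)"
  using smooth by (simp add: smooth_conformal_metric_def)

lemma transition: "z \<noteq> 0 \<Longrightarrow> Some z \<noteq> p \<Longrightarrow> g Inf (1 / z) = g Std z + 2 * ln (norm z)"
  using smooth by (simp add: smooth_conformal_metric_def)

text \<open>The choice of chart in \<open>pull_phi\<close> is immaterial. The representatives of M
  in the two charts satisfy I = 1/S, so |I'| = |S'|/|z|^2 contributes -2 ln |z|, which cancels the
  term 2 ln |z| of \<open>transition\<close>.\<close>

lemma pull_phi_chart:
  assumes x: "x \<in> chart_dom M Std k"
  shows "pull_phi g M x = g k (local_rep M Std k x) + ln (norm (deriv (local_rep M Std k) x))"
proof (cases "M (Some x)")
  case None
  then have "k = Inf" using x by (cases k) (auto simp: chart_dom_def range_param_Std)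
  then show ?thesis using None by (simp add: pull_phi_def)
next
  case (Some z)
  show ?thesis
  proof (cases k)
    case Std
    then show ?thesis using Some by (simp add: pull_phi_def)
  next
    case Inf
    define V where "V = chart_dom M Std Std \<inter> chart_dom M Std Inf"
    have V: "open V" unfolding V_def by (intro open_Int moebius_chart M)
    have xV: "x \<in> V" using x Some Inf by (auto simp: V_def chart_dom_def range_param_Std)
    let ?S = "local_rep M Std Std" and ?I = "local_rep M Std Inf"
    have I: "?I w = 1 / ?S w \<and> ?S w \<noteq> 0" if "w \<in> V" for w
    proof -
      have "M (Some w) \<noteq> None" using that range_param_Std[of "M (Some w)"] by (simp add: V_def chart_dom_def)
      then obtain y where "M (Some w) = Some y" by blast
      then show ?thesis using that by (auto simp: V_def chart_dom_def range_param_Inf local_rep_def simp del: param.simps(2))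
    qed
    have zS: "?S x = z" using Some by (simp add: local_rep_def)
    have z0: "z \<noteq> 0" using I[OF xV] zS by simp
    have dS: "(?S has_field_derivative deriv ?S x) (at x)"
      using holomorphic_derivI[OF moebius_chart(2,1)[OF M]] xV by (simp add: V_def)
    have "((\<lambda>w. 1 / ?S w) has_field_derivative - deriv ?S x / z\<^sup>2) (at x)"
      using z0 zS by (auto intro!: derivative_eq_intros dS simp: power2_eq_square)
    then have "(?I has_field_derivative - deriv ?S x / z\<^sup>2) (at x)"
      by (rule has_field_derivative_transform_within_open[OF _ V xV]) (simp add: I)
    then have "deriv ?I x = - deriv ?S x / z\<^sup>2" by (rule DERIV_imp_deriv)
    moreover have "deriv ?S x \<noteq> 0" using moebius_deriv_nonzero[OF M] xV by (simp add: V_def)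
    ultimately have "ln (norm (deriv ?I x)) = ln (norm (deriv ?S x)) - 2 * ln (norm z)"
      using z0 by (simp add: norm_divide norm_power ln_div ln_realpow)
    moreover have "Some z \<noteq> p" using M_Some[of x] Some by simp
    ultimately show ?thesis
      using transition[OF z0] I[OF xV] zS Some Inf by (simp add: pull_phi_def)
  qed
qed

text \<open>\<open>gauss_curv\<close> reads finite points in the chart z. At such points the chart
  at infinity agrees, because \<open>transition\<close> is the conformal change under the
  holomorphic map w -> 1/w.\<close>

lemma gauss_curv_chart:
  assumes z: "param k z \<noteq> p"
  shows "gauss_curv g (param k z) = chart_curv (g k) z"
proof (cases "k = Std \<or> z = 0")
  case True
  then show ?thesis by (cases k) auto
next
  case False
  then have k: "k = Inf" and z0: "z \<noteq> 0" by (cases k; simp)+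
  define V where "V = {w. param Inf w \<noteq> p} \<inter> - {0}"
  have V: "open V" unfolding V_def by (intro open_Int open_unmarked) auto
  have h: "(\<lambda>w. 1 / w) holomorphic_on V" by (intro holomorphic_intros) (auto simp: V_def)
  have d: "deriv (\<lambda>w. 1 / w) w = - 1 / w\<^sup>2" if "w \<noteq> 0" for w :: complex
    using that by (intro DERIV_imp_deriv) (auto intro!: derivative_eq_intros simp: power2_eq_square)
  have "chart_curv (g Inf) z = chart_curv (g Std) (1 / z)"
  proof (rule chart_curv_pullback[OF V h open_unmarked[of Std] _ _ smooth_chart[of Std]])
    show "1 / w \<in> {z. param Std z \<noteq> p}" if "w \<in> V" for w using that by (auto simp: V_def)
    show "deriv (\<lambda>w. 1 / w) w \<noteq> 0" if "w \<in> V" for w using that d[of w] by (auto simp: V_def)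
    show "g Inf w = g Std (1 / w) + ln (norm (deriv (\<lambda>w. 1 / w) w))" if "w \<in> V" for w
    proof -
      have w: "w \<noteq> 0" "Some (1 / w) \<noteq> p" using that by (auto simp: V_def)
      have "ln (norm (deriv (\<lambda>w. 1 / w) w)) = 2 * ln (norm (1 / w))"
        using w by (simp add: d norm_divide norm_power ln_div ln_realpow)
      then show ?thesis using transition[of "1 / w"] w by simp
    qed
    show "z \<in> V" using z z0 k by (simp add: V_def)
  qed
  then show ?thesis using k z0 by simp
qed

lemma pull_local:
  assumes eq: "hcmu_equation p g"
  shows "\<exists>V f f' q p'. open V \<and> x \<in> V \<and> hcmu_on V (pull_phi g M) (pull_K g M) f f' q p'"
proof -
  obtain k where k: "M (Some x) \<in> range (param k)" using param_cover by blast
  have "\<exists>f f' q p'. hcmu_on {z. param k z \<noteq> p} (g k) (\<lambda>z. gauss_curv g (param k z)) f f' q p'"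
    by (rule chart_hcmu_on[OF open_unmarked smooth_chart])
       (use eq gauss_curv_chart in \<open>auto simp: hcmu_equation_def Let_def\<close>)
  then obtain f f' q p' where H: "hcmu_on {z. param k z \<noteq> p} (g k) (\<lambda>z. gauss_curv g (param k z)) f f' q p'" by blast
  define V where "V = chart_dom M Std k"
  define L where "L = local_rep M Std k"
  have V: "open V" and L: "L holomorphic_on V" unfolding V_def L_def by (rule moebius_chart[OF M])+
  have PL: "param k (L y) = M (Some y)" if "y \<in> V" for y
    using local_rep_param[of y M Std k] that by (simp add: V_def L_def)
  obtain f f' q p' where "hcmu_on V (\<lambda>z. g k (L z) + ln (norm (deriv L z))) (\<lambda>z. gauss_curv g (param k (L z))) f f' q p'"
    using hcmu_on_pullback[OF V L _ _ H] PL M_Some moebius_deriv_nonzero[OF M, of _ Std k]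
    by (auto simp: V_def L_def)
  then have "hcmu_on V (pull_phi g M) (pull_K g M) f f' q p'"
    by (rule hcmu_on_cong[OF V, rotated 2]) (auto simp: pull_phi_chart V_def L_def pull_K_def PL[unfolded V_def L_def])
  moreover have "x \<in> V" using k by (simp add: V_def chart_dom_def)
  ultimately show ?thesis using V by blast
qed

lemma pull_phi_continuous:
  assumes eq: "hcmu_equation p g"
  shows "continuous_on UNIV (pull_phi g M)"
proof (rule continuous_at_imp_continuous_on, rule ballI)
  fix x
  obtain V f f' q p' where "x \<in> V" "hcmu_on V (pull_phi g M) (pull_K g M) f f' q p'" using pull_local[OF eq, of x] by metis
  then have "(pull_phi g M has_derivative (\<lambda>v. Re (q x * v))) (at x)" by (simp add: hcmu_on_def potential_on_def)
  then show "isCont (pull_phi g M) x" by (rule has_derivative_continuous)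
qed

lemma pull_area:
  assumes eq: "hcmu_equation p g" and fin: "finite_area p g"
  shows "integrable lborel (\<lambda>x. exp (2 * pull_phi g M x))"
    "(LINT x|lborel. exp (2 * pull_phi g M x)) = total_area p g"
proof -
  define S where "S = chart_dom M Std Std"
  define L where "L = local_rep M Std Std"
  define E where "E = (\<lambda>x. exp (2 * pull_phi g M x))"
  define G where "G = (\<lambda>z. exp (2 * g Std z))"
  have S: "open S" and L: "L holomorphic_on S" unfolding S_def L_def by (rule moebius_chart[OF M])+
  have inj: "inj_on L S" unfolding S_def L_def by (rule moebius_local_inj[OF M])
  have LS: "L ` S = {z. Some z \<noteq> p}"
  proof -
    have "Some (L x) = M (Some x)" if "x \<in> S" for x
      using local_rep_param[of x M Std Std] that by (simp add: S_def L_def)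
    moreover have "z \<in> L ` S" if zp: "Some z \<noteq> p" for z
    proof -
      obtain x where x: "M (Some x) = Some z" using inv_M_Some[OF zp] by metis
      then have "x \<in> S" by (simp add: S_def chart_dom_def range_param_Std)
      moreover have "L x = z" using x by (simp add: L_def local_rep_def)
      ultimately show ?thesis by blast
    qed
    ultimately show ?thesis using M_Some by (intro equalityI subsetI CollectI) (metis imageE, blast)
  qed
  have setint: "set_integrable lborel {z. Some z \<noteq> p} G" using fin by (simp add: finite_area_def G_def)
  have tot: "integral (L ` S) G = total_area p g" and "G integrable_on (L ` S)"
    using set_borel_integral_eq_integral[OF setint] by (simp_all add: LS total_area_def G_def)
  then have "G absolutely_integrable_on (L ` S)"
    by (intro nonnegative_absolutely_integrable_1) (auto simp: G_def)
  define E' where "E' = (\<lambda>z. (norm (deriv L z))\<^sup>2 * G (L z))"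
  have CV: "E' absolutely_integrable_on S" "integral S E' = total_area p g"
    using holomorphic_change_of_variables[OF S L inj, of G "total_area p g"] tot
      \<open>G absolutely_integrable_on (L ` S)\<close> unfolding E'_def by blast+
  have EG: "E' x = E x" if "x \<in> S" for x
    using pull_phi_chart[of x Std] moebius_deriv_nonzero[OF M, of x Std Std] that
    by (simp add: S_def L_def E'_def E_def G_def distrib_left exp_add exp_double power_mult_distrib)
  have "(E' has_integral total_area p g) S"
    using set_lebesgue_integral_eq_integral(1)[OF CV(1)] CV(2) by (simp add: has_integral_iff)
  then have ES: "(E has_integral total_area p g) S"
    by (rule has_integral_eq[rotated]) (rule EG)
  \<comment> \<open>The area is computed in the chart z, so the plane coordinate loses at most the
    one point that M sends to infinity.\<close>
  have neg: "negligible (UNIV - S)"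
  proof -
    have "UNIV - S \<subseteq> {x. Some x = inv M None}"
    proof
      fix x assume "x \<in> UNIV - S"
      then have "M (Some x) = None" by (cases "M (Some x)") (auto simp: S_def chart_dom_def range_param_Std)
      then show "x \<in> {x. Some x = inv M None}" using inv_M(1)[of "Some x"] by simp
    qed
    moreover have "finite {x. Some x = inv M None}" by (rule finite_subset[of _ "{the (inv M None)}"]) (auto, metis option.sel)
    ultimately show ?thesis by (metis negligible_finite negligible_subset)
  qed
  have "(E has_integral total_area p g) UNIV"
  proof (rule has_integral_spike_set_eq[THEN iffD1, OF _ _ ES])
    show "negligible {x \<in> S - UNIV. E x \<noteq> 0}" by simp
    show "negligible {x \<in> UNIV - S. E x \<noteq> 0}" by (rule negligible_subset[OF neg]) auto
  qed
  then have 2: "E integrable_on UNIV" "integral UNIV E = total_area p g"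
    by (simp_all add: has_integral_iff)
  then have "E absolutely_integrable_on UNIV" by (intro nonnegative_absolutely_integrable_1) (auto simp: E_def)
  \<comment> \<open>The change of variables yields integrability for completed Lebesgue measure;
    continuity supplies the Borel measurability needed for \<open>lborel\<close>.\<close>
  then have "integrable (completion lborel) E" by (simp add: set_integrable_def)
  moreover have "continuous_on UNIV E" unfolding E_def by (intro continuous_intros pull_phi_continuous[OF eq])
  then have "E \<in> borel_measurable lborel" by (simp add: borel_measurable_continuous_onI)
  ultimately have int: "integrable lborel E" by (simp add: integrable_completion)
  then show "integrable lborel (\<lambda>x. exp (2 * pull_phi g M x))" by (simp add: E_def)
  have "set_integrable lborel UNIV E" using int by (simp add: set_integrable_def)
  from set_borel_integral_eq_integral(2)[OF this] 2(2)
  show "(LINT x|lborel. exp (2 * pull_phi g M x)) = total_area p g"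
    by (simp add: set_lebesgue_integral_def E_def)
qed

lemma atin_marked:
  assumes "(pull_K g M \<longlongrightarrow> l) at_infinity"
  shows "curv_ext p g p = l"
proof -
  have N: "moebius (inv M)" by (rule moebius_inv[OF M])
  have "(gauss_curv g \<longlongrightarrow> l) (atin riemann_sphere p)"
  proof (rule tendstoI)
    fix e :: real assume "e > 0"
    then have "\<forall>\<^sub>F x in at_infinity. dist (pull_K g M x) l < e" by (rule tendstoD[OF assms])
    then obtain R where R': "\<forall>x. norm x \<ge> R \<longrightarrow> dist (pull_K g M x) l < e"
      unfolding eventually_at_infinity ..
    then have R: "dist (pull_K g M x) l < e" if "norm x \<ge> R" for x using that by (rule_tac R'[rule_format])
    define W where "W = insert None (Some ` (- cball (0::complex) R))"
    define U where "U = {s \<in> topspace riemann_sphere. inv M s \<in> W}"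
    have "openin riemann_sphere W"
      unfolding W_def openin_sphere by (intro disjI2 exI[of _ "cball (0::complex) R"] conjI refl compact_cball)
    then have "openin riemann_sphere U"
      unfolding U_def by (rule openin_continuous_map_preimage[OF moebius_continuous[OF N]])
    moreover have "p \<in> U" by (simp add: U_def W_def inv_M_p)
    moreover have "dist (gauss_curv g s) l < e" if s: "s \<in> U - {p}" for s
    proof -
      obtain x where x: "inv M s = Some x" "M (Some x) = s" using inv_M_Some[of s] s by auto
      then have "norm x > R" using s by (auto simp: U_def W_def)
      then show ?thesis using R[of x] x(2) by (simp add: pull_K_def)
    qed
    ultimately show "\<forall>\<^sub>F s in atin riemann_sphere p. dist (gauss_curv g s) l < e"
      unfolding eventually_atin by blast
  qed
  \<comment> \<open>\<open>Lim\<close> picks out the limit only if the filter of punctured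
    neighbourhoods is proper. A neighbourhood of infinity contains the complement of a compact set,
    and compact sets do not exhaust the plane.\<close>
  moreover have "\<not> trivial_limit (atin riemann_sphere p)"
  proof
    assume "trivial_limit (atin riemann_sphere p)"
    then have "eventually (\<lambda>_. False) (atin riemann_sphere p)" by (simp add: trivial_limit_def)
    then obtain U where U: "openin riemann_sphere U" "p \<in> U" "U - {p} = {}" unfolding eventually_atin by auto
    have "openin riemann_sphere {s \<in> topspace riemann_sphere. M s \<in> U}" (is "openin _ ?W")
      by (rule openin_continuous_map_preimage[OF moebius_continuous[OF M] U(1)])
    moreover have "None \<in> ?W" using U(2) Mp by simp
    ultimately obtain C where C: "compact C" "?W = insert None (Some ` (- C))" unfolding openin_sphere by auto
    have "C \<noteq> UNIV" using compact_imp_bounded[OF C(1)] not_bounded_UNIV[where ?'a = complex] by auto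
    then obtain x where "x \<notin> C" by auto
    then have "Some x \<in> ?W" unfolding C(2) by blast
    then have "M (Some x) \<in> U - {p}" using M_Some by simp
    then show False using U(3) by blast
  qed
  ultimately have "Lim (atin riemann_sphere p) (gauss_curv g) = l" by (intro tendsto_Lim)
  then show ?thesis by (simp add: curv_ext_def)
qed

lemma curv_ext_M: "curv_ext p g (M (Some x)) = pull_K g M x"
  by (simp add: curv_ext_def M_Some pull_K_def)

lemma max_points_pull:
  assumes l: "curv_ext p g p = l"
  shows "M (Some x) \<in> max_points p g \<longleftrightarrow> l \<le> pull_K g M x \<and> (\<forall>y. pull_K g M y \<le> pull_K g M x)"
    "p \<in> max_points p g \<longleftrightarrow> (\<forall>y. pull_K g M y \<le> l)"
    "M (Some x) \<in> min_points p g \<longleftrightarrow> pull_K g M x \<le> l \<and> (\<forall>y. pull_K g M x \<le> pull_K g M y)"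
    "p \<in> min_points p g \<longleftrightarrow> (\<forall>y. l \<le> pull_K g M y)"
proof -
  have all: "(\<forall>s. Q s) \<longleftrightarrow> Q p \<and> (\<forall>y. Q (M (Some y)))" for Q
    by (metis inv_M_Some)
  show "M (Some x) \<in> max_points p g \<longleftrightarrow> l \<le> pull_K g M x \<and> (\<forall>y. pull_K g M y \<le> pull_K g M x)"
    "p \<in> max_points p g \<longleftrightarrow> (\<forall>y. pull_K g M y \<le> l)"
    "M (Some x) \<in> min_points p g \<longleftrightarrow> pull_K g M x \<le> l \<and> (\<forall>y. pull_K g M x \<le> pull_K g M y)"
    "p \<in> min_points p g \<longleftrightarrow> (\<forall>y. l \<le> pull_K g M y)"
    unfolding max_points_def min_points_def mem_Collect_eq by (subst all; simp add: curv_ext_M l)+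
qed

end

section \<open>Affine maps as isometries\<close>

lemma mob_affine: "mob \<mu> b 0 1 (Some x) = Some (\<mu> * x + b)" "mob \<mu> b 0 1 None = None"
  by (simp_all add: mob_def hproj_def)

lemma local_rep_has_derivative:
  assumes "moebius h" "z \<in> chart_dom h k l"
  shows "(local_rep h k l has_field_derivative deriv (local_rep h k l) z) (at z)"
  by (rule holomorphic_derivI[OF moebius_chart(2,1)[OF assms(1)] assms(2)])

text \<open>An affine map fixes infinity, so conjugation by M and M' carries p to p'. The hypothesis
  is the isometry equation in the plane coordinates; the rest transfers it to arbitrary charts by
  the chain rule.\<close>

lemma affine_isometry:
  assumes A: "marked_metric p g M" and B: "marked_metric p' g' M'" and \<mu>: "\<mu> \<noteq> 0"
    and eq: "\<And>x. pull_phi g' M' (\<mu> * x + b) + ln (norm \<mu>) = pull_phi g M x"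
  shows "isometry p g p' g' (M' \<circ> mob \<mu> b 0 1 \<circ> inv M)"
proof -
  interpret A: marked_metric p g M by fact
  interpret B: marked_metric p' g' M' by fact
  define F where "F = M' \<circ> mob \<mu> b 0 1 \<circ> inv M"
  have mob: "moebius (mob \<mu> b 0 1)" unfolding moebius_def using \<mu> by (intro exI[of _ \<mu>] exI[of _ b] exI[of _ 0] exI[of _ 1]) simp
  have N: "moebius (inv M)" by (rule moebius_inv[OF A.M])
  have F: "moebius F" unfolding F_def by (intro moebius_comp B.M mob N)
  have Fp: "F p = p'" by (simp add: F_def A.inv_M_p mob_affine B.Mp)
  have "smooth_on D L \<and> (\<forall>z\<in>D. \<forall>v. exp (g' d (L z)) * norm (frechet_derivative L (at z) v) = exp (g c z) * norm v)"
    if D: "D = {z. param c z \<noteq> p \<and> F (param c z) \<in> range (param d)}" and L: "L = local_rep F c d" for c d D L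
  proof
    have DD: "D = {z. param c z \<noteq> p} \<inter> chart_dom F c d" by (auto simp: D chart_dom_def)
    show "smooth_on D L"
      unfolding DD L
      by (intro smooth_on_holomorphic open_Int A.open_unmarked moebius_chart(1)[OF F] holomorphic_on_subset[OF moebius_chart(2)[OF F]]) auto
    show "\<forall>z\<in>D. \<forall>v. exp (g' d (L z)) * norm (frechet_derivative L (at z) v) = exp (g c z) * norm v"
    proof (intro ballI allI)
      fix z v assume z: "z \<in> D"
      then have zp: "param c z \<noteq> p" and zF: "z \<in> chart_dom F c d" by (auto simp: DD)
      obtain x where x: "inv M (param c z) = Some x" "M (Some x) = param c z" using A.inv_M_Some[OF zp] by blast
      define y where "y = \<mu> * x + b"
      have Fz: "F (param c z) = M' (Some y)" by (simp add: F_def x(1) mob_affine y_def)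
      let ?X = "local_rep (inv M) c Std" and ?A = "local_rep M Std c" and ?B = "local_rep M' Std d"
      have zX: "z \<in> chart_dom (inv M) c Std" by (simp add: chart_dom_def x(1) range_param_Std)
      have Xz: "?X z = x" by (simp add: local_rep_def x(1))
      have xA: "x \<in> chart_dom M Std c" by (simp add: chart_dom_def x(2))
      have Ax: "?A x = z" by (simp add: local_rep_def x(2))
      have yB: "y \<in> chart_dom M' Std d" using zF Fz by (simp add: chart_dom_def)
      have By: "?B y = L z" by (simp add: L local_rep_def Fz)
      have dX: "(?X has_field_derivative deriv ?X z) (at z)" by (rule local_rep_has_derivative[OF N zX])
      have dA: "(?A has_field_derivative deriv ?A x) (at x)" by (rule local_rep_has_derivative[OF A.M xA])
      have dB: "(?B has_field_derivative deriv ?B y) (at y)" by (rule local_rep_has_derivative[OF B.M yB])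
      have dL: "(L has_field_derivative deriv L z) (at z)" unfolding L by (rule local_rep_has_derivative[OF F zF])
      have oX: "open (chart_dom (inv M) c Std)" by (rule moebius_chart(1)[OF N])
      have nX: "Some (?X w) = inv M (param c w)" if "w \<in> chart_dom (inv M) c Std" for w
        using local_rep_param[OF that] by simp
      \<comment> \<open>The chart representatives of M and of its inverse compose to the identity,
        so their derivatives have product 1 and the logarithms of their moduli cancel.\<close>
      have 1: "?A (?X w) = w" if "w \<in> chart_dom (inv M) c Std" for w
        using nX[OF that] by (simp add: local_rep_def[of M])
      have "((\<lambda>w. ?A (?X w)) has_field_derivative deriv ?A x * deriv ?X z) (at z)"
        by (rule DERIV_chain2[OF _ dX]) (simp add: Xz dA)
      moreover have "((\<lambda>w. ?A (?X w)) has_field_derivative 1) (at z)"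
        by (rule has_field_derivative_transform_within_open[OF DERIV_ident oX zX]) (simp add: 1)
      ultimately have AX: "deriv ?A x * deriv ?X z = 1" by (rule DERIV_unique)
      have 2: "?B (\<mu> * ?X w + b) = L w" if "w \<in> chart_dom (inv M) c Std" for w
      proof -
        have "F (param c w) = M' (Some (\<mu> * ?X w + b))" using nX[OF that] by (simp add: F_def mob_affine flip: nX[OF that])
        then show ?thesis by (simp add: L local_rep_def[of F] local_rep_def[of M'])
      qed
      have "((\<lambda>w. \<mu> * ?X w + b) has_field_derivative \<mu> * deriv ?X z) (at z)"
        by (auto intro!: derivative_eq_intros dX)
      then have "((\<lambda>w. ?B (\<mu> * ?X w + b)) has_field_derivative deriv ?B y * (\<mu> * deriv ?X z)) (at z)"
        by (rule DERIV_chain2[rotated]) (simp add: Xz y_def[symmetric] dB)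
      then have "(L has_field_derivative deriv ?B y * (\<mu> * deriv ?X z)) (at z)"
        by (rule has_field_derivative_transform_within_open[OF _ oX zX]) (simp add: 2)
      then have dLz: "deriv L z = deriv ?B y * (\<mu> * deriv ?X z)" by (rule DERIV_imp_deriv)
      have nz: "deriv ?A x \<noteq> 0" "deriv ?X z \<noteq> 0" "deriv ?B y \<noteq> 0"
        using AX moebius_deriv_nonzero[OF B.M yB] by auto
      have lnAX: "ln (norm (deriv ?A x)) + ln (norm (deriv ?X z)) = 0"
      proof -
        have "norm (deriv ?A x) * norm (deriv ?X z) = 1" using arg_cong[OF AX, of norm] by (simp add: norm_mult)
        moreover have "ln (norm (deriv ?A x) * norm (deriv ?X z)) = ln (norm (deriv ?A x)) + ln (norm (deriv ?X z))"
          using nz by (simp add: ln_mult)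
        ultimately show ?thesis by simp
      qed
      have "g' d (L z) + ln (norm (deriv L z)) = g c z"
        using eq[of x] A.pull_phi_chart[OF xA] B.pull_phi_chart[OF yB] nz \<mu> lnAX
        by (simp add: dLz norm_mult ln_mult Ax By y_def[symmetric])
      then have "exp (g c z) = exp (g' d (L z)) * norm (deriv L z)"
        using nz \<mu> by (simp add: exp_add dLz flip: \<open>g' d (L z) + ln (norm (deriv L z)) = g c z\<close>)
      moreover have "frechet_derivative L (at z) v = deriv L z * v"
        using frechet_derivative_eq[OF dL[unfolded has_field_derivative_def]] by simp
      ultimately show "exp (g' d (L z)) * norm (frechet_derivative L (at z) v) = exp (g c z) * norm v"
        by (simp add: norm_mult)
    qed
  qed
  then show ?thesis
    unfolding isometry_def F_def[symmetric] Let_def using moebius_homeomorphic_punctured[OF F Fp] by blast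
qed

section \<open>The classification\<close>

lemma log_derivative_limits:
  assumes k: "k holomorphic_on ball 0 \<rho>" and \<rho>: "\<rho> > 0" and k0: "k 0 = 0" and k'0: "deriv k 0 \<noteq> 0"
  shows "((\<lambda>z. z * deriv k z / k z) \<longlongrightarrow> 1) (at 0)" "((\<lambda>z. z * deriv (deriv k) z / deriv k z) \<longlongrightarrow> 0) (at 0)"
proof -
  have hk: "deriv k holomorphic_on ball 0 \<rho>" "deriv (deriv k) holomorphic_on ball 0 \<rho>"
    by (intro holomorphic_deriv k open_ball)+
  have c: "(deriv k \<longlongrightarrow> deriv k 0) (at 0)" "(deriv (deriv k) \<longlongrightarrow> deriv (deriv k) 0) (at 0)"
    using hk[THEN holomorphic_on_imp_continuous_on] \<rho>
    by (simp_all add: continuous_on_eq_continuous_at isCont_def)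
  have "(k has_field_derivative deriv k 0) (at 0)" by (rule holomorphic_derivI[OF k]) (use \<rho> in auto)
  then have q: "((\<lambda>z. k z / z) \<longlongrightarrow> deriv k 0) (at 0)" by (simp add: has_field_derivative_iff k0)
  have "((\<lambda>z. deriv k z / (k z / z)) \<longlongrightarrow> deriv k 0 / deriv k 0) (at 0)" by (intro tendsto_divide c q k'0)
  then show "((\<lambda>z. z * deriv k z / k z) \<longlongrightarrow> 1) (at 0)" using k'0 by (simp add: mult.commute)
  have "((\<lambda>z. z * deriv (deriv k) z / deriv k z) \<longlongrightarrow> 0 * deriv (deriv k) 0 / deriv k 0) (at 0)"
    by (intro tendsto_divide tendsto_mult c k'0 tendsto_ident_at)
  then show "((\<lambda>z. z * deriv (deriv k) z / deriv k z) \<longlongrightarrow> 0) (at 0)" by simp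
qed

text \<open>A limit of z Q z at 0 is uniform in the angle, so it passes to the circle means. Thus
  the averaged angle condition can be evaluated from a pointwise limit.\<close>

lemma circle_average_limit:
  fixes Q :: "complex \<Rightarrow> complex"
  assumes \<rho>: "\<rho> > 0" and Q: "continuous_on (ball 0 \<rho> - {0}) Q"
    and d: "\<And>r \<theta>. 0 < r \<Longrightarrow> r < \<rho> \<Longrightarrow> D r \<theta> = Re (Q (of_real r * cis \<theta>) * cis \<theta>)"
    and lim: "((\<lambda>z. z * Q z) \<longlongrightarrow> of_real l) (at 0)"
  shows "((\<lambda>r. 1 / (2 * pi) * integral {0..2 * pi} (\<lambda>\<theta>. r * D r \<theta> + 1 - \<alpha>)) \<longlongrightarrow> l + 1 - \<alpha>) (at_right 0)"
proof (rule tendstoI)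
  fix e :: real assume e: "e > 0"
  obtain \<delta> where \<delta>: "\<delta> > 0" "\<And>z. z \<noteq> 0 \<Longrightarrow> dist z 0 < \<delta> \<Longrightarrow> dist (z * Q z) (of_real l) < e / 2"
    using tendstoD[OF lim, of "e/2"] e unfolding eventually_at by auto
  have "dist (1 / (2 * pi) * integral {0..2 * pi} (\<lambda>\<theta>. r * D r \<theta> + 1 - \<alpha>)) (l + 1 - \<alpha>) < e"
    if r: "0 < r" "r < min \<delta> \<rho>" for r
  proof -
    define G where "G = (\<lambda>\<theta>. Re (of_real r * cis \<theta> * Q (of_real r * cis \<theta>)) - l)"
    have rd: "r * D r \<theta> + 1 - \<alpha> = G \<theta> + (l + 1 - \<alpha>)" for \<theta>
    proof -
      have "of_real r * cis \<theta> * Q (of_real r * cis \<theta>) = of_real r * (Q (of_real r * cis \<theta>) * cis \<theta>)" by simp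
      then have "Re (of_real r * cis \<theta> * Q (of_real r * cis \<theta>)) = r * D r \<theta>" using d[of r \<theta>] r by (simp only: Re_of_real_mult)
      then show ?thesis by (simp add: G_def)
    qed
    have G: "continuous_on {0..2*pi} G"
      unfolding G_def using r by (intro continuous_intros continuous_on_compose2[OF Q]) (auto simp: norm_mult)
    have bound: "norm (G \<theta>) \<le> e / 2" for \<theta>
    proof -
      let ?z = "of_real r * cis \<theta>"
      have "dist (?z * Q ?z) (of_real l) < e / 2" using r by (intro \<delta>(2)) (auto simp: norm_mult)
      moreover have "G \<theta> = Re (?z * Q ?z - of_real l)" by (simp add: G_def)
      ultimately show ?thesis using abs_Re_le_cmod[of "?z * Q ?z - of_real l"] by (simp add: dist_norm)
    qed
    have "integral {0..2 * pi} (\<lambda>\<theta>. r * D r \<theta> + 1 - \<alpha>) = integral {0..2 * pi} G + integral {0..2*pi} (\<lambda>_. l + 1 - \<alpha>)"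
      unfolding rd by (intro Henstock_Kurzweil_Integration.integral_add integrable_continuous_real G continuous_intros)
    also have "\<dots> = integral {0..2 * pi} G + 2 * pi * (l + 1 - \<alpha>)" by simp
    finally have "1 / (2 * pi) * integral {0..2 * pi} (\<lambda>\<theta>. r * D r \<theta> + 1 - \<alpha>) - (l + 1 - \<alpha>) = integral {0..2 * pi} G / (2 * pi)"
      by (simp add: field_simps)
    moreover have "norm (integral {0..2 * pi} G) \<le> e / 2 * (2 * pi - 0)"
      by (rule integral_bound) (use G bound in auto)
    ultimately have "\<bar>1 / (2 * pi) * integral {0..2 * pi} (\<lambda>\<theta>. r * D r \<theta> + 1 - \<alpha>) - (l + 1 - \<alpha>)\<bar> \<le> e / 2"
      by (simp add: abs_divide field_simps)
    then show ?thesis using e by (simp add: dist_real_def)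
  qed
  then show "\<forall>\<^sub>F r in at_right 0. dist (1 / (2 * pi) * integral {0..2 * pi} (\<lambda>\<theta>. r * D r \<theta> + 1 - \<alpha>)) (l + 1 - \<alpha>) < e"
    using \<delta>(1) \<rho> by (intro eventually_at_rightI[of 0 "min \<delta> \<rho>"]) auto
qed

context marked_metric
begin

text \<open>The coordinate h centred at p is arbitrary. Let k be the coordinate 1/x composed with h;
  it has a simple zero at 0. The computation shows that z times the derivative of the conformal
  exponent tends to l - 2 for every such k, and the angle condition becomes l - 2 + 1 - \<alpha> =
  0.\<close>

lemma singular_angle:
  assumes ang: "has_singular_angle p g \<alpha>" and pot: "potential_on UNIV (pull_phi g M) q p' s"
    and lim: "((\<lambda>z. z * q z) \<longlongrightarrow> - of_real l) at_infinity"
  shows "\<alpha> = l - 1"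
proof -
  from ang obtain c \<rho> h where \<rho>: "\<rho> > 0" and h: "h holomorphic_on ball 0 \<rho>" "inj_on h (ball 0 \<rho>)" "param c (h 0) = p"
    and lim_ang: "((\<lambda>r. 1 / (2 * pi) * integral {0..2 * pi} (\<lambda>\<theta>. r * deriv (\<lambda>s. g c (h (of_real s * cis \<theta>))
        + ln (norm (deriv h (of_real s * cis \<theta>)))) r + 1 - \<alpha>)) \<longlongrightarrow> 0) (at_right 0)"
    unfolding has_singular_angle_def Let_def by blast
  define N where "N = inv M"
  have N: "moebius N" unfolding N_def by (rule moebius_inv[OF M])
  \<comment> \<open>J is the coordinate 1/x near p, where x is the plane coordinate given by
    M.\<close>
  define J where "J = local_rep N c Inf"
  have oD: "open (chart_dom N c Inf)" and hJ: "J holomorphic_on chart_dom N c Inf"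
    unfolding J_def by (rule moebius_chart[OF N])+
  have h0D: "h 0 \<in> chart_dom N c Inf" by (simp add: chart_dom_def h(3) N_def inv_M_p range_param_Inf)
  have h0: "isCont h 0" using holomorphic_on_imp_continuous_on[OF h(1)] \<rho> by (simp add: continuous_on_eq_continuous_at)
  obtain e where e: "e > 0" "ball (h 0) e \<subseteq> chart_dom N c Inf" by (rule openE[OF oD h0D])
  from h0[unfolded continuous_at_eps_delta, rule_format, OF e(1)]
  obtain d where d0: "d > 0" "\<forall>z. dist z 0 < d \<longrightarrow> dist (h z) (h 0) < e" by (elim exE conjE)
  have hd: "h z \<in> chart_dom N c Inf" if "dist z 0 < d" for z
    by (rule subsetD[OF e(2)], simp only: mem_ball dist_commute[of "h 0"] d0(2)[rule_format, OF that])
  note d = d0(1) hd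
  define r0 where "r0 = min \<rho> d"
  define B where "B = ball (0::complex) r0"
  have r0: "r0 > 0" using \<rho> d by (simp add: r0_def)
  have B: "open B" "B \<subseteq> ball 0 \<rho>" and hB: "\<And>z. z \<in> B \<Longrightarrow> h z \<in> chart_dom N c Inf" using d by (auto simp: B_def r0_def)
  define k where "k = (\<lambda>z. J (h z))"
  have hk: "k holomorphic_on B"
    unfolding k_def using holomorphic_on_compose_gen[OF holomorphic_on_subset[OF h(1) B(2)] hJ] hB by (auto simp: o_def)
  have inj_k: "inj_on k B"
  proof (rule inj_onI)
    fix z w assume zw: "z \<in> B" "w \<in> B" "k z = k w"
    then have "h z = h w" using moebius_local_inj[OF N, of c Inf] hB by (auto simp: k_def J_def dest: inj_onD)
    then show "z = w" using h(2) zw B(2) by (auto dest: inj_onD)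
  qed
  have k0: "k 0 = 0" by (simp add: k_def J_def local_rep_def h(3) N_def inv_M_p)
  have B0: "0 \<in> B" using r0 by (simp add: B_def)
  have k'nz: "deriv k z \<noteq> 0" if "z \<in> B" for z
    by (rule holomorphic_injective_imp_regular[OF hk B(1) inj_k that])
  define V where "V = B - {0}"
  have V: "open V" using B(1) by (simp add: V_def open_delete)
  have knz: "k z \<noteq> 0" if "z \<in> V" for z
    using inj_k k0 B0 that unfolding V_def by (metis DiffD1 DiffD2 inj_onD singletonI)
  \<comment> \<open>\<tau> expresses the plane coordinate x through the local coordinate of the
    angle condition, away from the centre.\<close>
  define \<tau> where "\<tau> = (\<lambda>z. 1 / k z)"
  have hkV: "k holomorphic_on V" and hk'V: "deriv k holomorphic_on V"
    using hk holomorphic_on_subset holomorphic_deriv[OF hk B(1)] by (auto simp: V_def)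
  have h\<tau>: "\<tau> holomorphic_on V" unfolding \<tau>_def by (intro holomorphic_intros hkV knz)
  have dk: "(k has_field_derivative deriv k z) (at z)" and dk': "(deriv k has_field_derivative deriv (deriv k) z) (at z)"
    if "z \<in> V" for z using holomorphic_derivI[OF hkV V that] holomorphic_derivI[OF hk'V V that] .
  have \<tau>': "deriv \<tau> z = - deriv k z / (k z)\<^sup>2" if "z \<in> V" for z
    unfolding \<tau>_def by (rule DERIV_imp_deriv) (use knz[OF that] in \<open>auto intro!: derivative_eq_intros dk that simp: power2_eq_square\<close>)
  have \<tau>'nz: "deriv \<tau> z \<noteq> 0" if "z \<in> V" for z
    using \<tau>'[OF that] knz[OF that] k'nz that by (simp add: V_def)
  have \<tau>'': "deriv (deriv \<tau>) z / deriv \<tau> z = deriv (deriv k) z / deriv k z - 2 * deriv k z / k z" if z: "z \<in> V" for z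
  proof -
    have "((\<lambda>z. - deriv k z / (k z)\<^sup>2) has_field_derivative
        (- deriv (deriv k) z * (k z)\<^sup>2 + deriv k z * (2 * k z * deriv k z)) / ((k z)\<^sup>2 * (k z)\<^sup>2)) (at z)"
      using knz[OF z] by (auto intro!: derivative_eq_intros dk dk' z) (simp add: divide_simps)
    then have "(deriv \<tau> has_field_derivative
        (- deriv (deriv k) z * (k z)\<^sup>2 + deriv k z * (2 * k z * deriv k z)) / ((k z)\<^sup>2 * (k z)\<^sup>2)) (at z)"
      by (rule has_field_derivative_transform_within_open[OF _ V z]) (simp add: \<tau>')
    then have "deriv (deriv \<tau>) z = (- deriv (deriv k) z * (k z)\<^sup>2 + deriv k z * (2 * k z * deriv k z)) / ((k z)\<^sup>2 * (k z)\<^sup>2)"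
      by (rule DERIV_imp_deriv)
    moreover have "((- w * x\<^sup>2 + y * (2 * x * y)) / (x\<^sup>2 * x\<^sup>2)) / (- y / x\<^sup>2) = w / y - 2 * y / x"
      if "x \<noteq> 0" "y \<noteq> 0" for x y w :: complex
      using that by (simp add: divide_simps power2_eq_square algebra_simps)
    moreover have "deriv k z \<noteq> 0" using k'nz z by (simp add: V_def)
    ultimately show ?thesis using \<tau>'[OF z] knz[OF z] by (simp only: not_False_eq_True)
  qed
  have Mh: "M (Some (\<tau> z)) = param c (h z)" if z: "z \<in> V" for z
  proof -
    have "param Inf (k z) = N (param c (h z))"
      using local_rep_param[OF hB[of z]] z by (simp add: k_def J_def V_def)
    then have "N (param c (h z)) = Some (\<tau> z)" using knz[OF z] by (simp add: \<tau>_def)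
    then show ?thesis by (metis N_def inv_M(2))
  qed
  have psi: "g c (h z) + ln (norm (deriv h z)) = pull_phi g M (\<tau> z) + ln (norm (deriv \<tau> z))" if z: "z \<in> V" for z
  proof -
    let ?A = "local_rep M Std c"
    have dom: "\<tau> w \<in> chart_dom M Std c" if "w \<in> V" for w using Mh[OF that] by (simp add: chart_dom_def)
    have A: "?A (\<tau> w) = h w" if "w \<in> V" for w using Mh[OF that] by (simp add: local_rep_def)
    have "((\<lambda>w. ?A (\<tau> w)) has_field_derivative deriv ?A (\<tau> z) * deriv \<tau> z) (at z)"
      by (rule DERIV_chain2[OF local_rep_has_derivative[OF M dom[OF z]] holomorphic_derivI[OF h\<tau> V z]])
    then have "(h has_field_derivative deriv ?A (\<tau> z) * deriv \<tau> z) (at z)"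
      by (rule has_field_derivative_transform_within_open[OF _ V z]) (simp add: A)
    then have "deriv h z = deriv ?A (\<tau> z) * deriv \<tau> z" by (rule DERIV_imp_deriv)
    then show ?thesis
      using pull_phi_chart[OF dom[OF z]] A[OF z] \<tau>'nz[OF z] moebius_deriv_nonzero[OF M dom[OF z]]
      by (simp add: norm_mult ln_mult)
  qed
  define Q where "Q = (\<lambda>z. q (\<tau> z) * deriv \<tau> z + deriv (deriv \<tau>) z / deriv \<tau> z)"
  have dpsi: "((\<lambda>z. g c (h z) + ln (norm (deriv h z))) has_derivative (\<lambda>v. Re (Q z * v))) (at z)"
    and dQ: "isCont Q z" if z: "z \<in> V" for z
  proof -
    note PP = potential_pullback[OF V h\<tau> UNIV_I \<tau>'nz pot, unfolded potential_on_def]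
    have "((\<lambda>z. pull_phi g M (\<tau> z) + ln (norm (deriv \<tau> z))) has_derivative (\<lambda>v. Re (Q z * v))) (at z)"
      unfolding Q_def using bspec[OF conjunct2[OF PP] z] by blast
    then show "((\<lambda>z. g c (h z) + ln (norm (deriv h z))) has_derivative (\<lambda>v. Re (Q z * v))) (at z)"
      by (rule has_derivative_eq_on_open[OF V z, rotated]) (simp add: psi)
    show "isCont Q z" unfolding Q_def using bspec[OF conjunct2[OF PP] z] has_derivative_continuous by blast
  qed
  have Vball: "V = ball 0 r0 - {0}" by (simp add: V_def B_def)
  \<comment> \<open>z Q splits into - (x q(x)) (z k'/k) + z k''/k' - 2 z k'/k with x = 1/k. Here z
    k'/k tends to 1 and z k''/k' to 0 because k has a simple zero, so the limit is l - 2.\<close>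
  have limQ: "((\<lambda>z. z * Q z) \<longlongrightarrow> of_real (l - 2)) (at 0)"
  proof -
    have hkb: "k holomorphic_on ball 0 r0" using hk by (simp add: B_def)
    note L = log_derivative_limits[OF hkb r0 k0 k'nz[OF B0]]
    have evV: "\<forall>\<^sub>F z in at 0. z \<in> V"
      unfolding eventually_at Vball using r0 by (intro exI[of _ r0]) (auto simp: dist_commute)
    have "filterlim \<tau> at_infinity (at 0)"
    proof -
      have "isCont k 0" using holomorphic_on_imp_continuous_on[OF hk] B(1) B0 continuous_on_eq_continuous_at by blast
      then have "(k \<longlongrightarrow> 0) (at 0)" by (simp add: isCont_def k0)
      moreover have "\<forall>\<^sub>F z in at 0. k z \<noteq> 0" using evV by eventually_elim (rule knz)
      ultimately have "filterlim k (at 0) (at 0)" by (simp add: filterlim_at)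
      from filterlim_compose[OF filterlim_inverse_at_infinity this] show ?thesis by (simp add: \<tau>_def inverse_eq_divide)
    qed
    from filterlim_compose[OF lim this] have "((\<lambda>z. \<tau> z * q (\<tau> z)) \<longlongrightarrow> - of_real l) (at 0)" .
    then have "((\<lambda>z. - (\<tau> z * q (\<tau> z)) * (z * deriv k z / k z) + z * deriv (deriv k) z / deriv k z - 2 * (z * deriv k z / k z))
        \<longlongrightarrow> - (- of_real l) * 1 + 0 - 2 * 1) (at 0)"
      by (intro tendsto_intros L)
    moreover have "\<forall>\<^sub>F z in at 0. - (\<tau> z * q (\<tau> z)) * (z * deriv k z / k z) + z * deriv (deriv k) z / deriv k z - 2 * (z * deriv k z / k z) = z * Q z"
      using evV
    proof eventually_elim
      case (elim z)
      have "- (1 / x * Y) * (z * y / x) + z * w / y - 2 * (z * y / x) = z * (Y * (- y / x\<^sup>2) + (w / y - 2 * y / x))"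
        if "x \<noteq> 0" "y \<noteq> 0" for x y w Y :: complex
        using that by (simp add: divide_simps power2_eq_square algebra_simps)
      moreover have "deriv k z \<noteq> 0" using k'nz elim by (simp add: V_def)
      moreover have "Q z = q (1 / k z) * (- deriv k z / (k z)\<^sup>2) + (deriv (deriv k) z / deriv k z - 2 * deriv k z / k z)"
        unfolding Q_def \<tau>''[OF elim] unfolding \<tau>'[OF elim] by (simp only: \<tau>_def)
      ultimately show ?case using knz[OF elim] by (simp only: \<tau>_def not_False_eq_True)
    qed
    ultimately have "((\<lambda>z. z * Q z) \<longlongrightarrow> - (- of_real l) * 1 + 0 - 2 * 1) (at 0)" by (rule Lim_transform_eventually)
    then show ?thesis by simp
  qed
  have "((\<lambda>r. 1 / (2 * pi) * integral {0..2 * pi} (\<lambda>\<theta>. r * deriv (\<lambda>s. g c (h (of_real s * cis \<theta>))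
        + ln (norm (deriv h (of_real s * cis \<theta>)))) r + 1 - \<alpha>)) \<longlongrightarrow> (l - 2) + 1 - \<alpha>) (at_right 0)"
  proof (rule circle_average_limit[OF r0 _ _ limQ])
    show "continuous_on (ball 0 r0 - {0}) Q"
      unfolding Vball[symmetric] by (rule continuous_at_imp_continuous_on) (use dQ in blast)
    fix r \<theta> :: real assume r: "0 < r" "r < r0"
    have zV: "of_real r * cis \<theta> \<in> V" using r by (simp add: Vball norm_mult)
    have "((\<lambda>s. of_real s * cis \<theta>) has_derivative (\<lambda>x. of_real x * cis \<theta>)) (at r)"
      by (auto intro!: derivative_eq_intros)
    from has_derivative_compose[OF this dpsi[OF zV]]
    have "((\<lambda>s. g c (h (of_real s * cis \<theta>)) + ln (norm (deriv h (of_real s * cis \<theta>)))) has_derivative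
       (\<lambda>x. Re (Q (of_real r * cis \<theta>) * (of_real x * cis \<theta>)))) (at r)" .
    then have "((\<lambda>s. g c (h (of_real s * cis \<theta>)) + ln (norm (deriv h (of_real s * cis \<theta>)))) has_real_derivative
       Re (Q (of_real r * cis \<theta>) * cis \<theta>)) (at r)"
      unfolding has_field_derivative_def by (rule has_derivative_eq_rhs) (simp add: fun_eq_iff algebra_simps)
    then show "deriv (\<lambda>s. g c (h (of_real s * cis \<theta>)) + ln (norm (deriv h (of_real s * cis \<theta>)))) r =
       Re (Q (of_real r * cis \<theta>) * cis \<theta>)" by (rule DERIV_imp_deriv)
  qed
  from tendsto_unique[OF _ this lim_ang] show ?thesis by simp
qed

end

section \<open>The marked sphere as a plane metric\<close>

lemma moebius_to: "\<exists>M. moebius M \<and> M None = p"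
proof (cases p)
  case None
  have "moebius (mob 1 0 0 1)"
    unfolding moebius_def by (rule exI[of _ 1], rule exI[of _ 0], rule exI[of _ 0], rule exI[of _ 1]) simp
  then show ?thesis using None mob_affine(2) by metis
next
  case (Some a)
  then show ?thesis unfolding moebius_def
    by (intro exI[of _ "mob a 1 1 0"] conjI exI[of _ a] exI[of _ 1] exI[of _ 0]) (auto simp: mob_def hproj_def)
qed

locale hcmu_sphere = marked_metric +
  fixes \<alpha> :: real
  assumes hcmu: "non_csc_hcmu p \<alpha> g"

sublocale hcmu_sphere \<subseteq> H: hcmu_plane "pull_phi g M" "pull_K g M" "hcmu_field (pull_phi g M) (pull_K g M)"
  "deriv (hcmu_field (pull_phi g M) (pull_K g M))" "phi_deriv (pull_phi g M)" "wirtinger (phi_deriv (pull_phi g M))"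
proof (rule hcmu_plane_of_local)
  have eq: "hcmu_equation p g" and fin: "finite_area p g" and nc: "non_csc p g"
    using hcmu by (auto simp: non_csc_hcmu_def)
  show "\<exists>V f f' q p. open V \<and> z \<in> V \<and> hcmu_on V (pull_phi g M) (pull_K g M) f f' q p" for z
    by (rule pull_local[OF eq])
  show "integrable lborel (\<lambda>z. exp (2 * pull_phi g M z))" by (rule pull_area[OF eq fin])
  show "\<exists>z w. pull_K g M z \<noteq> pull_K g M w"
  proof (rule ccontr)
    assume a: "\<not> ?thesis"
    have "gauss_curv g s = pull_K g M 0" if s: "s \<noteq> p" for s
    proof -
      obtain x where "M (Some x) = s" using inv_M_Some[OF s] by blast
      then show ?thesis using a by (metis pull_K_def)
    qed
    then show False using nc unfolding non_csc_def by blast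
  qed
qed

context hcmu_sphere
begin

lemma area_total: "total_area p g = H.total"
  using hcmu pull_area(2) by (simp add: non_csc_hcmu_def H.total_def)

lemma angle:
  assumes "((\<lambda>z. z * phi_deriv (pull_phi g M) z) \<longlongrightarrow> - of_real l) at_infinity"
  shows "\<alpha> = l - 1"
proof (rule singular_angle[OF _ _ assms])
  show "has_singular_angle p g \<alpha>" using hcmu by (simp add: non_csc_hcmu_def)
  show "potential_on UNIV (pull_phi g M) (phi_deriv (pull_phi g M)) (wirtinger (phi_deriv (pull_phi g M)))
      (\<lambda>z. - (pull_K g M z * exp (2 * pull_phi g M z) / 2))"
    unfolding potential_on_def using H.dphi H.dq H.cont_p by blast
qed

text \<open>The value of K at p is its limit at infinity, which lies strictly between the attained
  values \<open>K1\<close> and \<open>K2\<close>; so all extremal points come from zeros of f. The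
  limit of z q gives \<alpha> as the degree of f minus one.\<close>

lemma many_zeros_saddle:
  assumes d: "degree H.F \<ge> 2"
  shows "p \<notin> extremal_points p g"
    "\<exists>n::nat. \<alpha> = real n \<and> n \<ge> 2 \<and>
           (\<exists>I1 I2. finite (max_points p g) \<and> card (max_points p g) = I1 \<and> I1 \<ge> 1 \<and>
                    finite (min_points p g) \<and> card (min_points p g) = I2 \<and> I2 \<ge> 1 \<and>
                    I1 > I2 \<and> I1 + I2 = n + 1 \<and>
                    (I2 = 1 \<or> (I2 \<ge> 2 \<and> \<not> I2 dvd I1)))"
proof -
  obtain l where l: "H.K2 < l" "l < H.K1" "(pull_K g M \<longlongrightarrow> l) at_infinity" using H.many_K_limit[OF d] by blast
  have cp: "curv_ext p g p = l" by (rule atin_marked[OF l(3)])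
  note mp = max_points_pull[OF cp]
  have "card H.Zmin \<ge> 1" "card H.Zmax \<ge> 1" using H.many_zeros[OF d] by auto
  then obtain zM zm where z: "pull_K g M zM = H.K1" "pull_K g M zm = H.K2"
    by (fastforce simp: H.Zmax_def H.Zmin_def card_gt_0_iff Suc_le_eq)
  have p: "p \<notin> max_points p g" "p \<notin> min_points p g"
    using mp(2,4) z l(1,2) by (metis not_less)+
  then show "p \<notin> extremal_points p g" by (simp add: extremal_points_def)
  have mx: "max_points p g = (\<lambda>x. M (Some x)) ` H.Zmax"
  proof -
    have "M (Some x) \<in> max_points p g \<longleftrightarrow> x \<in> H.Zmax" for x
      unfolding mp(1) H.Zmax_def mem_Collect_eq using z H.K_range(6) l(2) by (metis less_imp_le order_antisym)
    then show ?thesis using p(1) inv_M_Some by (auto simp: image_iff) metis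
  qed
  have mn: "min_points p g = (\<lambda>x. M (Some x)) ` H.Zmin"
  proof -
    have "M (Some x) \<in> min_points p g \<longleftrightarrow> x \<in> H.Zmin" for x
      unfolding mp(3) H.Zmin_def mem_Collect_eq using z H.K_range(5) l(1) by (metis less_imp_le order_antisym)
    then show ?thesis using p(2) inv_M_Some by (auto simp: image_iff) metis
  qed
  have inj: "inj_on (\<lambda>x. M (Some x)) A" for A
    using moebius_bij[OF M] by (auto simp: inj_on_def dest: bij_is_inj injD)
  define I1 I2 where "I1 = card H.Zmax" and "I2 = card H.Zmin"
  have I: "card (max_points p g) = I1" "card (min_points p g) = I2" "finite (max_points p g)" "finite (min_points p g)"
    using H.finite_Z by (simp_all add: mx mn card_image[OF inj] I1_def I2_def)
  have I12: "I2 \<ge> 1" "I1 > I2" "I2 dvd I1 \<Longrightarrow> I2 = 1" "degree H.F = I1 + I2"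
    using H.many_zeros[OF d] H.degree_F_card by (simp_all add: I1_def I2_def)
  have "\<alpha> = real (degree H.F) - 1" by (rule angle) (use H.many_q_limit[OF d] in simp)
  then have "\<alpha> = real (I1 + I2 - 1)" using I12 by simp
  then show "\<exists>n::nat. \<alpha> = real n \<and> n \<ge> 2 \<and>
           (\<exists>I1 I2. finite (max_points p g) \<and> card (max_points p g) = I1 \<and> I1 \<ge> 1 \<and>
                    finite (min_points p g) \<and> card (min_points p g) = I2 \<and> I2 \<ge> 1 \<and>
                    I1 > I2 \<and> I1 + I2 = n + 1 \<and>
                    (I2 = 1 \<or> (I2 \<ge> 2 \<and> \<not> I2 dvd I1)))"
    using I I12 by (intro exI[of _ "I1 + I2 - 1"] conjI exI[of _ I1] exI[of _ I2]) auto
qed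

text \<open>The zero of f carries one extreme value of K and p the other. The limit P'/(2 \<beta>) -
  1 of z q gives \<alpha> = b/a for \<beta> = -a, when p is the minimum, and \<alpha> = a/b for
  \<beta> = b, when p is the maximum. As b < a, these are the angles below and above 2 pi.\<close>

lemma single_zero_extremal:
  assumes d: "degree H.F = 1"
  shows "p \<in> extremal_points p g"
    "(\<exists>z0 c0. H.radial z0 (- H.a) c0 \<and> min_points p g = {p} \<and> \<alpha> < 1 \<and> \<alpha> = H.b / H.a \<and> H.total = pi / H.a * (H.K1 - H.K2)) \<or>
     (\<exists>z0 c0. H.b > 0 \<and> H.radial z0 H.b c0 \<and> max_points p g = {p} \<and> \<alpha> > 1 \<and> \<alpha> = H.a / H.b \<and> H.total = pi / H.b * (H.K1 - H.K2))"
proof -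
  have "p \<in> extremal_points p g \<and>
    ((\<exists>z0 c0. H.radial z0 (- H.a) c0 \<and> min_points p g = {p} \<and> \<alpha> < 1 \<and> \<alpha> = H.b / H.a \<and> H.total = pi / H.a * (H.K1 - H.K2)) \<or>
     (\<exists>z0 c0. H.b > 0 \<and> H.radial z0 H.b c0 \<and> max_points p g = {p} \<and> \<alpha> > 1 \<and> \<alpha> = H.a / H.b \<and> H.total = pi / H.b * (H.K1 - H.K2)))"
    using H.single_zero[OF d]
  proof (elim disjE conjE exE)
    fix z0 c0 assume r: "H.radial z0 (- H.a) c0" and z0: "pull_K g M z0 = H.K1"
    have a: "H.a > 0" by (rule H.ab)
    have cp: "curv_ext p g p = H.K2" using atin_marked[OF H.radial_K_limit[OF r]] a by simp
    note mp = max_points_pull[OF cp]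
    have pm: "p \<in> min_points p g" using mp(4) H.K_range(5) by blast
    have "M (Some x) \<notin> min_points p g" for x
      using mp(3) H.radial_strict[OF r, of x] z0 H.K_range(1) by (metis leD)
    then have mn: "min_points p g = {p}" using pm inv_M_Some by blast
    have "\<alpha> = - (H.P' H.K2 / (2 * (- H.a)) - 1) - 1"
      by (rule angle) (use H.radial_q_limit[OF r] a in \<open>simp only: neg_less_0_iff_less if_True minus_minus of_real_minus\<close>)
    then have al: "\<alpha> = H.b / H.a" using H.ab(5) a by simp
    then have "\<alpha> < 1" using H.ab(3) a by simp
    moreover have "H.total = pi / H.a * (H.K1 - H.K2)" using H.radial_area[OF r] a z0 by (simp add: field_simps)
    ultimately show ?thesis using pm mn r al by (auto simp: extremal_points_def)
  next
    fix z0 c0 assume b: "H.b > 0" and r: "H.radial z0 H.b c0" and z0: "pull_K g M z0 = H.K2"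
    have cp: "curv_ext p g p = H.K1" using atin_marked[OF H.radial_K_limit[OF r]] b by simp
    note mp = max_points_pull[OF cp]
    have pm: "p \<in> max_points p g" using mp(2) H.K_range(6) by blast
    have "M (Some x) \<notin> max_points p g" for x
      using mp(1) H.radial_strict[OF r, of x] z0 H.K_range(1) by (metis leD)
    then have mx: "max_points p g = {p}" using pm inv_M_Some by blast
    have "\<alpha> = (1 - H.P' H.K1 / (2 * H.b)) - 1"
      by (rule angle) (use H.radial_q_limit[OF r] b in simp)
    then have al: "\<alpha> = H.a / H.b" using H.ab(4) b by simp
    then have "\<alpha> > 1" using H.ab(3) b by simp
    moreover have "H.total = pi / H.b * (H.K1 - H.K2)" using H.radial_area[OF r] b z0 by simp
    ultimately show ?thesis using pm mx r al b by (auto simp: extremal_points_def)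
  qed
  then show "p \<in> extremal_points p g"
    "(\<exists>z0 c0. H.radial z0 (- H.a) c0 \<and> min_points p g = {p} \<and> \<alpha> < 1 \<and> \<alpha> = H.b / H.a \<and> H.total = pi / H.a * (H.K1 - H.K2)) \<or>
     (\<exists>z0 c0. H.b > 0 \<and> H.radial z0 H.b c0 \<and> max_points p g = {p} \<and> \<alpha> > 1 \<and> \<alpha> = H.a / H.b \<and> H.total = pi / H.b * (H.K1 - H.K2))"
    by blast+
qed

text \<open>Put s = K1 - K0 and t = K2 - K0, so that a and b are s and t times (K1 - K2)/12. The
  factor K1 - K2 cancels: \<alpha> is t/s or s/t, and the area is 12 pi/s or 12 pi/t. These two
  linear equations determine \<open>K1\<close> and \<open>K2\<close>.\<close>

lemma extremal_values:
  assumes d: "degree H.F = 1"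
  shows "(\<alpha> < 1 \<longrightarrow> H.total > 0 \<and> 2 * H.K1 + H.K2 = 12 * pi / H.total \<and> H.K1 + 2 * H.K2 = \<alpha> * (12 * pi / H.total)) \<and>
         (\<alpha> > 1 \<longrightarrow> H.total > 0 \<and> H.K1 + 2 * H.K2 = 12 * pi / H.total \<and> 2 * H.K1 + H.K2 = \<alpha> * (12 * pi / H.total))"
proof -
  define s t where "s = 2 * H.K1 + H.K2" and "t = H.K1 + 2 * H.K2"
  have D: "H.K1 - H.K2 > 0" using H.K_range(1) by simp
  have ab: "H.a = s * (H.K1 - H.K2) / 12" "H.b = t * (H.K1 - H.K2) / 12"
    by (simp_all add: H.a_def H.b_def H.K0_def s_def t_def)
  have s: "s > 0" using H.ab(1) D by (simp add: ab zero_less_mult_iff)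
  show ?thesis
    using single_zero_extremal(2)[OF d]
  proof (elim disjE exE conjE)
    assume a: "\<alpha> < 1" "\<alpha> = H.b / H.a" "H.total = pi / H.a * (H.K1 - H.K2)"
    have "H.total = 12 * pi / s" using a(3) s D by (simp add: ab)
    moreover have "\<alpha> = t / s" using a(2) s D by (simp add: ab)
    ultimately show ?thesis using a(1) s by (simp add: s_def[symmetric] t_def[symmetric])
  next
    assume a: "\<alpha> > 1" "\<alpha> = H.a / H.b" "H.total = pi / H.b * (H.K1 - H.K2)" "H.b > 0"
    have t: "t > 0" using a(4) D by (simp add: ab zero_less_mult_iff)
    have "H.total = 12 * pi / t" using a(3) t D by (simp add: ab)
    moreover have "\<alpha> = s / t" using a(2) t D by (simp add: ab)
    ultimately show ?thesis using a(1) t by (simp add: s_def[symmetric] t_def[symmetric])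
  qed
qed

lemma extremal_degree: "p \<in> extremal_points p g \<Longrightarrow> degree H.F = 1"
  using many_zeros_saddle(1) H.F_degree by (cases "degree H.F \<ge> 2") auto

end

lemma hcmu_sphere_exists: "non_csc_hcmu p \<alpha> g \<Longrightarrow> \<exists>M. hcmu_sphere p g M \<alpha>"
proof -
  assume a: "non_csc_hcmu p \<alpha> g"
  obtain M where "moebius M" "M None = p" using moebius_to by blast
  then show ?thesis using a by (intro exI[of _ M]) (unfold_locales, auto simp: non_csc_hcmu_def)
qed

section \<open>Uniqueness and rotational symmetry of radial metrics\<close>

locale hcmu_sphere_pair = A: hcmu_sphere p g M \<alpha> + B: hcmu_sphere p' g' M' \<alpha>
  for p g M \<alpha> p' g' M'

sublocale hcmu_sphere_pair \<subseteq> AB: hcmu_plane_pair "pull_phi g M" "pull_K g M" "hcmu_field (pull_phi g M) (pull_K g M)"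
  "deriv (hcmu_field (pull_phi g M) (pull_K g M))" "phi_deriv (pull_phi g M)" "wirtinger (phi_deriv (pull_phi g M))"
  "pull_phi g' M'" "pull_K g' M'" "hcmu_field (pull_phi g' M') (pull_K g' M')"
  "deriv (hcmu_field (pull_phi g' M') (pull_K g' M'))" "phi_deriv (pull_phi g' M')" "wirtinger (phi_deriv (pull_phi g' M'))"
  ..

context hcmu_sphere_pair
begin

lemma radial_affine_isometry:
  assumes rA: "A.H.radial x0 \<beta> c" and rB: "B.H.radial y0 \<beta> d"
    and K: "A.H.K1 = B.H.K1" "A.H.K2 = B.H.K2"
    and \<mu>: "\<mu> \<noteq> 0" "ln (norm \<mu>) / \<beta> + d = c"
  shows "isometry p g p' g' (M' \<circ> mob \<mu> (y0 - \<mu> * x0) 0 1 \<circ> inv M)"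
proof (rule affine_isometry[OF A.marked_metric_axioms B.marked_metric_axioms \<mu>(1)])
  fix x
  have "\<mu> * x + (y0 - \<mu> * x0) = y0 + \<mu> * (x - x0)" by (simp add: algebra_simps)
  then show "pull_phi g' M' (\<mu> * x + (y0 - \<mu> * x0)) + ln (norm \<mu>) = pull_phi g M x"
    using AB.radial_isometry[OF rA rB K \<mu>, of x] by (simp only:)
qed

lemma radial_isometric:
  assumes rA: "A.H.radial x0 \<beta> c" and rB: "B.H.radial y0 \<beta> d"
    and K: "A.H.K1 = B.H.K1" "A.H.K2 = B.H.K2"
  shows "isometric p g p' g'"
proof -
  \<comment> \<open>The positive dilation that solves ln |\<mu>|/\<beta> + d = c.\<close>
  define \<mu> where "\<mu> = complex_of_real (exp (\<beta> * (c - d)))"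
  have "\<beta> \<noteq> 0" using rA by (simp add: A.H.radial_def)
  then have "\<mu> \<noteq> 0" "ln (norm \<mu>) / \<beta> + d = c" by (simp_all add: \<mu>_def)
  from radial_affine_isometry[OF rA rB K this] show ?thesis unfolding isometric_def by blast
qed

text \<open>The common angle decides which extremum sits at the marked point, so both metrics fall
  under the same alternative. Angle and area then fix the roots, and with them the slope
  \<beta>.\<close>

lemma single_zero_isometric:
  assumes d: "degree A.H.F = 1" "degree B.H.F = 1" and area: "A.H.total = B.H.total"
  shows "isometric p g p' g'"
proof -
  note EA = A.extremal_values[OF d(1)] and EB = B.extremal_values[OF d(2)]
  show ?thesis
    using A.single_zero_extremal(2)[OF d(1)]
  proof (elim disjE exE conjE)
    fix x0 c assume r: "A.H.radial x0 (- A.H.a) c" and al: "\<alpha> < 1"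
    obtain y0 e where rB: "B.H.radial y0 (- B.H.a) e" using B.single_zero_extremal(2)[OF d(2)] al by fastforce
    have K: "A.H.K1 = B.H.K1" "A.H.K2 = B.H.K2" using EA EB al area by simp_all
    then have "A.H.a = B.H.a" by (simp add: A.H.a_def B.H.a_def A.H.K0_def B.H.K0_def)
    then show ?thesis using radial_isometric[OF r _ K] rB by simp
  next
    fix x0 c assume r: "A.H.radial x0 A.H.b c" and al: "\<alpha> > 1"
    obtain y0 e where rB: "B.H.radial y0 B.H.b e" using B.single_zero_extremal(2)[OF d(2)] al by fastforce
    have K: "A.H.K1 = B.H.K1" "A.H.K2 = B.H.K2" using EA EB al area by simp_all
    then have "A.H.b = B.H.b" by (simp add: A.H.b_def B.H.b_def A.H.K0_def B.H.K0_def)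
    then show ?thesis using radial_isometric[OF r _ K] rB by simp
  qed
qed

end

context hcmu_sphere
begin

text \<open>The comparison of two radial metrics is applied to the metric and itself with \<mu> =
  cis \<theta>, which has modulus 1 and leaves the constant \<open>c0\<close> unchanged. The map h
  moves \<open>z0\<close> to 0 and the marked point to infinity.\<close>

lemma radial_rotationally_symmetric:
  assumes r: "H.radial z0 \<beta> c0"
  shows "rotationally_symmetric p g"
proof -
  interpret S: hcmu_sphere_pair p g M \<alpha> p g M ..
  define T where "T = mob 1 (- z0) 0 1"
  define h where "h = T \<circ> inv M"
  have T: "moebius T" unfolding T_def moebius_def by (intro exI[of _ 1] exI[of _ "- z0"] exI[of _ 0]) auto
  have h: "moebius h" unfolding h_def by (intro moebius_comp T moebius_inv M)
  have "isometry p g p g (inv h \<circ> rotation \<theta> \<circ> h)" for \<theta>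
  proof -
    have "inv h = M \<circ> mob 1 z0 0 1"
    proof
      fix s
      have "h (M (mob 1 z0 0 1 s)) = s"
        by (cases s) (simp_all add: h_def T_def mob_affine)
      then show "inv h s = (M \<circ> mob 1 z0 0 1) s" using moebius_bij[OF h] by (metis bij_is_inj comp_apply inv_f_f)
    qed
    then have "inv h \<circ> rotation \<theta> \<circ> h = M \<circ> (mob 1 z0 0 1 \<circ> rotation \<theta> \<circ> T) \<circ> inv M"
      by (simp add: h_def o_assoc)
    also have "mob 1 z0 0 1 \<circ> rotation \<theta> \<circ> T = mob (cis \<theta>) (z0 - cis \<theta> * z0) 0 1"
    proof
      fix s show "(mob 1 z0 0 1 \<circ> rotation \<theta> \<circ> T) s = mob (cis \<theta>) (z0 - cis \<theta> * z0) 0 1 s"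
        by (cases s) (simp_all add: T_def mob_affine rotation_def algebra_simps)
    qed
    finally have "inv h \<circ> rotation \<theta> \<circ> h = M \<circ> mob (cis \<theta>) (z0 - cis \<theta> * z0) 0 1 \<circ> inv M" .
    moreover have "isometry p g p g (M \<circ> mob (cis \<theta>) (z0 - cis \<theta> * z0) 0 1 \<circ> inv M)"
      by (rule S.radial_affine_isometry[OF r r refl refl]) simp_all
    ultimately show ?thesis by (simp only:)
  qed
  then show ?thesis unfolding rotationally_symmetric_def using moebius_biholomorphic[OF h] by blast
qed

end

theorem theorem1p5:
  fixes \<alpha> :: real and p :: sphere and g :: conf_metric
  assumes "\<alpha> \<ge> 0" and "\<alpha> \<noteq> 1"
    and "non_csc_hcmu p \<alpha> g"
  shows
    "(p \<in> extremal_points p g \<longrightarrow>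
        rotationally_symmetric p g \<and>
        (\<forall>p' g'. non_csc_hcmu p' \<alpha> g' \<and> p' \<in> extremal_points p' g' \<and>
                 total_area p' g' = total_area p g \<longrightarrow> isometric p g p' g') \<and>
        (\<alpha> < 1 \<longrightarrow> min_points p g = {p}) \<and>
        (\<alpha> > 1 \<longrightarrow> max_points p g = {p})) \<and>
     (p \<in> saddle_points p g \<longrightarrow>
        (\<exists>n::nat. \<alpha> = real n \<and> n \<ge> 2 \<and>
           (\<exists>I1 I2. finite (max_points p g) \<and> card (max_points p g) = I1 \<and> I1 \<ge> 1 \<and>
                    finite (min_points p g) \<and> card (min_points p g) = I2 \<and> I2 \<ge> 1 \<and>
                    I1 > I2 \<and> I1 + I2 = n + 1 \<and>
                    (I2 = 1 \<or> (I2 \<ge> 2 \<and> \<not> I2 dvd I1)))))"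
proof -
  obtain M where "hcmu_sphere p g M \<alpha>" using hcmu_sphere_exists[OF assms(3)] by blast
  then interpret A: hcmu_sphere p g M \<alpha> .
  have iso: "isometric p g p' g'"
    if e: "p \<in> extremal_points p g" "non_csc_hcmu p' \<alpha> g'" "p' \<in> extremal_points p' g'" "total_area p' g' = total_area p g" for p' g'
  proof -
    obtain M' where "hcmu_sphere p' g' M' \<alpha>" using hcmu_sphere_exists[OF e(2)] by blast
    then interpret B: hcmu_sphere p' g' M' \<alpha> .
    interpret AB: hcmu_sphere_pair p g M \<alpha> p' g' M' ..
    show ?thesis
      using AB.single_zero_isometric[OF A.extremal_degree B.extremal_degree] e A.area_total B.area_total by simp
  qed
  show ?thesis
  proof (intro conjI impI)
    assume p: "p \<in> extremal_points p g"
    note S = A.single_zero_extremal(2)[OF A.extremal_degree[OF p]]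
    show "rotationally_symmetric p g" using S A.radial_rotationally_symmetric by blast
    show "\<forall>p' g'. non_csc_hcmu p' \<alpha> g' \<and> p' \<in> extremal_points p' g' \<and>
                 total_area p' g' = total_area p g \<longrightarrow> isometric p g p' g'"
      using iso[OF p] by blast
    show "min_points p g = {p}" if "\<alpha> < 1" using S that by (elim disjE exE conjE) auto
    show "max_points p g = {p}" if "\<alpha> > 1" using S that by (elim disjE exE conjE) auto
  next
    assume "p \<in> saddle_points p g"
    then have "p \<notin> extremal_points p g" by (simp add: saddle_points_def)
    \<comment> \<open>A single zero would make p an extremal point.\<close>
    then have "degree A.H.F \<noteq> 1" using A.single_zero_extremal(1) by blast
    then have "degree A.H.F \<ge> 2" using A.H.F_degree by linarith
    then show "\<exists>n::nat. \<alpha> = real n \<and> n \<ge> 2 \<and>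
           (\<exists>I1 I2. finite (max_points p g) \<and> card (max_points p g) = I1 \<and> I1 \<ge> 1 \<and>
                    finite (min_points p g) \<and> card (min_points p g) = I2 \<and> I2 \<ge> 1 \<and>
                    I1 > I2 \<and> I1 + I2 = n + 1 \<and>
                    (I2 = 1 \<or> (I2 \<ge> 2 \<and> \<not> I2 dvd I1)))" by (rule A.many_zeros_saddle(2))
  qed
qed

end
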